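(* The regular genus of the $4$-dimensional torus is $16$, i.e. $\mathcal{G}(\mathbb{S}^1\times\mathbb{S}^1\times\mathbb{S}^1\times\mathbb{S}^1)=16$. Moreover, this value is attained by a crystallization of $\mathbb{S}^1\times\mathbb{S}^1\times\mathbb{S}^1\times\mathbb{S}^1$ with $120$ vertices, i.e. there is a $120$-vertex crystallization $\Gamma$ of $\mathbb{S}^1\times\mathbb{S}^1\times\mathbb{S}^1\times\mathbb{S}^1$ with $\rho(\Gamma)=16$.
   Context: All manifolds and maps are in the PL category. An $(n+1)$-regular colored graph $(\Gamma,\gamma)$ is a finite multigraph without loops, regular of degree $n+1$, together with a proper edge-coloring $\gamma:E(\Gamma)\to\Delta_n=\{0,1,\dots,n\}$ (adjacent edges get different colors). For $\mathcal C\subseteq\Delta_n$, $\Gamma_{\mathcal C}$ is the spanning subgraph with edges of colors in $\mathcal C$, and $g_{\mathcal C}$ is its number of connected components. From $\Gamma$ one builds an $n$-dimensional simplicial cell complex $\mathcal K(\Gamma)$: take an $n$-simplex $\sigma(v)$ with vertices labeled by $\Delta_n$ for each vertex $v$, and for each $j$-colored edge $v_1v_2$ identify the $(n-1)$-faces of $\sigma(v_1),\sigma(v_2)$ opposite to their $j$-labeled vertices, matching equally labeled vertices. $\Gamma$ is a gem of a closed $n$-manifold $M$ if $|\mathcal K(\Gamma)|$ is PL homeomorphic to $M$; it is a crystallization of $M$ if moreover $\Gamma_{\Delta_n\setminus\{j\}}$ is connected for every $j$. For a gem $\Gamma$ of a closed connected $n$-manifold ($n\ge 3$) and a cyclic permutation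 $\varepsilon=(\varepsilon_0,\dots,\varepsilon_n)$ of $\Delta_n$, set $\chi_\varepsilon(\Gamma)=\sum_{i\in\mathbb Z_{n+1}} g_{\{\varepsilon_i,\varepsilon_{i+1}\}}+(1-n)\frac{|V(\Gamma)|}{2}$ and $\rho_\varepsilon(\Gamma)=1-\chi_\varepsilon(\Gamma)/2$. The regular genus of $\Gamma$ is $\rho(\Gamma)=\min_\varepsilon\rho_\varepsilon(\Gamma)$, and the regular genus of $M$ is $\mathcal G(M)=\min\{\rho(\Gamma): \Gamma \text{ a gem of } M\}$. *)

theory Defs
  imports "HOL-Analysis.Analysis"
begin

text \<open>An (n+1)-regular colored graph with colour set the finite type 'c
  (so n+1 = CARD('c)) is encoded by, for every colour c, the map sending a
  vertex to the other endpoint of its unique c-coloured edge.  Regularity,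
  properness of the colouring and absence of loops amount to: each such map
  is a fixed-point-free involution of the vertex set.  Multiple edges are
  allowed (different colours may give the same neighbour).\<close>

definition colored_graph :: "'v set \<Rightarrow> ('c \<Rightarrow> 'v \<Rightarrow> 'v) \<Rightarrow> bool" where
  "colored_graph V adj \<longleftrightarrow> finite V \<and>
     (\<forall>c v. v \<in> V \<longrightarrow> adj c v \<in> V \<and> adj c v \<noteq> v \<and> adj c (adj c v) = v)"

definition comp_rel :: "'v set \<Rightarrow> ('c \<Rightarrow> 'v \<Rightarrow> 'v) \<Rightarrow> 'c set \<Rightarrow> ('v \<times> 'v) set" where
  "comp_rel V adj C = {(v, w). v \<in> V \<and> w \<in> V \<and>
      (v, w) \<in> rtrancl {(x, adj c x) | x c. x \<in> V \<and> c \<in> C}}"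

definition g_comp :: "'v set \<Rightarrow> ('c \<Rightarrow> 'v \<Rightarrow> 'v) \<Rightarrow> 'c set \<Rightarrow> nat" where
  "g_comp V adj C = card (V // comp_rel V adj C)"

text \<open>A cyclic permutation epsilon = (epsilon_0,...,epsilon_n) of the colours is
  a bijection e from {0..n} = {..<CARD('c)} onto the colours; indices mod n+1.\<close>
definition chi_eps :: "'v set \<Rightarrow> ('c::finite \<Rightarrow> 'v \<Rightarrow> 'v) \<Rightarrow> (nat \<Rightarrow> 'c) \<Rightarrow> real" where
  "chi_eps V adj e =
     (\<Sum>i<CARD('c). real (g_comp V adj {e i, e ((i + 1) mod CARD('c))}))
     + (1 - (real CARD('c) - 1)) * real (card V) / 2"

definition rho_eps :: "'v set \<Rightarrow> ('c::finite \<Rightarrow> 'v \<Rightarrow> 'v) \<Rightarrow> (nat \<Rightarrow> 'c) \<Rightarrow> real" where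
  "rho_eps V adj e = 1 - chi_eps V adj e / 2"

definition reg_genus_graph :: "'v set \<Rightarrow> ('c::finite \<Rightarrow> 'v \<Rightarrow> 'v) \<Rightarrow> real" where
  "reg_genus_graph V adj =
     Min ((\<lambda>e. rho_eps V adj e) ` {e. bij_betw e {..<CARD('c)} (UNIV :: 'c set)})"

text \<open>Standard simplex with vertices labelled by the colours (barycentric
  coordinates); the facet opposite the j-labelled vertex is x$j = 0.\<close>
definition std_simplex :: "(real^'c::finite) set" where
  "std_simplex = {x. (\<forall>i. 0 \<le> x$i) \<and> (\<Sum>i\<in>UNIV. x$i) = 1}"

text \<open>The 4-torus S^1 x S^1 x S^1 x S^1, as a subset of C^4, with its
  standard PL structure coming from the covering map R^4 -> T^4.\<close>
definition torus4 :: "(complex^4) set" where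
  "torus4 = {z. \<forall>i. norm (z$i) = 1}"

definition torus_cover :: "real^4 \<Rightarrow> complex^4" where
  "torus_cover x = (\<chi> i. cis (2 * pi * x$i))"

definition pl_simplex_to_torus4 :: "(real^'c::finite \<Rightarrow> complex^4) \<Rightarrow> bool" where
  "pl_simplex_to_torus4 f \<longleftrightarrow>
     (\<exists>h :: real^'c \<Rightarrow> real^4.
        (\<forall>x\<in>std_simplex. torus_cover (h x) = f x) \<and>
        (\<exists>T. finite T \<and> \<Union>T = std_simplex \<and>
             (\<forall>t\<in>T. (\<exists>F. finite F \<and> t = convex hull F) \<and>
                     (\<exists>L b. linear L \<and> (\<forall>x\<in>t. h x = L x + b)))))"

text \<open>Elementary identifications of K(Gamma): for a j-coloured edge v w, the
  point x of the facet of sigma(v) opposite its j-vertex is glued to the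
  point with the same barycentric coordinates in sigma(w).\<close>
definition K_ident :: "'v set \<Rightarrow> ('c::finite \<Rightarrow> 'v \<Rightarrow> 'v) \<Rightarrow> (('v \<times> (real^'c)) \<times> ('v \<times> (real^'c))) set" where
  "K_ident V adj = {((v, x), (w, y)). v \<in> V \<and> x \<in> std_simplex \<and>
       (\<exists>j. w = adj j v \<and> x$j = 0) \<and> y = x}"

text \<open>|K(Gamma)| is PL homeomorphic to T^4: there is a family of PL maps on the
  simplices sigma(v), compatible with the identifications, inducing a
  bijection from the quotient |K(Gamma)| onto T^4 (a continuous bijection
  from a compact space onto a Hausdorff space is a homeomorphism, and
  the inverse of a PL homeomorphism of compact polyhedra is PL).\<close>
definition K_PL_homeomorphic_T4 :: "'v set \<Rightarrow> ('c::finite \<Rightarrow> 'v \<Rightarrow> 'v) \<Rightarrow> bool" where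
  "K_PL_homeomorphic_T4 V adj \<longleftrightarrow>
     (\<exists>f :: 'v \<Rightarrow> real^'c \<Rightarrow> complex^4.
        (\<forall>v\<in>V. pl_simplex_to_torus4 (f v)) \<and>
        (\<forall>v\<in>V. \<forall>x\<in>std_simplex. f v x \<in> torus4) \<and>
        (\<forall>v x w y. ((v, x), (w, y)) \<in> K_ident V adj \<longrightarrow> f v x = f w y) \<and>
        torus4 \<subseteq> (\<Union>v\<in>V. f v ` std_simplex) \<and>
        (\<forall>v\<in>V. \<forall>w\<in>V. \<forall>x\<in>std_simplex. \<forall>y\<in>std_simplex.
            f v x = f w y \<longrightarrow> ((v, x), (w, y)) \<in> rtrancl (K_ident V adj)))"

definition gem_T4 :: "'v set \<Rightarrow> (5 \<Rightarrow> 'v \<Rightarrow> 'v) \<Rightarrow> bool" where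
  "gem_T4 V adj \<longleftrightarrow> colored_graph V adj \<and> K_PL_homeomorphic_T4 V adj"

definition crystallization_T4 :: "'v set \<Rightarrow> (5 \<Rightarrow> 'v \<Rightarrow> 'v) \<Rightarrow> bool" where
  "crystallization_T4 V adj \<longleftrightarrow> gem_T4 V adj \<and>
     (\<forall>j. g_comp V adj (UNIV - {j}) = 1)"

text \<open>Regular genus of T^4: infimum of rho(Gamma) over all gems (vertex sets
  taken inside nat, which loses nothing since gems are finite).\<close>
definition regular_genus_T4 :: real where
  "regular_genus_T4 = Inf {reg_genus_graph V adj | (V :: nat set) (adj :: 5 \<Rightarrow> nat \<Rightarrow> nat).
                              gem_T4 V adj}"

end

theory Submission
  imports Defs
begin

text \<open>
  Lower bound. For a gem with colour classes in the cyclic order \<open>\<epsilon>\<close>, the genus \<open>\<rho>\<^sub>\<epsilon>\<close> is a combination of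
  three inputs. The bicoloured and three-coloured residues satisfy an inequality saying that a
  connected closed surface has Euler characteristic at most 2. The alternating sum of all residue
  numbers, the Euler characteristic of the complex, vanishes: cutting the simplices into relatively
  open convex cells on which the lift to \<open>\<real>\<^sup>4\<close> is affine and stays in one unit cube, both the open faces
  and the half-open cube are recombined from the same cells, and the signed count \<open>(-1)\<^bsup>dim\<^esup>\<close> is a
  valuation. Finally, the graph spanned by the vertices with two given labels carries the whole first
  cohomology of the torus, so that its cycle rank is at least 4.

  Realization. The quotient of the affine Coxeter complex of type \<open>A\<^sub>4\<close> by the root lattice is a torus
  with 120 alcoves, indexed by the symmetric group; its coloured dual graph is the Cayley graph with
  respect to the five cyclically adjacent transpositions. For the order of colours in which neighbours
  commute, all bicoloured cycles have length 4 and the genus is 16.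
\<close>

text \<open>The obstacle is that a gem is given only by piecewise affine lifts, one for each
  simplex, which agree across a facet up to an integer vector. Images of simplices are not convex,
  and no homology is set up. A real cohomology class therefore appears as a linear functional on
  R^4, and its being a coboundary as a choice of one correcting constant per simplex. Let p be the
  number of vertices and A the sum of the residue numbers over the five cyclically consecutive
  colour pairs. The surface inequality is needed for all ten colour triples: the consecutive ones
  carry twice the weight of the others, so that the nonconsecutive pairs cancel after the Euler
  relation has removed the consecutive triples. The cycle rank bound is applied to the five
  nonconsecutive label pairs, each time with the constant 3 = 4 - 1, the rank less one for
  connectedness. The outcome is 2 A <= 3 p - 60, and this is where 16 = 1 + 5 * 3 comes
  from.\<close>

section \<open>An Euler relation for relatively open convex sets\<close>

text \<open>Sum over all breakpoints the drop from the value at \<open>t\<close> to the value just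
  after \<open>t\<close>. A point drops once by \<open>m\<close>; an open interval shows only the
  rise at its left end, being already absent at its right end. This yields the Euler characteristics
  1 and -1.\<close>

lemma jump_count:
  fixes J :: "'i \<Rightarrow> real set" and m :: "'i \<Rightarrow> int"
  assumes fin: "finite I"
    and point: "\<And>i. i \<in> I \<Longrightarrow> p i \<Longrightarrow> J i = {a i}"
    and interval: "\<And>i. i \<in> I \<Longrightarrow> \<not> p i \<Longrightarrow> a i < b i \<and> J i = {a i<..<b i}"
    and zero: "\<And>t. (\<Sum>i\<in>I. if t \<in> J i then m i else 0) = 0"
  shows "(\<Sum>i\<in>I. if p i then m i else - m i) = 0"
proof -
  define D where "D = a ` I \<union> b ` I"
  have finD: "finite D" using fin by (simp add: D_def)
  \<comment> \<open>With \<open>e\<close> below every gap between breakpoints, \<open>t + e\<close>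
    is never a breakpoint and samples the value just to the right of \<open>t\<close>.\<close>
  obtain e where e: "e > 0" "\<And>s t. s \<in> D \<Longrightarrow> t \<in> D \<Longrightarrow> s < t \<Longrightarrow> e < t - s"
  proof -
    define E where "E = insert 1 ((\<lambda>(s,t). t - s) ` {(s,t) \<in> D \<times> D. s < t})"
    have "finite {(s,t) \<in> D \<times> D. s < t}"
      by (rule finite_subset[of _ "D \<times> D"]) (use finD in auto)
    then have E: "finite E" "E \<noteq> {}" "\<And>x. x \<in> E \<Longrightarrow> x > 0"
      by (auto simp: E_def)
    then have M: "Min E > 0" by simp
    have le: "Min E \<le> t - s" if "s \<in> D" "t \<in> D" "s < t" for s t
      using that E(1) by (intro Min_le) (auto simp: E_def image_iff)
    show ?thesis
      using M le by (intro that[of "Min E / 2"]) fastforce+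
  qed
  have jump: "(\<Sum>t\<in>D. (if t \<in> J i then m i else 0) - (if t + e \<in> J i then m i else 0))
      = (if p i then m i else - m i)" if i: "i \<in> I" for i
  proof -
    have aD: "a i \<in> D" and bD: "b i \<in> D" using i by (auto simp: D_def)
    show ?thesis
    proof (cases "p i")
      case True
      have no: "t + e \<noteq> a i" if "t \<in> D" for t
        using e(1) e(2)[OF that aD] by force
      have "(\<Sum>t\<in>D. (if t \<in> J i then m i else 0) - (if t + e \<in> J i then m i else 0))
          = (\<Sum>t\<in>D. if t = a i then m i else 0)"
        using no point[OF i True] by (intro sum.cong) auto
      then show ?thesis using finD aD True by simp
    next
      case False
      have J: "J i = {a i<..<b i}" and ab: "a i < b i" using interval[OF i False] by auto
      have 1: "t + e > a i \<longleftrightarrow> t \<ge> a i" if "t \<in> D" for t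
        using e(1) e(2)[OF that aD] by force
      have 2: "t + e < b i \<longleftrightarrow> t < b i" if "t \<in> D" for t
        using e(1) e(2)[OF that bD] by force
      have "(\<Sum>t\<in>D. (if t \<in> J i then m i else 0) - (if t + e \<in> J i then m i else 0))
          = (\<Sum>t\<in>D. if t = a i then - m i else 0)"
        using 1 2 J ab by (intro sum.cong) auto
      then show ?thesis using finD aD False by simp
    qed
  qed
  have "(\<Sum>i\<in>I. if p i then m i else - m i)
     = (\<Sum>i\<in>I. \<Sum>t\<in>D. (if t \<in> J i then m i else 0) - (if t + e \<in> J i then m i else 0))"
    by (intro sum.cong refl) (simp add: jump)
  also have "\<dots> = (\<Sum>t\<in>D. \<Sum>i\<in>I. (if t \<in> J i then m i else 0) - (if t + e \<in> J i then m i else 0))"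
    by (rule sum.swap)
  also have "\<dots> = 0" by (simp add: sum_subtractf zero)
  finally show ?thesis .
qed

lemma rel_open_real_cases:
  fixes J :: "real set"
  assumes "convex J" "rel_open J" "bounded J" "J \<noteq> {}" "\<And>a. J \<noteq> {a}"
  obtains a b where "a < b" "J = {a<..<b}"
proof -
  have "aff_dim J \<noteq> 0" using assms(5) by (auto simp: aff_dim_eq_0)
  moreover have "aff_dim J \<noteq> -1" using assms(4) by (simp add: aff_dim_empty)
  moreover have "aff_dim J \<ge> -1" by (rule aff_dim_geq)
  moreover have "aff_dim J \<le> 1" using aff_dim_le_DIM[of J] by simp
  ultimately have "aff_dim J = DIM(real)" by auto
  then have "affine hull J = UNIV" using aff_dim_eq_full by blast
  then have op: "open J" using assms(2) by (simp add: rel_open)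
  have bd: "bdd_above J" "bdd_below J"
    using assms(3) by (auto simp: bounded_imp_bdd_above bounded_imp_bdd_below)
  have "J = {Inf J<..<Sup J}"
  proof (intro equalityI subsetI)
    fix x assume x: "x \<in> J"
    obtain d where d: "d > 0" "ball x d \<subseteq> J" using op x openE by blast
    have "x + d/2 \<in> J" "x - d/2 \<in> J" using d by (auto simp: dist_real_def subset_iff)
    then have "x + d/2 \<le> Sup J" "Inf J \<le> x - d/2"
      using bd by (auto intro: cSup_upper cInf_lower)
    then show "x \<in> {Inf J<..<Sup J}" using d by auto
  next
    fix x assume x: "x \<in> {Inf J<..<Sup J}"
    obtain y where y: "y \<in> J" "x < y" using x bd assms(4) less_cSup_iff by auto
    obtain z where z: "z \<in> J" "z < x" using x bd assms(4) cInf_less_iff by auto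
    have "is_interval J" using assms(1) by (simp add: is_interval_convex_1)
    then show "x \<in> J" using y z unfolding is_interval_1 by (meson less_imp_le)
  qed
  moreover from this have "Inf J < Sup J"
    using assms(4) by (metis greaterThanLessThan_empty_iff not_le)
  ultimately show ?thesis using that by blast
qed

text \<open>Relative openness makes \<open>C\<close> an open piece of its affine hull, so slicing
  \<open>C\<close> loses as much dimension as slicing the hull; there a hyperplane that meets
  without containing loses exactly one.\<close>

lemma aff_dim_slice:
  fixes C :: "'a::euclidean_space set"
  assumes "convex C" "rel_open C" "x \<in> C" "b \<bullet> x = t" "\<not> C \<subseteq> {x. b \<bullet> x = t}"
  shows "aff_dim (C \<inter> {x. b \<bullet> x = t}) = aff_dim C - 1"
proof -
  obtain U where U: "open U" "C = affine hull C \<inter> U"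
    using assms(2) unfolding rel_open openin_open by blast
  let ?A = "affine hull C"
  have eq: "C \<inter> {x. b \<bullet> x = t} = (?A \<inter> {x. b \<bullet> x = t}) \<inter> U" using U(2) by blast
  have "aff_dim ((?A \<inter> {x. b \<bullet> x = t}) \<inter> U) = aff_dim (?A \<inter> {x. b \<bullet> x = t})"
  proof (rule aff_dim_convex_Int_open)
    show "convex (?A \<inter> {x. b \<bullet> x = t})"
      by (intro convex_Int affine_imp_convex affine_affine_hull convex_hyperplane)
    show "?A \<inter> {x. b \<bullet> x = t} \<inter> U \<noteq> {}" using eq assms(3,4) by blast
  qed (rule U)
  also have "\<dots> = aff_dim ?A - 1"
    using aff_dim_affine_Int_hyperplane[OF affine_affine_hull, of C b t] assms(3-5)
      hull_subset[of C affine] by auto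
  finally show ?thesis using eq by simp
qed

lemma rel_open_slice:
  fixes C :: "'a::euclidean_space set"
  assumes "convex C" "rel_open C"
  shows "convex (C \<inter> {x. b \<bullet> x = t}) \<and> rel_open (C \<inter> {x. b \<bullet> x = t})"
proof -
  have "convex S \<and> rel_open S" if "S \<in> {C, {x. b \<bullet> x = t}}" for S
    using that assms by (auto simp: convex_hyperplane affine_rel_open affine_hyperplane)
  from convex_rel_open_finite_Inter[OF this, of "{C, {x. b \<bullet> x = t}}"] show ?thesis by simp
qed

text \<open>A Fubini argument for the Euler characteristic: \<open>B\<close> holds the directions
  still free, and the coordinates outside \<open>B\<close> are frozen at those of \<open>x0\<close>.
  Slicing along \<open>b\<close> keeps the pointwise relation and leaves one free direction
  fewer.\<close>

lemma euler_relation_aux: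
  fixes C :: "'i \<Rightarrow> 'a::euclidean_space set" and m :: "'i \<Rightarrow> int"
  assumes "finite B" "B \<subseteq> Basis" "finite I"
    and "\<And>i. i \<in> I \<Longrightarrow> convex (C i) \<and> rel_open (C i) \<and> bounded (C i) \<and> C i \<noteq> {}"
    and "\<And>i x b. i \<in> I \<Longrightarrow> x \<in> C i \<Longrightarrow> b \<in> Basis - B \<Longrightarrow> x \<bullet> b = x0 \<bullet> b"
    and "\<And>x. (\<Sum>i\<in>I. if x \<in> C i then m i else 0) = 0"
  shows "(\<Sum>i\<in>I. m i * (-1) ^ nat (aff_dim (C i))) = 0"
  using assms
proof (induction B arbitrary: I C m x0 rule: finite_induct)
  case empty
  have C: "C i = {x0}" if "i \<in> I" for i
  proof -
    have "x = x0" if "x \<in> C i" for x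
      using empty.prems(4)[OF \<open>i \<in> I\<close> that] by (metis Diff_empty euclidean_eqI)
    then show ?thesis using empty.prems(3)[OF that] by blast
  qed
  have "(\<Sum>i\<in>I. m i * (-1) ^ nat (aff_dim (C i))) = (\<Sum>i\<in>I. if x0 \<in> C i then m i else 0)"
    by (rule sum.cong) (simp_all add: C)
  then show ?case using empty.prems(5)[of x0] by simp
next
  case (insert b B)
  have bB: "b \<in> Basis" using insert.prems(1) by auto
  define S where "S i t = C i \<inter> {x. b \<bullet> x = t}" for i t
  define J where "J i = (\<lambda>x. b \<bullet> x) ` C i" for i
  define p where "p i \<longleftrightarrow> (\<exists>a. J i = {a})" for i
  have ex: "\<exists>a c. if p i then J i = {a} else a < c \<and> J i = {a<..<c}" if i: "i \<in> I" for i
  proof (cases "p i")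
    case False
    have "linear (\<lambda>x. b \<bullet> x)" by (simp add: bounded_linear.linear bounded_linear_inner_right)
    then have J: "convex (J i) \<and> rel_open (J i)"
      using insert.prems(3)[OF i] unfolding J_def by (intro convex_rel_open_linear_image) auto
    have bJ: "bounded (J i)"
      using insert.prems(3)[OF i] unfolding J_def
      by (intro bounded_linear_image bounded_linear_inner_right) auto
    have "J i \<noteq> {}" using insert.prems(3)[OF i] by (simp add: J_def)
    then show ?thesis
      using rel_open_real_cases[of "J i"] J bJ False unfolding p_def by (metis (full_types))
  qed (auto simp: p_def)
  then obtain a c where ac: "\<And>i. i \<in> I \<Longrightarrow> if p i then J i = {a i} else a i < c i \<and> J i = {a i<..<c i}"
    by metis
  \<comment> \<open>The signed weight of the slices of cell \<open>i\<close>. It is the same at all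
    heights in the shadow \<open>J i\<close>, and the sign flips exactly when slicing lowers the
    dimension.\<close>
  define m' where "m' i = m i * (-1) ^ nat (aff_dim (C i)) * (if p i then 1 else -1)" for i
  have dimS: "m i * (-1) ^ nat (aff_dim (S i t)) = m' i" if i: "i \<in> I" and t: "t \<in> J i" for i t
  proof -
    obtain x where x: "x \<in> C i" "b \<bullet> x = t" using t by (auto simp: J_def)
    show ?thesis
    proof (cases "p i")
      case True
      then obtain a where "J i = {a}" by (auto simp: p_def)
      then have "b \<bullet> y = t" if "y \<in> C i" for y using t that unfolding J_def by (metis imageI singletonD)
      then have "C i \<subseteq> {x. b \<bullet> x = t}" by blast
      then have "S i t = C i" by (auto simp: S_def)
      then show ?thesis using True by (simp add: m'_def)
    next
      case False
      have "\<not> C i \<subseteq> {x. b \<bullet> x = t}"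
      proof
        assume "C i \<subseteq> {x. b \<bullet> x = t}"
        then have "J i = {t}" using x by (auto simp: J_def)
        then show False using False by (auto simp: p_def)
      qed
      then have d: "aff_dim (S i t) = aff_dim (C i) - 1"
        unfolding S_def using aff_dim_slice[of "C i" x b t] insert.prems(3)[OF i] x by blast
      have "S i t \<noteq> {}" using x by (auto simp: S_def)
      then have "aff_dim (S i t) \<ge> 0"
        by (metis aff_dim_negative_iff not_less)
      then have "nat (aff_dim (C i)) = Suc (nat (aff_dim (S i t)))" using d by auto
      then show ?thesis using False by (simp add: m'_def)
    qed
  qed
  have "(\<Sum>i\<in>I. if t \<in> J i then m' i else 0) = 0" for t
  proof -
    define It where "It = {i \<in> I. t \<in> J i}"
    \<comment> \<open>The induction hypothesis is used with the base point moved along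
      \<open>b\<close> to height \<open>t\<close>, which freezes that coordinate too.\<close>
    have "(\<Sum>i\<in>It. m i * (-1) ^ nat (aff_dim (S i t))) = 0"
    proof (rule insert.IH[where ?x0.0 = "x0 + (t - x0 \<bullet> b) *\<^sub>R b"])
      show "B \<subseteq> Basis" "finite It" using insert.prems by (auto simp: It_def)
      show "convex (S i t) \<and> rel_open (S i t) \<and> bounded (S i t) \<and> S i t \<noteq> {}" if "i \<in> It" for i
      proof -
        have i: "i \<in> I" "t \<in> J i" using that by (auto simp: It_def)
        have "bounded (S i t)" using insert.prems(3)[OF i(1)]
          unfolding S_def by (meson bounded_subset inf_le1)
        moreover have "S i t \<noteq> {}" using i(2) by (auto simp: S_def J_def)
        ultimately show ?thesis
          using rel_open_slice[of "C i" b t] insert.prems(3)[OF i(1)] by (auto simp: S_def)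
      qed
      show "x \<bullet> b' = (x0 + (t - x0 \<bullet> b) *\<^sub>R b) \<bullet> b'"
        if "i \<in> It" "x \<in> S i t" "b' \<in> Basis - B" for i x b'
      proof (cases "b' = b")
        case True
        then show ?thesis using that(2) bB by (simp add: S_def inner_add_left inner_add_right inner_commute)
      next
        case False
        then have "b \<bullet> b' = 0" using that(3) bB by (simp add: inner_not_same_Basis)
        then show ?thesis using that False insert.prems(4)[of i x b']
          by (auto simp: S_def It_def inner_add_left)
      qed
      show "(\<Sum>i\<in>It. if x \<in> S i t then m i else 0) = 0" for x
      proof (cases "b \<bullet> x = t")
        case True
        have "(\<Sum>i\<in>It. if x \<in> S i t then m i else 0) = (\<Sum>i\<in>I. if x \<in> C i then m i else 0)"
          unfolding It_def using insert.prems(2) True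
          by (intro sum.mono_neutral_cong_left) (auto simp: S_def J_def)
        then show ?thesis using insert.prems(5) by simp
      next
        case False
        then show ?thesis by (auto simp: S_def intro!: sum.neutral)
      qed
    qed
    moreover have "(\<Sum>i\<in>I. if t \<in> J i then m' i else 0) = (\<Sum>i\<in>It. m i * (-1) ^ nat (aff_dim (S i t)))"
      unfolding It_def using insert.prems(2)
      by (intro sum.mono_neutral_cong_right) (auto simp: dimS)
    ultimately show ?thesis by simp
  qed
  then have "(\<Sum>i\<in>I. if p i then m' i else - m' i) = 0"
    using ac insert.prems(2) by (intro jump_count[where J = J and a = a and b = c]) auto
  moreover have "(if p i then m' i else - m' i) = m i * (-1) ^ nat (aff_dim (C i))" for i
    by (simp add: m'_def)
  ultimately show ?case by simp
qed

theorem euler_relation: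
  fixes C :: "'i \<Rightarrow> 'a::euclidean_space set" and m :: "'i \<Rightarrow> int"
  assumes "finite I"
    and "\<And>i. i \<in> I \<Longrightarrow> convex (C i) \<and> rel_open (C i) \<and> bounded (C i) \<and> C i \<noteq> {}"
    and "\<And>x. (\<Sum>i\<in>I. if x \<in> C i then m i else 0) = 0"
  shows "(\<Sum>i\<in>I. m i * (-1) ^ nat (aff_dim (C i))) = 0"
  using assms by (intro euler_relation_aux[of Basis]) auto

section \<open>Residues and the surface inequality\<close>

lemma even_card_sym_diff:
  assumes "finite A" "finite B"
  shows "even (card (sym_diff A B)) \<longleftrightarrow> (even (card A) \<longleftrightarrow> even (card B))"
proof -
  have "card (sym_diff A B) = card (A - B) + card (B - A)"
    using assms by (intro card_Un_disjoint) auto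
  moreover have "card A = card (A - B) + card (A \<inter> B)" "card B = card (B - A) + card (A \<inter> B)"
    using card_Int_Diff[OF assms(1), of B] card_Int_Diff[OF assms(2), of A] by (simp_all add: Int_commute)
  ultimately show ?thesis by auto
qed

text \<open>Nonempty families closed under symmetric difference are vector spaces over the field
  with two elements, and this is the dimension formula for a sum: each fibre of addition is a
  translate of the intersection.\<close>

lemma card_sum_sym_diff:
  fixes A B :: "'a set set"
  assumes "finite A" "finite B"
    and A: "\<And>S T. S \<in> A \<Longrightarrow> T \<in> A \<Longrightarrow> sym_diff S T \<in> A"
    and B: "\<And>S T. S \<in> B \<Longrightarrow> T \<in> B \<Longrightarrow> sym_diff S T \<in> B"
  shows "card A * card B = card ((\<lambda>(S, T). sym_diff S T) ` (A \<times> B)) * card (A \<inter> B)"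
proof -
  let ?f = "\<lambda>(S, T). sym_diff S T"
  have "card (A \<times> B) = (\<Sum>y\<in>?f ` (A \<times> B). card {p \<in> A \<times> B. ?f p = y})"
    using sum.image_gen[of "A \<times> B" "\<lambda>_. 1::nat" ?f] assms(1,2) by simp
  also have "\<dots> = (\<Sum>y\<in>?f ` (A \<times> B). card (A \<inter> B))"
  proof (rule sum.cong[OF refl])
    fix y assume "y \<in> ?f ` (A \<times> B)"
    then obtain S0 T0 where ST: "S0 \<in> A" "T0 \<in> B" "y = sym_diff S0 T0" by auto
    \<comment> \<open>Two decompositions of \<open>y\<close> differ by the same set in both
      components, which therefore lies in \<open>A \<inter> B\<close>.\<close>
    have "bij_betw (\<lambda>(S, T). sym_diff S S0) {p \<in> A \<times> B. ?f p = y} (A \<inter> B)"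
    proof (rule bij_betw_byWitness[where f' = "\<lambda>X. (sym_diff X S0, sym_diff X T0)"])
      show "\<forall>p\<in>{p \<in> A \<times> B. ?f p = y}.
          (sym_diff (case p of (S, T) \<Rightarrow> sym_diff S S0) S0, sym_diff (case p of (S, T) \<Rightarrow> sym_diff S S0) T0) = p"
        using ST(3) by auto
      show "\<forall>X\<in>A \<inter> B. (case (sym_diff X S0, sym_diff X T0) of (S, T) \<Rightarrow> sym_diff S S0) = X"
        by auto
      show "(\<lambda>(S, T). sym_diff S S0) ` {p \<in> A \<times> B. ?f p = y} \<subseteq> A \<inter> B"
      proof (rule image_subsetI)
        fix p assume "p \<in> {p \<in> A \<times> B. ?f p = y}"
        then obtain S T where S: "p = (S, T)" "S \<in> A" "T \<in> B" "sym_diff S T = y" by auto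
        then have "sym_diff S S0 = sym_diff T T0" using ST(3) by blast
        then show "(case p of (S, T) \<Rightarrow> sym_diff S S0) \<in> A \<inter> B"
          using A[OF S(2) ST(1)] B[OF S(3) ST(2)] S(1) by simp
      qed
      show "(\<lambda>X. (sym_diff X S0, sym_diff X T0)) ` (A \<inter> B) \<subseteq> {p \<in> A \<times> B. ?f p = y}"
      proof (rule image_subsetI)
        fix X assume X: "X \<in> A \<inter> B"
        then have "sym_diff X S0 \<in> A" "sym_diff X T0 \<in> B"
          using A[of X S0] B[of X T0] ST by auto
        moreover have "sym_diff (sym_diff X S0) (sym_diff X T0) = y" using ST(3) by blast
        ultimately show "(sym_diff X S0, sym_diff X T0) \<in> {p \<in> A \<times> B. ?f p = y}" by simp
      qed
    qed
    then show "card {p \<in> A \<times> B. ?f p = y} = card (A \<inter> B)" by (rule bij_betw_same_card)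
  qed
  finally show ?thesis by (simp add: card_cartesian_product)
qed

text \<open>Orthogonal subspaces have dimensions adding up to at most that of the whole space; the
  pairing is the parity of the intersection. Deleting one element \<open>e\<close> from
  \<open>E\<close> costs the product of the cardinalities at most a factor 2.\<close>

lemma orthogonal_families_card:
  fixes J B :: "'a set set"
  assumes "finite E" "J \<subseteq> Pow E" "B \<subseteq> Pow E"
    and "\<And>S T. S \<in> J \<Longrightarrow> T \<in> J \<Longrightarrow> sym_diff S T \<in> J"
    and "\<And>S T. S \<in> B \<Longrightarrow> T \<in> B \<Longrightarrow> sym_diff S T \<in> B"
    and "\<And>S T. S \<in> J \<Longrightarrow> T \<in> B \<Longrightarrow> even (card (S \<inter> T))"
  shows "card J * card B \<le> 2 ^ card E"
  using assms
proof (induction E arbitrary: J B rule: finite_induct)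
  case empty
  then have "card J \<le> card {{} :: 'a set}" "card B \<le> card {{} :: 'a set}"
    by (intro card_mono; auto)+
  then have "card J * card B \<le> 1 * 1" by (intro mult_mono) auto
  then show ?case by simp
next
  case (insert e E)
  \<comment> \<open>The case of a family avoiding \<open>e\<close>, phrased so that \<open>J\<close>
    and \<open>B\<close> can play either role. Forgetting \<open>e\<close> in the other family is at
    most two to one and leaves all intersections unchanged.\<close>
  have restrict: "card F * card G \<le> 2 * 2 ^ card E"
    if F: "F \<subseteq> Pow (insert e E)" "F \<subseteq> Pow E" and G: "G \<subseteq> Pow (insert e E)"
      and F': "\<And>S T. S \<in> F \<Longrightarrow> T \<in> F \<Longrightarrow> sym_diff S T \<in> F"
      and G': "\<And>S T. S \<in> G \<Longrightarrow> T \<in> G \<Longrightarrow> sym_diff S T \<in> G"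
      and orth: "\<And>S T. S \<in> F \<Longrightarrow> T \<in> G \<Longrightarrow> even (card (S \<inter> T))" for F G
  proof -
    let ?r = "\<lambda>S. S - {e}"
    have finG: "finite G" using G finite_subset insert.hyps(1) by fastforce
    have "card F * card (?r ` G) \<le> 2 ^ card E"
    proof (rule insert.IH[OF F(2)])
      show "?r ` G \<subseteq> Pow E" using G by auto
      show "sym_diff S T \<in> F" if "S \<in> F" "T \<in> F" for S T using that by (rule F')
      show "sym_diff S T \<in> ?r ` G" if "S \<in> ?r ` G" "T \<in> ?r ` G" for S T
      proof -
        from that obtain S' T' where "S' \<in> G" "T' \<in> G" "S = ?r S'" "T = ?r T'" by auto
        moreover from this have "sym_diff S T = ?r (sym_diff S' T')" by auto
        ultimately show ?thesis using G' by (metis imageI)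
      qed
      show "even (card (S \<inter> T))" if "S \<in> F" "T \<in> ?r ` G" for S T
      proof -
        from that obtain T' where T': "T' \<in> G" "T = ?r T'" by auto
        then have "S \<inter> T = S \<inter> T'" using F(2) that(1) insert.hyps(2) by auto
        then show ?thesis using orth[OF that(1) T'(1)] by simp
      qed
    qed
    moreover have "card G \<le> 2 * card (?r ` G)"
    proof -
      have "G \<subseteq> ?r ` G \<union> insert e ` ?r ` G"
      proof
        fix S assume S: "S \<in> G"
        have "S = ?r S \<or> S = insert e (?r S)" by auto
        then show "S \<in> ?r ` G \<union> insert e ` ?r ` G" using S by blast
      qed
      then have "card G \<le> card (?r ` G \<union> insert e ` ?r ` G)"
        using finG by (intro card_mono) auto
      also have "\<dots> \<le> card (?r ` G) + card (insert e ` ?r ` G)" by (rule card_Un_le)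
      also have "card (insert e ` ?r ` G) \<le> card (?r ` G)" using finG by (intro card_image_le) auto
      finally show ?thesis by simp
    qed
    then have "card F * card G \<le> card F * (2 * card (?r ` G))" by (rule mult_le_mono2)
    ultimately show ?thesis by (simp only: mult.left_commute[of "card F"])
  qed
  have finJB: "finite J" "finite B"
    using insert.prems(1,2) insert.hyps(1) by (meson finite.insertI finite_Pow_iff finite_subset)+
  consider "J \<subseteq> Pow E" | "B \<subseteq> Pow E" | "\<exists>S\<in>J. e \<in> S" "\<exists>T\<in>B. e \<in> T"
    using insert.prems(1,2) by blast
  then have "card J * card B \<le> 2 * 2 ^ card E"
  proof cases
    case 1
    then show ?thesis using restrict[of J B] insert.prems by blast
  next
    case 2
    then have "card B * card J \<le> 2 * 2 ^ card E"
    proof (intro restrict)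
      show "even (card (S \<inter> T))" if "S \<in> B" "T \<in> J" for S T
        using insert.prems(5)[OF that(2,1)] by (simp add: Int_commute)
    qed (use insert.prems in auto)
    then show ?thesis by (simp add: mult.commute)
  next
    case 3
    then obtain S0 T0 where S0: "S0 \<in> J" "e \<in> S0" and T0: "T0 \<in> B" "e \<in> T0" by blast
    let ?J0 = "{S \<in> J. e \<notin> S}" and ?r = "\<lambda>S. S - {e}"
    have "card {S \<in> J. e \<in> S} \<le> card ?J0"
    proof (rule card_inj_on_le[where f = "\<lambda>S. sym_diff S S0"])
      show "inj_on (\<lambda>S. sym_diff S S0) {S \<in> J. e \<in> S}" by (auto intro!: inj_onI)
    qed (use S0 insert.prems(3) finJB in auto)
    moreover have "card J = card {S \<in> J. e \<in> S} + card ?J0"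
      using finJB by (subst card_Un_disjoint[symmetric]) (auto intro: arg_cong[where f = card])
    ultimately have J: "card J \<le> 2 * card ?J0" by simp
    \<comment> \<open>Two members of \<open>B\<close> differing only in \<open>e\<close> would put
      \<open>{e}\<close> into \<open>B\<close>, against orthogonality to \<open>S0\<close>. So here
      only \<open>J\<close> is halved.\<close>
    have "inj_on ?r B"
    proof (rule inj_onI, rule ccontr)
      fix S T assume ST: "S \<in> B" "T \<in> B" "?r S = ?r T" "S \<noteq> T"
      then have "sym_diff S T = {e}" by blast
      then have "{e} \<in> B" using insert.prems(4)[OF ST(1,2)] by simp
      then have "even (card (S0 \<inter> {e}))" using insert.prems(5) S0(1) by blast
      then show False using S0(2) by simp
    qed
    then have B: "card (?r ` B) = card B" by (rule card_image)
    have "card ?J0 * card (?r ` B) \<le> 2 ^ card E"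
    proof (rule insert.IH)
      show "?J0 \<subseteq> Pow E" "?r ` B \<subseteq> Pow E" using insert.prems(1,2) by auto
      show "sym_diff S T \<in> ?J0" if "S \<in> ?J0" "T \<in> ?J0" for S T
        using that insert.prems(3) by auto
      show "sym_diff S T \<in> ?r ` B" if "S \<in> ?r ` B" "T \<in> ?r ` B" for S T
      proof -
        from that obtain S' T' where "S' \<in> B" "T' \<in> B" "S = ?r S'" "T = ?r T'" by auto
        moreover from this have "sym_diff S T = ?r (sym_diff S' T')" by auto
        ultimately show ?thesis using insert.prems(4) by (metis imageI)
      qed
      show "even (card (S \<inter> T))" if "S \<in> ?J0" "T \<in> ?r ` B" for S T
      proof -
        from that obtain T' where T': "T' \<in> B" "T = ?r T'" by auto
        then have "S \<inter> T = S \<inter> T'" using that(1) by auto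
        then show ?thesis using insert.prems(5)[OF _ T'(1)] that(1) by simp
      qed
    qed
    then have "2 * card ?J0 * card B \<le> 2 * 2 ^ card E" using B by simp
    moreover have "card J * card B \<le> 2 * card ?J0 * card B" using J by (rule mult_le_mono1)
    ultimately show ?thesis by (rule le_trans[rotated])
  qed
  then show ?case using insert.hyps by simp
qed

section \<open>Residue numbers as dimensions\<close>

lemma comp_rel_equiv:
  assumes "colored_graph V adj"
  shows "equiv V (comp_rel V adj C)"
proof (rule equivI)
  let ?r = "{(x, adj c x) | x c. x \<in> V \<and> c \<in> C}"
  have "sym ?r"
    using assms unfolding colored_graph_def by (intro symI) (auto, metis)
  then have "sym (?r\<^sup>*)" by (rule sym_rtrancl)
  then show "sym (comp_rel V adj C)" unfolding comp_rel_def sym_def by blast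
  show "trans (comp_rel V adj C)" unfolding comp_rel_def trans_def by (auto intro: rtrancl_trans)
  show "refl_on V (comp_rel V adj C)" unfolding comp_rel_def refl_on_def by auto
  show "comp_rel V adj C \<subseteq> V \<times> V" unfolding comp_rel_def by auto
qed

lemma comp_rel_step:
  assumes "colored_graph V adj" "v \<in> V" "c \<in> C"
  shows "(v, adj c v) \<in> comp_rel V adj C"
  using assms unfolding colored_graph_def comp_rel_def by auto

lemma comp_rel_invariant:
  assumes "colored_graph V adj" "(v, w) \<in> comp_rel V adj C"
    and "\<And>v c. v \<in> V \<Longrightarrow> c \<in> C \<Longrightarrow> F (adj c v) = F v"
  shows "F w = F v"
proof -
  have "(v, w) \<in> {(x, adj c x) | x c. x \<in> V \<and> c \<in> C}\<^sup>*" using assms(2) by (simp add: comp_rel_def)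
  then show ?thesis by (induction rule: rtrancl_induct) (auto simp: assms(3))
qed

text \<open>As indicator functions modulo 2 these are the functions constant on the residues of
  \<open>C\<close>: a vector space whose dimension is the residue number.\<close>

definition color_closed :: "'v set \<Rightarrow> ('c \<Rightarrow> 'v \<Rightarrow> 'v) \<Rightarrow> 'c set \<Rightarrow> 'v set set" where
  "color_closed V adj C = {S. S \<subseteq> V \<and> (\<forall>v\<in>S. \<forall>c\<in>C. adj c v \<in> S)}"

lemma color_closed_Un: "color_closed V adj C \<inter> color_closed V adj D = color_closed V adj (C \<union> D)"
  unfolding color_closed_def by auto

lemma color_closed_sym_diff:
  assumes "colored_graph V adj" "S \<in> color_closed V adj C" "T \<in> color_closed V adj C"
  shows "sym_diff S T \<in> color_closed V adj C"
proof -
  have "adj c v \<in> S \<longleftrightarrow> v \<in> S" "adj c v \<in> T \<longleftrightarrow> v \<in> T" if "v \<in> V" "c \<in> C" for c v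
    using assms that unfolding colored_graph_def color_closed_def by (auto, metis+)
  then show ?thesis using assms(2,3) by (auto simp: color_closed_def)
qed

lemma card_color_closed:
  assumes "colored_graph V adj"
  shows "card (color_closed V adj C) = 2 ^ g_comp V adj C"
proof -
  let ?R = "comp_rel V adj C"
  note eq = comp_rel_equiv[OF assms, of C]
  have un: "\<Union>(V // ?R) = V" by (rule Union_quotient[OF eq])
  have "bij_betw Union (Pow (V // ?R)) (color_closed V adj C)"
  proof (rule bij_betw_imageI)
    show "inj_on Union (Pow (V // ?R))"
    proof (rule inj_onI)
      fix A B assume AB: "A \<in> Pow (V // ?R)" "B \<in> Pow (V // ?R)" "\<Union>A = \<Union>B"
      have sub: "A \<subseteq> B" if AB: "A \<subseteq> V // ?R" "B \<subseteq> V // ?R" "\<Union>A = \<Union>B" for A B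
      proof
        fix X assume X: "X \<in> A"
        then have "X \<in> V // ?R" using AB by auto
        then obtain x where x: "x \<in> X" using in_quotient_imp_non_empty[OF eq] by blast
        then obtain Y where Y: "Y \<in> B" "x \<in> Y" using X AB(3) by blast
        then have "X = Y" using quotient_disj[OF eq, of X Y] AB X x by auto
        then show "X \<in> B" using Y by simp
      qed
      show "A = B" using sub[of A B] sub[of B A] AB by auto
    qed
    show "Union ` Pow (V // ?R) = color_closed V adj C"
    proof (intro equalityI subsetI)
      fix S assume "S \<in> Union ` Pow (V // ?R)"
      then obtain A where A: "A \<subseteq> V // ?R" "S = \<Union>A" by auto
      have "adj c v \<in> S" if v: "v \<in> S" and c: "c \<in> C" for c v
      proof -
        obtain X where X: "X \<in> A" "v \<in> X" using v A by auto
        then have XV: "X \<in> V // ?R" using A by auto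
        then have "v \<in> V" using X un by blast
        then have "(v, adj c v) \<in> ?R" using c by (rule comp_rel_step[OF assms])
        then have "adj c v \<in> X" by (rule in_quotient_imp_closed[OF eq XV X(2)])
        then show ?thesis using X A by auto
      qed
      moreover have "S \<subseteq> V" using A un by blast
      ultimately show "S \<in> color_closed V adj C" by (simp add: color_closed_def)
    next
      fix S assume S: "S \<in> color_closed V adj C"
      have cl: "w \<in> S" if "v \<in> S" "(v, w) \<in> ?R" for v w
      proof -
        have "(v, w) \<in> {(x, adj c x) | x c. x \<in> V \<and> c \<in> C}\<^sup>*" using that(2) by (simp add: comp_rel_def)
        then show ?thesis by (induction rule: rtrancl_induct) (use that(1) S in \<open>auto simp: color_closed_def\<close>)
      qed
      have "v \<in> ?R `` {v}" if "v \<in> S" for v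
        using equiv_class_self[OF eq] S that by (auto simp: color_closed_def)
      then have "S = \<Union>((\<lambda>v. ?R `` {v}) ` S)" using cl by blast
      moreover have "(\<lambda>v. ?R `` {v}) ` S \<in> Pow (V // ?R)"
        using S by (auto simp: color_closed_def intro: quotientI)
      ultimately show "S \<in> Union ` Pow (V // ?R)" by blast
    qed
  qed
  then have "card (color_closed V adj C) = card (Pow (V // ?R))" by (metis bij_betw_same_card)
  moreover have "finite (V // ?R)"
    using assms eq finite_quotient unfolding colored_graph_def equiv_def by blast
  ultimately show ?thesis by (simp add: card_Pow g_comp_def)
qed

lemma g_comp_uniform:
  assumes "colored_graph V adj" "\<And>v. v \<in> V \<Longrightarrow> card (comp_rel V adj C `` {v}) = k"
  shows "k * g_comp V adj C = card V"
proof -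
  let ?R = "comp_rel V adj C"
  note eq = comp_rel_equiv[OF assms(1), of C]
  have fin: "finite V" using assms(1) by (simp add: colored_graph_def)
  have un: "\<Union>(V // ?R) = V" by (rule Union_quotient[OF eq])
  have "k * card (V // ?R) = card (\<Union>(V // ?R))"
  proof (rule card_partition)
    show "finite (V // ?R)" using finite_quotient fin eq unfolding equiv_def by blast
    show "finite (\<Union>(V // ?R))" using fin un by simp
    show "card c = k" if "c \<in> V // ?R" for c using that assms(2) by (auto elim!: quotientE)
    show "c1 \<inter> c2 = {}" if "c1 \<in> V // ?R" "c2 \<in> V // ?R" "c1 \<noteq> c2" for c1 c2
      using that quotient_disj[OF eq] by blast
  qed
  then show ?thesis by (simp add: un g_comp_def)
qed

lemma comp_rel_class_eqI:
  assumes "colored_graph V adj" "v \<in> X" "X \<in> color_closed V adj C"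
    and "\<And>w. w \<in> X \<Longrightarrow> (v, w) \<in> comp_rel V adj C"
  shows "comp_rel V adj C `` {v} = X"
proof -
  have "w \<in> X" if "(v, w) \<in> comp_rel V adj C" for w
  proof -
    have "(v, w) \<in> {(x, adj c x) | x c. x \<in> V \<and> c \<in> C}\<^sup>*" using that by (simp add: comp_rel_def)
    then show ?thesis by (induction rule: rtrancl_induct) (use assms(2,3) in \<open>auto simp: color_closed_def\<close>)
  qed
  then show ?thesis using assms(4) by blast
qed

lemma g_comp_empty:
  assumes "colored_graph V adj"
  shows "g_comp V adj {} = card V"
proof -
  have "comp_rel V adj {} `` {v} = {v}" if "v \<in> V" for v
    using that by (intro comp_rel_class_eqI[OF assms]) (auto simp: color_closed_def comp_rel_def)
  then show ?thesis using g_comp_uniform[OF assms, of "{}" 1] by simp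
qed

lemma g_comp_singleton:
  assumes "colored_graph V adj"
  shows "2 * g_comp V adj {c} = card V"
proof (rule g_comp_uniform[OF assms])
  fix v assume v: "v \<in> V"
  have a: "adj c v \<in> V" "adj c v \<noteq> v" "adj c (adj c v) = v"
    using assms v by (auto simp: colored_graph_def)
  have "comp_rel V adj {c} `` {v} = {v, adj c v}"
  proof (rule comp_rel_class_eqI[OF assms])
    show "(v, w) \<in> comp_rel V adj {c}" if "w \<in> {v, adj c v}" for w
      using that comp_rel_step[OF assms v, of c "{c}"] v by (auto simp: comp_rel_def)
  qed (use a v in \<open>auto simp: color_closed_def\<close>)
  then show "card (comp_rel V adj {c} `` {v}) = 2" using a by simp
qed

text \<open>The edges of the common colour \<open>c\<close> pair off the vertices of the
  intersection, which is thus a one-coloured graph in its own right.\<close>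

lemma even_card_color_closed:
  assumes "colored_graph V adj" "S \<in> color_closed V adj C" "T \<in> color_closed V adj D" "c \<in> C" "c \<in> D"
  shows "even (card (S \<inter> T))"
proof -
  have "colored_graph (S \<inter> T) (\<lambda>_::unit. adj c)"
    using assms unfolding colored_graph_def color_closed_def by (auto intro: finite_subset)
  from g_comp_singleton[OF this, of "()"] show ?thesis by (metis dvd_triv_left)
qed

lemma color_closed_subset: "color_closed V adj C \<subseteq> Pow V"
  by (auto simp: color_closed_def)

text \<open>Passes from cardinalities to dimensions: \<open>x\<close> and \<open>y\<close> stand for
  the sizes of two sums whose summands meet in dimension \<open>k\<close>.\<close>

lemma exponents_le:
  fixes x y :: nat
  assumes "x * y \<le> 2 ^ n" "x * 2 ^ k = 2 ^ a" "y * 2 ^ k = 2 ^ b"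
  shows "a + b \<le> n + 2 * k"
proof -
  have "(2::nat) ^ (a + b) = (x * y) * 2 ^ (2 * k)"
    unfolding power_add assms(2,3)[symmetric] by (simp add: power2_eq_square mult_2 power_add)
  also have "\<dots> \<le> 2 ^ n * 2 ^ (2 * k)" using assms(1) by (rule mult_le_mono1)
  also have "\<dots> = 2 ^ (n + 2 * k)" by (simp add: power_add)
  finally show ?thesis by simp
qed

text \<open>The Euler characteristic of a connected closed surface is at most 2. Over the field with two
  elements, the potentials spanned by the two families of bicoloured cycles through \<open>c\<close> are
  orthogonal to the third family, which bounds the sum of their dimensions.\<close>
lemma surface_inequality:
  assumes G: "colored_graph V adj"
  shows "2 * (g_comp V adj {a,b} + g_comp V adj {a,c} + g_comp V adj {b,c})
     \<le> 4 * g_comp V adj {a,b,c} + card V"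
proof -
  let ?I = "color_closed V adj" and ?g = "g_comp V adj"
  let ?sum = "\<lambda>A B. (\<lambda>(S, T). sym_diff S T) ` (A \<times> B)"
  have finV: "finite V" using G by (simp add: colored_graph_def)
  have fin: "finite (?I C)" for C
    using finV color_closed_subset[of V adj C] by (meson finite_Pow_iff finite_subset)
  have card_sum: "card (?sum (?I C) (?I D)) * 2 ^ ?g (C \<union> D) = 2 ^ (?g C + ?g D)" for C D
    using card_sum_sym_diff[OF fin fin, of C D] color_closed_sym_diff[OF G]
    by (simp add: color_closed_Un card_color_closed[OF G] power_add)
  \<comment> \<open>Any summand of \<open>?J\<close> shares a colour with any summand of
    \<open>?B\<close>, whence orthogonality. The edges of colour \<open>c\<close> are added to
    \<open>?B\<close> so that in both sums the summands meet in \<open>?I {a,b,c}\<close>.\<close>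
  let ?J = "?sum (?I {a,c}) (?I {b,c})" and ?B = "?sum (?I {a,b}) (?I {c})"
  have le: "card ?J * card ?B \<le> 2 ^ card V"
  proof (rule orthogonal_families_card[OF finV])
    show "?J \<subseteq> Pow V" "?B \<subseteq> Pow V" by (auto simp: color_closed_def)
    have cl: "sym_diff S T \<in> ?sum (?I C) (?I D)"
      if ST: "S \<in> ?sum (?I C) (?I D)" "T \<in> ?sum (?I C) (?I D)" for S T C D
    proof -
      from ST obtain S1 S2 T1 T2 where 1: "S1 \<in> ?I C" "S2 \<in> ?I D" "S = sym_diff S1 S2"
        "T1 \<in> ?I C" "T2 \<in> ?I D" "T = sym_diff T1 T2" by auto
      then have "sym_diff S T = sym_diff (sym_diff S1 T1) (sym_diff S2 T2)" by blast
      moreover have "sym_diff S1 T1 \<in> ?I C" "sym_diff S2 T2 \<in> ?I D"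
        using 1 color_closed_sym_diff[OF G] by blast+
      ultimately show ?thesis by (intro image_eqI[where x = "(sym_diff S1 T1, sym_diff S2 T2)"]) auto
    qed
    show "sym_diff S T \<in> ?J" if "S \<in> ?J" "T \<in> ?J" for S T using that by (rule cl)
    show "sym_diff S T \<in> ?B" if "S \<in> ?B" "T \<in> ?B" for S T using that by (rule cl)
    show "even (card (S \<inter> T))" if "S \<in> ?J" "T \<in> ?B" for S T
    proof -
      from that obtain S1 S2 T1 T2 where ST: "S1 \<in> ?I {a,c}" "S2 \<in> ?I {b,c}" "S = sym_diff S1 S2"
        "T1 \<in> ?I {a,b}" "T2 \<in> ?I {c}" "T = sym_diff T1 T2" by auto
      have "S1 \<subseteq> V" "S2 \<subseteq> V" "T1 \<subseteq> V" "T2 \<subseteq> V" using ST by (auto simp: color_closed_def)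
      then have fins: "finite S1" "finite S2" "finite T1" "finite T2"
        using finV by (auto intro: finite_subset)
      have "even (card (S1 \<inter> T1))" "even (card (S2 \<inter> T1))" "even (card (S1 \<inter> T2))" "even (card (S2 \<inter> T2))"
        using ST(1,2,4,5) even_card_color_closed[OF G] by blast+
      moreover have eq: "S \<inter> T = sym_diff (sym_diff (S1 \<inter> T1) (S2 \<inter> T1)) (sym_diff (S1 \<inter> T2) (S2 \<inter> T2))"
        using ST(3,6) by blast
      moreover have "even (card (sym_diff A B))"
        if "even (card A)" "even (card B)" "finite A" "finite B" for A B :: "'a set"
        using that even_card_sym_diff by blast
      ultimately show ?thesis unfolding eq using fins by (metis finite_Diff finite_Int finite_Un)
    qed
  qed
  have un: "{a,c} \<union> {b,c} = {a,b,c}" "{a,b} \<union> {c} = {a,b,c}" by auto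
  have "?g {a,c} + ?g {b,c} + (?g {a,b} + ?g {c}) \<le> card V + 2 * ?g {a,b,c}"
    by (rule exponents_le[OF le card_sum[of "{a,c}" "{b,c}", unfolded un] card_sum[of "{a,b}" "{c}", unfolded un]])
  then show ?thesis using g_comp_singleton[OF G, of c] by simp
qed

section \<open>Gems of the torus and their lifts\<close>

text \<open>\<open>X\<close> indexes the unknowns and \<open>Y\<close> the equations; each equation
  is spent on eliminating one unknown.\<close>

lemma homogeneous_system_solution:
  fixes A :: "'x \<Rightarrow> 'y \<Rightarrow> real"
  assumes "finite Y" "finite X" "card Y < card X"
  shows "\<exists>c. (\<exists>x\<in>X. c x \<noteq> 0) \<and> (\<forall>y\<in>Y. (\<Sum>x\<in>X. c x * A x y) = 0)"
  using assms
proof (induction Y arbitrary: X A rule: finite_induct)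
  case empty
  then have "X \<noteq> {}" by auto
  then show ?case by (intro exI[of _ "\<lambda>_. 1"]) auto
next
  case (insert y0 Y)
  show ?case
  proof (cases "\<exists>x0\<in>X. A x0 y0 \<noteq> 0")
    case False
    obtain c where "\<exists>x\<in>X. c x \<noteq> 0" "\<forall>y\<in>Y. (\<Sum>x\<in>X. c x * A x y) = 0"
      using insert.IH[of X A] insert.prems insert.hyps by auto
    then show ?thesis using False by (intro exI[of _ c]) auto
  next
    case True
    then obtain x0 where x0: "x0 \<in> X" "A x0 y0 \<noteq> 0" by auto
    let ?X = "X - {x0}"
    have "card Y < card ?X" using insert.prems insert.hyps x0 by auto
    then obtain c where c: "\<exists>x\<in>?X. c x \<noteq> 0"
      "\<forall>y\<in>Y. (\<Sum>x\<in>?X. c x * (A x y - A x y0 / A x0 y0 * A x0 y)) = 0"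
      using insert.IH[of ?X "\<lambda>x y. A x y - A x y0 / A x0 y0 * A x0 y"] insert.prems(1) by auto
    \<comment> \<open>The equation \<open>y0\<close> forces the value \<open>- d\<close> on the
      pivot unknown \<open>x0\<close>.\<close>
    define d where "d = (\<Sum>x\<in>?X. c x * A x y0) / A x0 y0"
    let ?c = "c(x0 := - d)"
    have split: "(\<Sum>x\<in>X. ?c x * A x y) = (\<Sum>x\<in>?X. c x * A x y) - d * A x0 y" for y
    proof -
      have "(\<Sum>x\<in>X. ?c x * A x y) = ?c x0 * A x0 y + (\<Sum>x\<in>?X. ?c x * A x y)"
        by (rule sum.remove[OF insert.prems(1) x0(1)])
      also have "(\<Sum>x\<in>?X. ?c x * A x y) = (\<Sum>x\<in>?X. c x * A x y)" by (rule sum.cong) auto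
      finally show ?thesis by simp
    qed
    have "(\<Sum>x\<in>X. ?c x * A x y) = 0" if "y \<in> Y" for y
    proof -
      have "0 = (\<Sum>x\<in>?X. c x * A x y - c x * A x y0 * (A x0 y / A x0 y0))"
        using c(2) that by (simp add: algebra_simps)
      also have "\<dots> = (\<Sum>x\<in>?X. c x * A x y) - (\<Sum>x\<in>?X. c x * A x y0) * (A x0 y / A x0 y0)"
        by (simp only: sum_subtractf sum_distrib_right)
      finally show ?thesis using split[of y] by (simp add: d_def)
    qed
    moreover have "(\<Sum>x\<in>X. ?c x * A x y0) = 0" using split[of y0] x0 by (simp add: d_def)
    moreover have "\<exists>x\<in>X. ?c x \<noteq> 0" using c(1) by auto
    ultimately show ?thesis by blast
  qed
qed

section \<open>The covering of the torus and the standard simplex\<close>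

lemma torus_cover_eq_iff: "torus_cover p = torus_cover q \<longleftrightarrow> (\<forall>i. p $ i - q $ i \<in> \<int>)"
proof -
  have "cis (2 * pi * x) = cis (2 * pi * y) \<longleftrightarrow> x - y \<in> \<int>" for x y :: real
  proof -
    have "cis (2 * pi * x) = cis (2 * pi * y) \<longleftrightarrow> sin (2 * pi * x) = sin (2 * pi * y) \<and> cos (2 * pi * x) = cos (2 * pi * y)"
      by (auto simp: complex_eq_iff)
    also have "\<dots> \<longleftrightarrow> (\<exists>n::int. 2 * pi * x = 2 * pi * y + 2 * pi * n)" by (rule sin_cos_eq_iff)
    also have "\<dots> \<longleftrightarrow> (\<exists>n::int. x - y = of_int n)"
    proof -
      have "2 * pi * x = 2 * pi * y + 2 * pi * n \<longleftrightarrow> x - y = n" for n :: real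
      proof -
        have "2 * pi * x = 2 * pi * y + 2 * pi * n \<longleftrightarrow> (2 * pi) * x = (2 * pi) * (y + n)"
          by (simp only: distrib_left)
        also have "\<dots> \<longleftrightarrow> x - y = n" by (subst mult_cancel_left) auto
        finally show ?thesis .
      qed
      then show ?thesis by simp
    qed
    finally show ?thesis by (auto simp: Ints_def)
  qed
  then show ?thesis by (simp add: torus_cover_def vec_eq_iff)
qed

lemma range_torus_cover: "range torus_cover = torus4"
proof (intro equalityI subsetI)
  fix z assume "z \<in> torus4"
  then have norm: "norm (z $ i) = 1" for i by (simp add: torus4_def)
  have "cis (Arg (z $ i)) = sgn (z $ i)" for i using norm[of i] by (intro cis_Arg) auto
  then have "z $ i = cis (2 * pi * (Arg (z $ i) / (2 * pi)))" for i
    using norm[of i] by (simp add: sgn_div_norm)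
  then have "z = torus_cover (\<chi> i. Arg (z $ i) / (2 * pi))"
    by (simp add: torus_cover_def vec_eq_iff)
  then show "z \<in> range torus_cover" by blast
qed (auto simp: torus_cover_def torus4_def)

lemma finite_vec:
  assumes "finite B"
  shows "finite {x :: 'a ^ 'n::finite. \<forall>i. x $ i \<in> B}"
proof (rule finite_subset)
  show "{x :: 'a ^ 'n. \<forall>i. x $ i \<in> B} \<subseteq> vec_lambda ` (Pi\<^sub>E UNIV (\<lambda>_. B))"
  proof
    fix x :: "'a ^ 'n" assume "x \<in> {x. \<forall>i. x $ i \<in> B}"
    then have "x = vec_lambda (vec_nth x)" "vec_nth x \<in> Pi\<^sub>E UNIV (\<lambda>_. B)" by auto
    then show "x \<in> vec_lambda ` (Pi\<^sub>E UNIV (\<lambda>_. B))" by blast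
  qed
  show "finite (vec_lambda ` (Pi\<^sub>E (UNIV :: 'n set) (\<lambda>_. B)))"
    using assms by (intro finite_imageI finite_PiE) auto
qed

lemma finite_Ints_bounded: "finite {x :: real. x \<in> \<int> \<and> \<bar>x\<bar> \<le> M}"
proof (rule finite_subset)
  show "{x :: real. x \<in> \<int> \<and> \<bar>x\<bar> \<le> M} \<subseteq> of_int ` {-\<lceil>M\<rceil>..\<lceil>M\<rceil>}"
  proof clarify
    fix x :: real assume "x \<in> \<int>" "\<bar>x\<bar> \<le> M"
    then obtain n where n: "x = of_int n" by (auto elim: Ints_cases)
    then have "\<bar>of_int n :: real\<bar> \<le> of_int \<lceil>M\<rceil>" using \<open>\<bar>x\<bar> \<le> M\<close> by linarith
    then have "\<bar>n\<bar> \<le> \<lceil>M\<rceil>" by (simp only: of_int_le_iff flip: of_int_abs)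
    then show "x \<in> of_int ` {-\<lceil>M\<rceil>..\<lceil>M\<rceil>}" unfolding n by (intro imageI) auto
  qed
qed simp

lemma convex_std_simplex: "convex (std_simplex :: (real^'c::finite) set)"
  unfolding std_simplex_def convex_def
  by (auto simp: sum.distrib simp flip: sum_distrib_left)

lemma closed_std_simplex: "closed (std_simplex :: (real^'c::finite) set)"
proof -
  have eq: "std_simplex = (\<Inter>i. {x :: real^'c. 0 \<le> x $ i}) \<inter> {x. (\<Sum>i\<in>UNIV. x $ i) = 1}"
    by (auto simp: std_simplex_def)
  moreover have "closed {x :: real^'c. 0 \<le> x $ i}" for i
    by (intro closed_Collect_le continuous_intros)
  moreover have "closed {x :: real^'c. (\<Sum>i\<in>UNIV. x $ i) = 1}"
    by (intro closed_Collect_eq continuous_intros)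
  ultimately show ?thesis unfolding eq by (intro closed_Int closed_INT) auto
qed

lemma bounded_std_simplex: "bounded (std_simplex :: (real^'c::finite) set)"
proof -
  have "norm x \<le> 1" if "x \<in> std_simplex" for x :: "real^'c"
  proof -
    have "norm x \<le> (\<Sum>i\<in>UNIV. \<bar>x $ i\<bar>)" by (rule norm_le_l1_cart)
    also have "\<dots> = 1" using that by (simp add: std_simplex_def)
    finally show ?thesis .
  qed
  then show ?thesis by (auto simp: bounded_iff)
qed

lemma compact_std_simplex: "compact (std_simplex :: (real^'c::finite) set)"
  using compact_eq_bounded_closed closed_std_simplex bounded_std_simplex by blast

lemma axis_std_simplex: "axis l 1 \<in> (std_simplex :: (real^'c::finite) set)"
  by (auto simp: std_simplex_def axis_def)

text \<open>The homeomorphism seen in the universal cover: \<open>h v\<close> lifts the map on the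
  simplex of \<open>v\<close>, and \<open>T v\<close> is a finite cover by polytopes on which the
  lift is affine. Lifts of neighbouring simplices are chosen independently, so \<open>glue\<close>
  can only ask for agreement modulo integer vectors.\<close>

locale torus_gem =
  fixes V :: "'v set" and adj :: "'c::finite \<Rightarrow> 'v \<Rightarrow> 'v"
    and h :: "'v \<Rightarrow> real^'c \<Rightarrow> real^4" and T :: "'v \<Rightarrow> (real^'c) set set"
  assumes graph: "colored_graph V adj"
    and finite_T: "v \<in> V \<Longrightarrow> finite (T v)"
    and Union_T: "v \<in> V \<Longrightarrow> \<Union>(T v) = std_simplex"
    and polytope_T: "v \<in> V \<Longrightarrow> t \<in> T v \<Longrightarrow> \<exists>F. finite F \<and> t = convex hull F"
    and affine_T: "v \<in> V \<Longrightarrow> t \<in> T v \<Longrightarrow> \<exists>L b. linear L \<and> (\<forall>x\<in>t. h v x = L x + b)"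
    and glue: "v \<in> V \<Longrightarrow> x \<in> std_simplex \<Longrightarrow> x $ j = 0 \<Longrightarrow>
      torus_cover (h (adj j v) x) = torus_cover (h v x)"
    and surj: "\<exists>v\<in>V. \<exists>x\<in>std_simplex. torus_cover (h v x) = torus_cover p"
    and inj: "v \<in> V \<Longrightarrow> w \<in> V \<Longrightarrow> x \<in> std_simplex \<Longrightarrow> y \<in> std_simplex \<Longrightarrow>
      torus_cover (h v x) = torus_cover (h w y) \<Longrightarrow> ((v, x), (w, y)) \<in> (K_ident V adj)\<^sup>*"
begin

lemma finite_V: "finite V" and adj_V: "v \<in> V \<Longrightarrow> adj c v \<in> V"
  using graph by (auto simp: colored_graph_def)

lemma V_nonempty: "V \<noteq> {}" using surj by blast

text \<open>Elementary identifications keep the barycentric coordinates and cross only facets that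
  contain the point.\<close>

lemma K_ident_rtrancl:
  assumes "((v, x), (w, y)) \<in> (K_ident V adj)\<^sup>*" "v \<in> V" "x \<in> std_simplex"
  shows "y = x \<and> (v, w) \<in> comp_rel V adj {j. x $ j = 0}"
  using assms(1)
proof (induction rule: rtrancl_induct2)
  case refl
  then show ?case using assms by (simp add: comp_rel_def)
next
  case (step w y w' y')
  then obtain j where j: "w \<in> V" "w' = adj j w" "y $ j = 0" "y' = y" by (auto simp: K_ident_def)
  have "(w, w') \<in> comp_rel V adj {j. x $ j = 0}"
    unfolding j(2) by (rule comp_rel_step[OF graph j(1)]) (use j step in auto)
  then show ?case
    using step j(4) equivE[OF comp_rel_equiv[OF graph]] by (metis transD)
qed

text \<open>Describes the points of the complex: an open face with label set \<open>A\<close> is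
  shared by the simplices of one residue of the colours outside \<open>A\<close>, and by no
  others.\<close>

lemma torus_cover_h_eq_iff:
  assumes "v \<in> V" "w \<in> V" "x \<in> std_simplex" "y \<in> std_simplex"
  shows "torus_cover (h v x) = torus_cover (h w y) \<longleftrightarrow> x = y \<and> (v, w) \<in> comp_rel V adj {j. x $ j = 0}"
proof
  assume "torus_cover (h v x) = torus_cover (h w y)"
  from K_ident_rtrancl[OF inj[OF assms this] assms(1,3)]
  show "x = y \<and> (v, w) \<in> comp_rel V adj {j. x $ j = 0}" by auto
next
  assume *: "x = y \<and> (v, w) \<in> comp_rel V adj {j. x $ j = 0}"
  have "torus_cover (h w x) = torus_cover (h v x)"
    by (rule comp_rel_invariant[OF graph conjunct2[OF *], where F = "\<lambda>v. torus_cover (h v x)"])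
      (rule glue, use assms in auto)
  then show "torus_cover (h v x) = torus_cover (h w y)" using * by simp
qed

lemma continuous_h:
  assumes "v \<in> V"
  shows "continuous_on std_simplex (h v)"
proof -
  have "continuous_on t (h v) \<and> closed t" if t: "t \<in> T v" for t
  proof -
    obtain L b where L: "linear L" "\<forall>x\<in>t. h v x = L x + b" using affine_T[OF assms t] by blast
    have "continuous_on t (\<lambda>x. L x + b)"
      by (intro continuous_intros linear_continuous_on linear_conv_bounded_linear[THEN iffD1] L)
    then have "continuous_on t (h v)" using L(2) by (simp cong: continuous_on_cong)
    moreover have "closed t"
      using polytope_T[OF assms t] compact_convex_hull finite_imp_compact compact_imp_closed by metis
    ultimately show ?thesis by blast
  qed
  then have "continuous_on (\<Union>t\<in>T v. t) (h v)"
    using finite_T[OF assms] by (intro continuous_on_closed_Union) auto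
  then show ?thesis using Union_T[OF assms] by simp
qed

text \<open>Over a common facet the difference of two lifts is continuous and integer valued on a
  connected set, hence a single deck transformation.\<close>

lemma transition_constant:
  assumes "v \<in> V" "x \<in> std_simplex" "y \<in> std_simplex" "x $ j = 0" "y $ j = 0"
  shows "h (adj j v) x - h v x = h (adj j v) y - h v y"
proof -
  let ?F = "{x \<in> std_simplex. x $ j = 0}" and ?g = "\<lambda>x. h (adj j v) x - h v x"
  have "convex {x :: real^'c. x $ j = 0}" by (auto simp: convex_def)
  then have "convex ?F" using convex_Int[OF convex_std_simplex] by (simp add: Collect_conj_eq)
  then have "connected ?F" by (rule convex_connected)
  have "(\<lambda>x. ?g x $ i) constant_on ?F" for i
  proof (rule continuous_discrete_range_constant)
    show "connected ?F" by fact
    show "continuous_on ?F (\<lambda>x. ?g x $ i)"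
      using assms(1) adj_V by (intro continuous_intros continuous_on_subset[OF continuous_h]) auto
    fix x assume x: "x \<in> ?F"
    show "\<exists>e>0. \<forall>y. y \<in> ?F \<and> ?g y $ i \<noteq> ?g x $ i \<longrightarrow> e \<le> norm (?g y $ i - ?g x $ i)"
    proof (intro exI[of _ 1] conjI allI impI)
      fix y assume y: "y \<in> ?F \<and> ?g y $ i \<noteq> ?g x $ i"
      have "?g x $ i \<in> \<int>" "?g y $ i \<in> \<int>"
        using glue[OF assms(1)] x y by (auto simp: torus_cover_eq_iff)
      then have "?g y $ i - ?g x $ i \<in> \<int>" by (rule Ints_diff[rotated])
      then show "1 \<le> norm (?g y $ i - ?g x $ i)" using y Ints_nonzero_abs_ge1 by fastforce
    qed simp
  qed
  then have "?g x $ i = ?g y $ i" for i using assms unfolding constant_on_def by (metis (mono_tags, lifting) mem_Collect_eq)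
  then show ?thesis by (simp only: vec_eq_iff) simp
qed

text \<open>Such a \<open>\<phi>\<close> descends to a continuous function on the torus whose lift differs from \<open>\<phi>\<close> by a constant.\<close>
lemma locally_linear_function_trivial:
  fixes \<phi> :: "real^4" and \<alpha> :: "'v \<Rightarrow> real"
  assumes "\<And>v j x. v \<in> V \<Longrightarrow> x \<in> std_simplex \<Longrightarrow> x $ j = 0 \<Longrightarrow>
     \<phi> \<bullet> h (adj j v) x - \<alpha> (adj j v) = \<phi> \<bullet> h v x - \<alpha> v"
  obtains k where "\<phi> = 0" "\<And>v. v \<in> V \<Longrightarrow> \<alpha> v = k"
proof -
  have welldef: "\<phi> \<bullet> h w y - \<alpha> w = \<phi> \<bullet> h v x - \<alpha> v"
    if "v \<in> V" "w \<in> V" "x \<in> std_simplex" "y \<in> std_simplex" "torus_cover (h v x) = torus_cover (h w y)"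
    for v w x y
  proof -
    have *: "x = y" "(v, w) \<in> comp_rel V adj {j. x $ j = 0}"
      using torus_cover_h_eq_iff[OF that(1-4)] that(5) by auto
    have "\<phi> \<bullet> h w x - \<alpha> w = \<phi> \<bullet> h v x - \<alpha> v"
      by (rule comp_rel_invariant[OF graph *(2), where F = "\<lambda>v. \<phi> \<bullet> h v x - \<alpha> v"])
        (rule assms, use that in auto)
    then show ?thesis using *(1) by simp
  qed
  have "\<exists>v x. v \<in> V \<and> x \<in> std_simplex \<and> torus_cover (h v x) = torus_cover p" for p
    using surj[of p] by blast
  then obtain vv xx where vx: "\<And>p. vv p \<in> V" "\<And>p. xx p \<in> std_simplex"
    "\<And>p. torus_cover (h (vv p) (xx p)) = torus_cover p" by metis
  \<comment> \<open>\<open>Q\<close> is the function on the torus, pulled back to the universal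
    cover, minus the linear function \<open>\<phi>\<close>; it will turn out constant.\<close>
  define Q where "Q p = \<phi> \<bullet> h (vv p) (xx p) - \<alpha> (vv p) - \<phi> \<bullet> p" for p
  have Q: "Q p = \<phi> \<bullet> h v x - \<alpha> v - \<phi> \<bullet> p"
    if "v \<in> V" "x \<in> std_simplex" "torus_cover (h v x) = torus_cover p" for v x p
    using welldef[of v "vv p" x "xx p"] vx[of p] that by (simp add: Q_def)
  \<comment> \<open>The lifted simplex of \<open>v\<close> shifted by \<open>- n\<close>. For
    integer \<open>n\<close>, \<open>Q\<close> takes only the value
    \<open>\<phi> \<bullet> n - \<alpha> v\<close> there.\<close>
  define D where "D = (\<lambda>(v, n). {p. p + n \<in> h v ` std_simplex})"
  have const_ball: "Q p = Q 0" for p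
  proof -
    have "\<exists>K. \<forall>x\<in>std_simplex. norm (h v x) \<le> K" if "v \<in> V" for v
      using compact_continuous_image[OF continuous_h[OF that] compact_std_simplex]
      by (auto dest!: compact_imp_bounded simp: bounded_iff)
    then obtain K where K: "\<And>v x. v \<in> V \<Longrightarrow> x \<in> std_simplex \<Longrightarrow> norm (h v x) \<le> K v" by metis
    \<comment> \<open>On the ball of radius \<open>norm p\<close> only integer shifts with entries
      up to \<open>M\<close> are needed, so finitely many closed pieces cover it and
      \<open>Q\<close> has finitely many values.\<close>
    define M where "M = norm p + Max (K ` V)"
    define N where "N = {n :: real^4. \<forall>i. n $ i \<in> {x. x \<in> \<int> \<and> \<bar>x\<bar> \<le> M}}"
    let ?S = "cball 0 (norm p) :: (real^4) set"
    have finN: "finite N" unfolding N_def by (intro finite_vec finite_Ints_bounded)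
    have cover: "?S = (\<Union>i\<in>V \<times> N. ?S \<inter> D i)"
    proof (intro equalityI subsetI)
      fix q assume q: "q \<in> ?S"
      define n where "n = h (vv q) (xx q) - q"
      have "n $ i \<in> \<int>" for i using vx(3)[of q] by (simp add: n_def torus_cover_eq_iff)
      moreover have "\<bar>n $ i\<bar> \<le> M" for i
      proof -
        have "\<bar>n $ i\<bar> \<le> norm n" by (rule component_le_norm_cart)
        also have "\<dots> \<le> norm (h (vv q) (xx q)) + norm q" unfolding n_def by (rule norm_triangle_ineq4)
        also have "norm (h (vv q) (xx q)) \<le> Max (K ` V)"
          using K[OF vx(1,2)] finite_V vx(1)[of q] by (meson Max_ge finite_imageI imageI order_trans)
        also have "norm q \<le> norm p" using q by simp
        finally show ?thesis by (simp add: M_def)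
      qed
      ultimately have "n \<in> N" by (simp add: N_def)
      moreover have "q + n = h (vv q) (xx q)" by (simp add: n_def)
      ultimately show "q \<in> (\<Union>i\<in>V \<times> N. ?S \<inter> D i)" using q vx(1,2)[of q] by (auto simp: D_def)
    qed auto
    have Qc: "Q q = \<phi> \<bullet> n - \<alpha> v" if "v \<in> V" "n \<in> N" "q \<in> D (v, n)" for q v n
    proof -
      obtain x where x: "x \<in> std_simplex" "q + n = h v x" using \<open>q \<in> D (v, n)\<close> by (auto simp: D_def)
      then have "torus_cover (h v x) = torus_cover q"
        using \<open>n \<in> N\<close> by (simp add: torus_cover_eq_iff N_def flip: x(2))
      from Q[OF \<open>v \<in> V\<close> x(1) this] show ?thesis by (simp add: inner_add_right flip: x(2))
    qed
    have "continuous_on (\<Union>i\<in>V \<times> N. ?S \<inter> D i) Q"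
    proof (rule continuous_on_closed_Union)
      show "finite (V \<times> N)" using finN finite_V by simp
      fix i assume "i \<in> V \<times> N"
      then obtain v n where i: "i = (v, n)" "v \<in> V" "n \<in> N" by auto
      have "closed (h v ` std_simplex)"
        using compact_continuous_image[OF continuous_h[OF i(2)] compact_std_simplex] by (rule compact_imp_closed)
      then have "closed ((\<lambda>p. p + n) -` (h v ` std_simplex))"
        by (intro closed_vimage continuous_intros)
      then show "closed (?S \<inter> D i)" by (auto simp: D_def i vimage_def intro!: closed_Int)
      have "continuous_on (?S \<inter> D i) (\<lambda>_. \<phi> \<bullet> n - \<alpha> v)" by simp
      then show "continuous_on (?S \<inter> D i) Q"
        by (rule continuous_on_eq) (use Qc i in auto)
    qed
    then have "continuous_on ?S Q" using cover by simp
    moreover have "finite (Q ` ?S)"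
    proof (rule finite_subset)
      show "Q ` ?S \<subseteq> (\<lambda>(v, n). \<phi> \<bullet> n - \<alpha> v) ` (V \<times> N)"
      proof (rule image_subsetI)
        fix q assume "q \<in> ?S"
        then have "q \<in> (\<Union>i\<in>V \<times> N. ?S \<inter> D i)" using cover by blast
        then obtain v n where "v \<in> V" "n \<in> N" "q \<in> D (v, n)" by auto
        then show "Q q \<in> (\<lambda>(v, n). \<phi> \<bullet> n - \<alpha> v) ` (V \<times> N)" using Qc by force
      qed
    qed (use finN finite_V in auto)
    ultimately have "Q constant_on ?S"
      using continuous_finite_range_constant[of ?S Q] connected_cball by blast
    then show ?thesis by (auto simp: constant_on_def)
  qed
  \<comment> \<open>A unit translation fixes the point of the torus but changes \<open>Q\<close> by
    a coordinate of \<open>\<phi>\<close>.\<close>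
  have "\<phi> $ i = 0" for i
  proof -
    have "torus_cover (axis i 1) = torus_cover 0" by (simp add: torus_cover_eq_iff axis_def)
    then have "Q (axis i 1) = Q 0 - \<phi> \<bullet> axis i 1"
      using Q[of "vv 0" "xx 0" "axis i 1"] Q[of "vv 0" "xx 0" 0] vx[of 0] by simp
    then show ?thesis using const_ball[of "axis i 1"] by (simp add: inner_axis)
  qed
  then have "\<phi> = 0" by (simp add: vec_eq_iff)
  moreover have "\<alpha> v = - Q 0" if "v \<in> V" for v
  proof -
    have "Q (h v (axis undefined 1)) = - \<alpha> v"
      using Q[OF that axis_std_simplex refl] by simp
    then show ?thesis using const_ball[of "h v (axis undefined 1)"] by simp
  qed
  ultimately show ?thesis using that by blast
qed

text \<open>Residues of all colours but \<open>l\<close> are the vertices labelled \<open>l\<close>;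
  those of all colours but \<open>l\<close> and \<open>m\<close> are the edges joining these labels.
  With too few edges, counting unknowns yields a nontrivial solution: vertex potentials whose
  differences are the values of a functional \<open>\<phi>\<close> along the edges. As every facet
  contains a vertex labelled \<open>l\<close> or \<open>m\<close>, the potentials give one
  correcting constant per simplex, so \<open>\<phi>\<close> descends to the torus and everything
  vanishes.\<close>

lemma edge_count:
  assumes lm: "l \<noteq> m"
  shows "g_comp V adj (UNIV - {l}) + g_comp V adj (UNIV - {m}) + 3 \<le> g_comp V adj (UNIV - {l, m})"
proof (rule ccontr)
  assume neg: "\<not> ?thesis"
  define R where "R C = comp_rel V adj C" for C
  have eqR: "equiv V (R C)" for C unfolding R_def by (rule comp_rel_equiv[OF graph])
  define cl where "cl C v = R C `` {v}" for C v
  have finq: "finite (V // R C)" for C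
    using finite_quotient finite_V eqR unfolding equiv_def by blast
  obtain v0 where v0: "v0 \<in> V" using V_nonempty by blast
  let ?L = "UNIV - {l}" and ?M = "UNIV - {m}" and ?E = "UNIV - {l, m}"
  have clq: "cl C v \<in> V // R C" if "v \<in> V" for C v using that by (auto simp: cl_def intro: quotientI)
  have cl_adj: "cl C (adj c v) = cl C v" if "v \<in> V" "c \<in> C" for C c v
    unfolding cl_def using equiv_class_eq[OF eqR] comp_rel_step[OF graph that] by (simp add: R_def)
  define rep where "rep e = (SOME v. v \<in> V \<and> cl ?E v = e)" for e
  have rep: "rep e \<in> V \<and> cl ?E (rep e) = e" if "e \<in> V // R ?E" for e
    unfolding rep_def by (rule someI_ex) (use that in \<open>auto simp: cl_def elim!: quotientE\<close>)
  \<comment> \<open>The lifted edge vector from the \<open>l\<close>-vertex to the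
    \<open>m\<close>-vertex; \<open>d_adj\<close> shows that it depends only on the edge, so any
    representative simplex will do.\<close>
  define d where "d v = h v (axis m 1) - h v (axis l 1)" for v
  \<comment> \<open>The unknowns are the potentials of both kinds of vertices and the four
    coordinates of the functional. One \<open>l\<close>-vertex is left out, its potential being set
    to 0, to exclude the constant solution; hence 3 = 4 - 1 in the claim.\<close>
  define X where "X = ((V // R ?L - {cl ?L v0}) <+> V // R ?M) <+> (UNIV :: 4 set)"
  define A where "A x e = (case x of Inl (Inl c) \<Rightarrow> - (if c = cl ?L (rep e) then 1 else 0)
      | Inl (Inr c) \<Rightarrow> (if c = cl ?M (rep e) then 1 else 0) | Inr i \<Rightarrow> - (d (rep e) $ i))" for x e
  have "card (V // R ?L) > 0" using clq[OF v0] finq by (auto simp: card_gt_0_iff)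
  then have "card X = g_comp V adj ?L - 1 + g_comp V adj ?M + 4" "g_comp V adj ?L > 0"
    unfolding X_def using finq clq[OF v0] by (simp_all add: card_Plus g_comp_def R_def)
  then have "card (V // R ?E) < card X" using neg by (simp add: g_comp_def R_def)
  moreover have "finite X" unfolding X_def using finq by simp
  ultimately obtain c where c: "\<exists>x\<in>X. c x \<noteq> 0" "\<And>e. e \<in> V // R ?E \<Longrightarrow> (\<Sum>x\<in>X. c x * A x e) = 0"
    using homogeneous_system_solution[OF finq[of ?E], of X A] by auto
  define FL where "FL k = (if k = cl ?L v0 then 0 else c (Inl (Inl k)))" for k
  define FM where "FM k = c (Inl (Inr k))" for k
  define \<phi> where "\<phi> = (\<chi> i. c (Inr i))"
  have rep_eq: "FM (cl ?M (rep e)) - FL (cl ?L (rep e)) = \<phi> \<bullet> d (rep e)" if e: "e \<in> V // R ?E" for e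
  proof -
    have "(\<Sum>x\<in>X. c x * A x e) = (\<Sum>k\<in>V // R ?L - {cl ?L v0}. c (Inl (Inl k)) * - (if k = cl ?L (rep e) then 1 else 0))
       + (\<Sum>k\<in>V // R ?M. c (Inl (Inr k)) * (if k = cl ?M (rep e) then 1 else 0)) + (\<Sum>i\<in>UNIV. c (Inr i) * - (d (rep e) $ i))"
      unfolding X_def using finq by (subst sum.Plus; simp add: A_def)+
    also have "(\<Sum>k\<in>V // R ?L - {cl ?L v0}. c (Inl (Inl k)) * - (if k = cl ?L (rep e) then 1 else 0))
       = (\<Sum>k\<in>V // R ?L - {cl ?L v0}. if k = cl ?L (rep e) then - c (Inl (Inl k)) else 0)"
      by (intro sum.cong) auto
    also have "\<dots> = - FL (cl ?L (rep e))"
      using finq clq[of "rep e" ?L] rep[OF e] by (simp add: FL_def sum.delta)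
    also have "(\<Sum>k\<in>V // R ?M. c (Inl (Inr k)) * (if k = cl ?M (rep e) then 1 else 0)) = FM (cl ?M (rep e))"
      using finq clq[of "rep e" ?M] rep[OF e] by (simp add: FM_def if_distrib sum.delta cong: if_cong)
    also have "(\<Sum>i\<in>UNIV. c (Inr i) * - (d (rep e) $ i)) = - (\<phi> \<bullet> d (rep e))"
      by (simp add: \<phi>_def inner_vec_def sum_negf)
    finally show ?thesis using c(2)[OF e] by linarith
  qed
  have d_adj: "d (adj j v) = d v" if "v \<in> V" "j \<in> ?E" for j v
    using transition_constant[OF that(1) axis_std_simplex axis_std_simplex, of m j l] that(2)
    by (simp add: d_def axis_def algebra_simps)
  have all_eq: "FM (cl ?M v) - FL (cl ?L v) = \<phi> \<bullet> d v" if v: "v \<in> V" for v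
  proof -
    let ?e = "cl ?E v"
    let ?G = "\<lambda>v. FM (cl ?M v) - FL (cl ?L v) - \<phi> \<bullet> d v"
    have "(v, rep ?e) \<in> R ?E"
      using rep[OF clq[OF v, of ?E]] v eq_equiv_class_iff[OF eqR, of v "rep ?e" ?E] by (simp add: cl_def)
    then have "(v, rep ?e) \<in> comp_rel V adj ?E" by (simp add: R_def)
    moreover have "?G (adj c v) = ?G v" if "v \<in> V" "c \<in> ?E" for v c
      using that cl_adj[of v c ?L] cl_adj[of v c ?M] d_adj[of v c] by auto
    ultimately have "?G (rep ?e) = ?G v" by (rule comp_rel_invariant[OF graph, where F = ?G])
    then show ?thesis using rep_eq[OF clq[OF v]] by simp
  qed
  \<comment> \<open>The correcting constant of \<open>v\<close>, read off at its
    \<open>l\<close>-vertex; by \<open>all_eq\<close> the \<open>m\<close>-vertex gives the same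
    value.\<close>
  define \<alpha> where "\<alpha> v = \<phi> \<bullet> h v (axis l 1) - FL (cl ?L v)" for v
  have \<alpha>': "\<alpha> v = \<phi> \<bullet> h v (axis m 1) - FM (cl ?M v)" if "v \<in> V" for v
    using all_eq[OF that] by (simp add: \<alpha>_def d_def inner_diff_right)
  \<comment> \<open>The facet opposite \<open>j\<close> contains the \<open>l\<close>-vertex unless
    \<open>j = l\<close>, and in that case the \<open>m\<close>-vertex. Comparing there suffices
    because the transition is constant on the facet.\<close>
  have "\<phi> \<bullet> h (adj j v) x - \<alpha> (adj j v) = \<phi> \<bullet> h v x - \<alpha> v"
    if v: "v \<in> V" and x: "x \<in> std_simplex" "x $ j = 0" for v j x
  proof (cases "j = l")
    case False
    have "h (adj j v) x - h v x = h (adj j v) (axis l 1) - h v (axis l 1)"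
      using False by (intro transition_constant[OF v x(1) axis_std_simplex x(2)]) (simp add: axis_def)
    then have "\<phi> \<bullet> (h (adj j v) x - h v x) = \<phi> \<bullet> (h (adj j v) (axis l 1) - h v (axis l 1))" by simp
    moreover have "cl ?L (adj j v) = cl ?L v" using False by (intro cl_adj v) auto
    ultimately show ?thesis by (simp add: \<alpha>_def inner_diff_right)
  next
    case True
    have "h (adj j v) x - h v x = h (adj j v) (axis m 1) - h v (axis m 1)"
      using True lm by (intro transition_constant[OF v x(1) axis_std_simplex x(2)]) (simp add: axis_def)
    then have "\<phi> \<bullet> (h (adj j v) x - h v x) = \<phi> \<bullet> (h (adj j v) (axis m 1) - h v (axis m 1))" by simp
    moreover have "cl ?M (adj j v) = cl ?M v" using True lm by (intro cl_adj v) auto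
    ultimately show ?thesis using \<alpha>'[OF v] \<alpha>'[OF adj_V[OF v]] by (simp add: inner_diff_right)
  qed
  from locally_linear_function_trivial[of \<phi> \<alpha>, OF this]
  obtain k where k: "\<phi> = 0" "\<And>v. v \<in> V \<Longrightarrow> \<alpha> v = k" by blast
  \<comment> \<open>The normalised potential pins the common constant \<open>k\<close> to 0, and
    then both potentials vanish.\<close>
  have "FL (cl ?L v0) = 0" by (simp add: FL_def)
  then have "k = 0" using k(2)[OF v0] k(1) by (simp add: \<alpha>_def)
  then have FL0: "FL (cl ?L v) = 0" and FM0: "FM (cl ?M v) = 0" if "v \<in> V" for v
    using k(2)[OF that] \<alpha>'[OF that] k(1) by (simp_all add: \<alpha>_def)
  have "c x = 0" if "x \<in> X" for x
  proof -
    have "FL q = 0" if "q \<in> V // R ?L" for q using that FL0 by (auto simp: cl_def elim!: quotientE)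
    then have "c (Inl (Inl q)) = 0" if "q \<in> V // R ?L" "q \<noteq> cl ?L v0" for q
      using that by (metis FL_def)
    moreover have "c (Inl (Inr q)) = 0" if "q \<in> V // R ?M" for q
      using that FM0 by (auto simp: cl_def FM_def elim!: quotientE)
    moreover have "c (Inr i) = 0" for i using k(1) by (simp add: \<phi>_def vec_eq_iff)
    ultimately show ?thesis using \<open>x \<in> X\<close> unfolding X_def by (elim PlusE DiffE) auto
  qed
  then show False using c(1) by blast
qed

end

section \<open>Cell decompositions\<close>

text \<open>Weights 1 on one partition and -1 on the other cancel at every point.\<close>

lemma euler_two_partitions:
  fixes C :: "'i \<Rightarrow> 'a::euclidean_space set" and D :: "'j \<Rightarrow> 'a set"
  assumes "finite I" "finite J"
    and C: "\<And>i. i \<in> I \<Longrightarrow> convex (C i) \<and> rel_open (C i) \<and> bounded (C i) \<and> C i \<noteq> {}"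
    and D: "\<And>j. j \<in> J \<Longrightarrow> convex (D j) \<and> rel_open (D j) \<and> bounded (D j) \<and> D j \<noteq> {}"
    and disjC: "\<And>i i' x. i \<in> I \<Longrightarrow> i' \<in> I \<Longrightarrow> x \<in> C i \<Longrightarrow> x \<in> C i' \<Longrightarrow> i = i'"
    and disjD: "\<And>i i' x. i \<in> J \<Longrightarrow> i' \<in> J \<Longrightarrow> x \<in> D i \<Longrightarrow> x \<in> D i' \<Longrightarrow> i = i'"
    and eq: "(\<Union>i\<in>I. C i) = (\<Union>j\<in>J. D j)"
  shows "(\<Sum>i\<in>I. (-1) ^ nat (aff_dim (C i))) = (\<Sum>j\<in>J. (-1::int) ^ nat (aff_dim (D j)))"
proof -
  define E where "E = case_sum C D"
  define m :: "'i + 'j \<Rightarrow> int" where "m = case_sum (\<lambda>_. 1) (\<lambda>_. -1)"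
  have ind: "(\<Sum>k\<in>K. if x \<in> F k then 1 else 0) = (if x \<in> (\<Union>k\<in>K. F k) then 1 else (0::int))"
    if K: "finite K" "\<And>i i'. i \<in> K \<Longrightarrow> i' \<in> K \<Longrightarrow> x \<in> F i \<Longrightarrow> x \<in> F i' \<Longrightarrow> i = i'"
    for K :: "'k set" and F :: "'k \<Rightarrow> 'a set" and x
  proof (cases "x \<in> (\<Union>k\<in>K. F k)")
    case True
    then obtain k where k: "k \<in> K" "x \<in> F k" by blast
    have "(\<Sum>k\<in>K. if x \<in> F k then 1 else 0) = (\<Sum>j\<in>K. if j = k then 1 else (0::int))"
      by (intro sum.cong) (use k K(2) in auto)
    then show ?thesis using True k K(1) by simp
  qed (auto intro!: sum.neutral)
  have "(\<Sum>k\<in>I <+> J. m k * (-1) ^ nat (aff_dim (E k))) = 0"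
  proof (rule euler_relation)
    show "finite (I <+> J)" using assms(1,2) by simp
    show "convex (E k) \<and> rel_open (E k) \<and> bounded (E k) \<and> E k \<noteq> {}" if "k \<in> I <+> J" for k
      using that C D unfolding E_def by (elim PlusE) simp_all
    show "(\<Sum>k\<in>I <+> J. if x \<in> E k then m k else 0) = 0" for x
    proof -
      have "(\<Sum>k\<in>I <+> J. if x \<in> E k then m k else 0)
          = (\<Sum>i\<in>I. if x \<in> C i then 1 else 0) + (\<Sum>j\<in>J. if x \<in> D j then -1 else 0)"
        using assms(1,2) by (subst sum.Plus) (simp_all add: E_def m_def cong: if_cong)
      also have "(\<Sum>j\<in>J. if x \<in> D j then -1 else (0::int)) = - (\<Sum>j\<in>J. if x \<in> D j then 1 else 0)"
        unfolding sum_negf[symmetric] by (intro sum.cong) auto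
      also have "(\<Sum>j\<in>J. if x \<in> D j then 1 else (0::int)) = (if x \<in> (\<Union>j\<in>J. D j) then 1 else 0)"
        using disjD by (intro ind assms(2)) blast
      also have "(\<Sum>i\<in>I. if x \<in> C i then 1 else (0::int)) = (if x \<in> (\<Union>j\<in>J. D j) then 1 else 0)"
        unfolding eq[symmetric] using disjC by (intro ind assms(1)) blast
      finally show ?thesis by simp
    qed
  qed
  then show ?thesis using assms(1,2) by (simp add: sum.Plus E_def m_def sum_negf)
qed

text \<open>The face through \<open>x\<close> of a hyperplane arrangement, each hyperplane being a
  pair of normal vector and offset.\<close>

definition cell :: "('a::euclidean_space \<times> real) set \<Rightarrow> 'a \<Rightarrow> 'a set" where
  "cell H x = {y. \<forall>p\<in>H. sgn (fst p \<bullet> y - snd p) = sgn (fst p \<bullet> x - snd p)}"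

lemma cell_self: "x \<in> cell H x"
  by (auto simp: cell_def)

lemma cell_eq: "y \<in> cell H x \<Longrightarrow> cell H y = cell H x"
  by (auto simp: cell_def)

lemma finite_cells:
  assumes "finite H"
  shows "finite (range (cell H))"
proof -
  let ?s = "\<lambda>x. restrict (\<lambda>p. sgn (fst p \<bullet> x - snd p)) H"
  have "cell H x = {y. ?s y = ?s x}" for x
    unfolding cell_def by (auto simp: restrict_def fun_eq_iff)
  then have "range (cell H) = (\<lambda>s. {y. ?s y = s}) ` range ?s" by (simp add: image_image)
  moreover have "range ?s \<subseteq> Pi\<^sub>E H (\<lambda>_. {-1, 0, 1})"
    by (auto simp: sgn_if split: if_splits)
  then have "finite (range ?s)"
    by (rule finite_subset) (intro finite_PiE assms, simp)
  ultimately show ?thesis by simp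
qed

lemma convex_rel_open_cell:
  assumes "finite H"
  shows "convex (cell H x) \<and> rel_open (cell H x)"
proof -
  let ?S = "\<lambda>p. {y. sgn (fst p \<bullet> y - snd p) = sgn (fst p \<bullet> x - snd p)}"
  have eq: "cell H x = \<Inter>(?S ` H)" by (auto simp: cell_def)
  have "convex (?S p) \<and> rel_open (?S p)" for p
  proof -
    obtain a b where p: "p = (a, b)" by (cases p)
    have op: "rel_open S" if "open S" for S :: "'a set"
      using that by (simp add: rel_open_def rel_interior_open)
    consider "a \<bullet> x = b" | "a \<bullet> x < b" | "a \<bullet> x > b" by linarith
    then show ?thesis
    proof cases
      case 1
      then have "?S p = {y. a \<bullet> y = b}" by (auto simp: p sgn_if)
      then show ?thesis by (simp add: convex_hyperplane affine_rel_open affine_hyperplane)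
    next
      case 2
      then have "?S p = {y. a \<bullet> y < b}" by (auto simp: p sgn_if split: if_splits)
      then show ?thesis by (simp add: convex_halfspace_lt op open_halfspace_lt)
    next
      case 3
      then have "?S p = {y. a \<bullet> y > b}" by (auto simp: p sgn_if split: if_splits)
      then show ?thesis by (simp add: convex_halfspace_gt op open_halfspace_gt)
    qed
  qed
  then show ?thesis unfolding eq
    by (intro convex_rel_open_finite_Inter) (use assms in auto)
qed

text \<open>Membership in a polytope is decided by the signs of its defining inequalities. The claim
  covers every larger \<open>G\<close> so that the hyperplanes of several pieces can be united
  later.\<close>

lemma polytope_cell:
  fixes F :: "'a::euclidean_space set"
  assumes "finite F"
  shows "\<exists>H. finite H \<and> (\<forall>x\<in>convex hull F. \<forall>G. H \<subseteq> G \<longrightarrow> cell G x \<subseteq> convex hull F)"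
proof -
  obtain \<H> where \<H>: "finite \<H>" "convex hull F = \<Inter>\<H>" "\<forall>S\<in>\<H>. \<exists>a b. a \<noteq> 0 \<and> S = {x. a \<bullet> x \<le> b}"
    using polyhedron_convex_hull[OF assms] by (auto simp only: polyhedron_def)
  have "\<forall>S\<in>\<H>. \<exists>q. S = {x. fst q \<bullet> x \<le> snd q}" using \<H>(3) by (metis fst_conv snd_conv)
  then obtain p where p: "\<And>S. S \<in> \<H> \<Longrightarrow> S = {x. fst (p S) \<bullet> x \<le> snd (p S)}"
    by (metis (no_types))
  have "y \<in> convex hull F" if "x \<in> convex hull F" "p ` \<H> \<subseteq> G" "y \<in> cell G x" for x y G
  proof -
    have "y \<in> S" if S: "S \<in> \<H>" for S
    proof -
      have "p S \<in> G" using S \<open>p ` \<H> \<subseteq> G\<close> by blast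
      then have "sgn (fst (p S) \<bullet> y - snd (p S)) = sgn (fst (p S) \<bullet> x - snd (p S))"
        using \<open>y \<in> cell G x\<close> by (simp add: cell_def)
      moreover have "fst (p S) \<bullet> x \<le> snd (p S)" using p[OF S] S \<H>(2) \<open>x \<in> convex hull F\<close> by blast
      ultimately have "fst (p S) \<bullet> y \<le> snd (p S)" by (auto simp: sgn_if split: if_splits)
      then show "y \<in> S" using p[OF S] by blast
    qed
    then show ?thesis using \<H>(2) by blast
  qed
  then show ?thesis using \<H>(1) by (intro exI[of _ "p ` \<H>"]) blast
qed

text \<open>The integer level hyperplanes of coordinate \<open>i\<close> separate the unit slabs,
  and boundedness leaves finitely many of them. The adjoint supplies their normal vector.\<close>

lemma floor_cell:
  fixes L :: "'a::euclidean_space \<Rightarrow> real^'n"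
  assumes "linear L" "\<And>x. x \<in> t \<Longrightarrow> \<bar>(L x + b) $ i\<bar> \<le> M"
  shows "\<exists>H. finite H \<and> (\<forall>x\<in>t. \<forall>G. H \<subseteq> G \<longrightarrow> (\<forall>y\<in>cell G x. \<lfloor>(L y + b) $ i\<rfloor> = \<lfloor>(L x + b) $ i\<rfloor>))"
proof -
  let ?a = "adjoint L (axis i 1)"
  have La: "(L x + b) $ i = ?a \<bullet> x + b $ i" for x
    using adjoint_works[OF assms(1), of x "axis i 1"] by (simp add: inner_axis inner_commute)
  \<comment> \<open>The range has a margin of one, since the levels at the floor and at the next
    integer are both needed.\<close>
  define H where "H = (\<lambda>n::int. (?a, n - b $ i)) ` {-\<lceil>M\<rceil> - 1..\<lceil>M\<rceil> + 1}"
  have "\<lfloor>(L y + b) $ i\<rfloor> = \<lfloor>(L x + b) $ i\<rfloor>" if "x \<in> t" "H \<subseteq> G" "y \<in> cell G x" for x y G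
  proof -
    let ?n = "\<lfloor>(L x + b) $ i\<rfloor>"
    have "\<bar>(L x + b) $ i\<bar> \<le> M" using assms(2) that(1) by blast
    then have "-\<lceil>M\<rceil> - 1 \<le> ?n" "?n + 1 \<le> \<lceil>M\<rceil> + 1" by linarith+
    then have "(?a, ?n - b $ i) \<in> H" "(?a, of_int (?n + 1) - b $ i) \<in> H"
      unfolding H_def by (intro image_eqI[of _ _ ?n] image_eqI[of _ _ "?n + 1"]; simp)+
    then have "(?a, ?n - b $ i) \<in> G" "(?a, of_int (?n + 1) - b $ i) \<in> G" using that(2) by blast+
    then have "sgn (?a \<bullet> y - (?n - b $ i)) = sgn (?a \<bullet> x - (?n - b $ i))"
      "sgn (?a \<bullet> y - (of_int (?n + 1) - b $ i)) = sgn (?a \<bullet> x - (of_int (?n + 1) - b $ i))"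
      using that(3) unfolding cell_def by force+
    moreover have "?a \<bullet> x - (?n - b $ i) \<ge> 0" "?a \<bullet> x - (of_int (?n + 1) - b $ i) < 0"
      using La[of x] by linarith+
    ultimately have "?a \<bullet> y - (?n - b $ i) \<ge> 0" "?a \<bullet> y - (of_int (?n + 1) - b $ i) < 0"
      by (auto simp: sgn_if split: if_splits)
    then show ?thesis using La[of y] by linarith
  qed
  moreover have "finite H" by (simp add: H_def)
  ultimately show ?thesis by blast
qed

text \<open>Injectivity on \<open>C\<close> extends to its direction space: a kernel vector, scaled
  down, would join two points of the relatively open \<open>C\<close> with equal images.\<close>

lemma aff_dim_linear_image_inj_on:
  fixes L :: "'a::euclidean_space \<Rightarrow> 'b::euclidean_space"
  assumes "linear L" "rel_open C" "inj_on L C"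
  shows "aff_dim (L ` C) = aff_dim C"
proof (cases "C = {}")
  case False
  then obtain a where a: "a \<in> C" by blast
  let ?D = "(\<lambda>x. x - a) ` C"
  obtain e where e: "e > 0" "ball a e \<inter> affine hull C \<subseteq> C"
    using assms(2) a unfolding rel_open openin_contains_ball by blast
  have sp: "span ?D = (\<lambda>x. x - a) ` (affine hull C)"
    using diffs_affine_hull_span[OF a] by simp
  have "inj_on L (span ?D)"
  proof (subst linear_injective_on_subspace_0[OF assms(1) subspace_span], intro ballI impI)
    fix w assume w: "w \<in> span ?D" "L w = 0"
    \<comment> \<open>Small enough to keep the displaced point within distance \<open>e\<close> of
      \<open>a\<close>; the summand 1 avoids division by zero for \<open>w = 0\<close>.\<close>
    define s where "s = e / (2 * (norm w + 1))"
    have s: "s > 0" "norm (s *\<^sub>R w) < e"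
    proof -
      show "s > 0" using e by (simp add: s_def add_nonneg_pos)
      have "norm (s *\<^sub>R w) = (e / 2) * (norm w / (norm w + 1))" using \<open>s > 0\<close> e by (simp add: s_def)
      also have "\<dots> \<le> (e / 2) * 1" using e using norm_ge_zero[of w]
        by (intro mult_left_mono) (auto simp: divide_le_eq simp del: norm_ge_zero)
      also have "\<dots> < e" using e by simp
      finally show "norm (s *\<^sub>R w) < e" .
    qed
    have "s *\<^sub>R w \<in> span ?D" using w by (simp add: span_scale)
    then obtain y where y: "y \<in> affine hull C" "s *\<^sub>R w = y - a" unfolding sp by blast
    then have "y \<in> ball a e" using s by (simp add: dist_norm norm_minus_commute)
    then have "y \<in> C" using e y by blast
    moreover have "L y = L a"
      using w(2) y(2) linear_diff[OF assms(1), of y a] linear_scale[OF assms(1), of s w] by simp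
    ultimately have "y = a" using a assms(3) by (auto dest: inj_onD)
    then show "w = 0" using y s by simp
  qed
  then have "dim (L ` ?D) = dim ?D" using assms(1) by (intro dim_image_eq) auto
  moreover have "L ` ?D = (\<lambda>y. y - L a) ` (L ` C)"
    using linear_diff[OF assms(1)] by (auto simp: image_image)
  moreover have "aff_dim C = int (dim ?D)"
    using a by (intro aff_dim_eq_dim_subtract hull_inc)
  moreover have "aff_dim (L ` C) = int (dim ((\<lambda>y. y - L a) ` (L ` C)))"
    using a by (intro aff_dim_eq_dim_subtract hull_inc imageI)
  ultimately show ?thesis by simp
qed simp

definition open_face :: "'c::finite set \<Rightarrow> (real^'c) set" where
  "open_face A = {x \<in> std_simplex. \<forall>i. x $ i = 0 \<longleftrightarrow> i \<notin> A}"

text \<open>The vertices are affinely independent, so the relative interior of their hull consists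
  of the combinations with positive coefficients, which here are the coordinates themselves.\<close>

lemma open_face:
  fixes A :: "'c::finite set"
  assumes "A \<noteq> {}"
  shows "convex (open_face A) \<and> rel_open (open_face A) \<and> bounded (open_face A) \<and> open_face A \<noteq> {}
    \<and> aff_dim (open_face A) = int (card A) - 1"
proof -
  let ?B = "(\<lambda>i. axis i 1 :: real^'c) ` A"
  have inj: "inj_on (\<lambda>i. axis i 1 :: real^'c) A" by (auto simp: inj_on_def axis_eq_axis)
  have "?B \<subseteq> Basis" by (auto simp: axis_in_Basis_iff)
  then have "independent ?B" by (rule independent_mono[OF independent_Basis])
  then have ind: "\<not> affine_dependent ?B" using affine_dependent_imp_dependent by blast
  have "open_face A = {y. \<exists>u. (\<forall>x\<in>?B. 0 < u x) \<and> sum u ?B = 1 \<and> (\<Sum>x\<in>?B. u x *\<^sub>R x) = y}"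
  proof (intro equalityI subsetI)
    fix y assume y: "y \<in> open_face A"
    have yA: "y $ i = 0" if "i \<notin> A" for i using y that by (simp add: open_face_def)
    have pos: "0 < y $ i" if "i \<in> A" for i
      using y that by (auto simp: open_face_def std_simplex_def order.strict_iff_order)
    have "(\<Sum>i\<in>A. y $ i) = (\<Sum>i\<in>UNIV. y $ i)" using yA by (intro sum.mono_neutral_left) auto
    also have "\<dots> = 1" using y by (simp add: open_face_def std_simplex_def)
    finally have "sum (\<lambda>x. x \<bullet> y) ?B = 1"
      using inj by (simp add: sum.reindex inner_axis')
    moreover have "(\<Sum>x\<in>?B. (x \<bullet> y) *\<^sub>R x) = y"
    proof -
      have "(\<Sum>x\<in>?B. (x \<bullet> y) *\<^sub>R x) $ j = y $ j" for j
      proof -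
        have "(\<Sum>x\<in>?B. (x \<bullet> y) *\<^sub>R x) = (\<Sum>i\<in>A. y $ i *\<^sub>R axis i 1)"
          using inj by (simp add: sum.reindex inner_axis')
        then have "(\<Sum>x\<in>?B. (x \<bullet> y) *\<^sub>R x) $ j = (\<Sum>i\<in>A. if i = j then y $ i else 0)"
          by (simp only: sum_component) (intro sum.cong, auto simp: axis_def)
        then show ?thesis using yA by simp
      qed
      then show ?thesis by (simp add: vec_eq_iff)
    qed
    moreover have "\<forall>x\<in>?B. 0 < x \<bullet> y" using pos by (auto simp: inner_axis')
    ultimately show "y \<in> {y. \<exists>u. (\<forall>x\<in>?B. 0 < u x) \<and> sum u ?B = 1 \<and> (\<Sum>x\<in>?B. u x *\<^sub>R x) = y}"
      by (intro CollectI exI[of _ "\<lambda>x. x \<bullet> y"] conjI)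
  next
    fix y assume "y \<in> {y. \<exists>u. (\<forall>x\<in>?B. 0 < u x) \<and> sum u ?B = 1 \<and> (\<Sum>x\<in>?B. u x *\<^sub>R x) = y}"
    then obtain u where u: "\<forall>x\<in>?B. 0 < u x" "sum u ?B = 1" "(\<Sum>x\<in>?B. u x *\<^sub>R x) = y" by blast
    have yj: "y $ j = (if j \<in> A then u (axis j 1) else 0)" for j
    proof -
      have "y $ j = (\<Sum>i\<in>A. if i = j then u (axis i 1) else 0)"
        unfolding u(3)[symmetric] sum.reindex[OF inj] sum_component o_def
        by (intro sum.cong) (auto simp: axis_def)
      then show ?thesis by simp
    qed
    have "(\<Sum>j\<in>UNIV. y $ j) = (\<Sum>j\<in>A. u (axis j 1))" unfolding yj by (simp add: sum.If_cases)
    then have "(\<Sum>j\<in>UNIV. y $ j) = 1" using u(2) inj by (simp add: sum.reindex)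
    then show "y \<in> open_face A" using u(1) yj by (auto simp: open_face_def std_simplex_def less_imp_le less_imp_neq)
  qed
  then have eq: "open_face A = rel_interior (convex hull ?B)"
    by (simp only: rel_interior_convex_hull_explicit[OF ind])
  have "convex (open_face A) \<and> rel_open (open_face A)"
    unfolding eq by (simp add: convex_rel_interior convex_convex_hull rel_interior_rel_open)
  moreover have "open_face A \<noteq> {}"
    unfolding eq using assms by (simp add: rel_interior_eq_empty convex_convex_hull)
  moreover have "bounded (open_face A)"
    using bounded_std_simplex by (rule bounded_subset) (auto simp: open_face_def)
  moreover have "aff_dim (open_face A) = int (card A) - 1"
    unfolding eq using aff_dim_affine_independent[OF ind] card_image[OF inj]
    by (simp add: rel_interior_aff_dim convex_convex_hull aff_dim_convex_hull)
  ultimately show ?thesis by blast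
qed

section \<open>The Euler characteristic of a gem\<close>

text \<open>The relatively open faces of the half-open unit cube, a fundamental domain of the
  integer lattice; \<open>S\<close> is the set of free coordinates.\<close>

definition cube_face :: "'n::finite set \<Rightarrow> (real^'n) set" where
  "cube_face S = {p. \<forall>i. if i \<in> S then 0 < p $ i \<and> p $ i < 1 else p $ i = 0}"

text \<open>Each face is the cell through its centre in the arrangement of all coordinate
  hyperplanes at 0 and 1.\<close>

lemma cube_face:
  "convex (cube_face S) \<and> rel_open (cube_face S) \<and> bounded (cube_face S) \<and> cube_face S \<noteq> {}"
proof -
  let ?H = "(\<lambda>i. (axis i 1 :: real^'n, 0)) ` UNIV \<union> (\<lambda>i. (axis i 1 :: real^'n, 1)) ` UNIV"
  define x where "x = (\<chi> i. if i \<in> S then 1/2 else (0::real))"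
  have "sgn (y $ i) = sgn (x $ i) \<and> sgn (y $ i - 1) = sgn (x $ i - 1) \<longleftrightarrow>
      (if i \<in> S then 0 < y $ i \<and> y $ i < 1 else y $ i = 0)" for y i
    by (auto simp: x_def sgn_if)
  moreover have "cell ?H x = {y. \<forall>i. sgn (y $ i) = sgn (x $ i) \<and> sgn (y $ i - 1) = sgn (x $ i - 1)}"
    by (auto simp: cell_def inner_axis' ball_Un)
  ultimately have "cube_face S = cell ?H x" by (simp add: cube_face_def)
  moreover have "cube_face S \<subseteq> cbox 0 1"
    by (auto simp: cube_face_def mem_box_cart split: if_splits) (metis less_imp_le order_refl zero_le_one)+
  ultimately show ?thesis
    using convex_rel_open_cell[of ?H x] cell_self[of x ?H] bounded_subset[OF bounded_cbox] by auto
qed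

lemma disjoint_cube_faces:
  assumes "p \<in> cube_face S" "p \<in> cube_face S'"
  shows "S = S'"
proof -
  have "i \<in> S \<longleftrightarrow> p $ i \<noteq> 0" "i \<in> S' \<longleftrightarrow> p $ i \<noteq> 0" for i
    using spec[of _ i, OF assms(1)[unfolded cube_face_def mem_Collect_eq]]
      spec[of _ i, OF assms(2)[unfolded cube_face_def mem_Collect_eq]] by (auto split: if_splits)
  then show ?thesis by blast
qed

lemma Union_cube_faces: "(\<Union>S. cube_face S) = {p. \<forall>i. 0 \<le> p $ i \<and> p $ i < 1}"
proof (intro equalityI subsetI)
  fix p :: "real^'n" assume p: "p \<in> {p. \<forall>i. 0 \<le> p $ i \<and> p $ i < 1}"
  then have "p \<in> cube_face {i. p $ i > 0}" by (auto simp: cube_face_def order.order_iff_strict)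
  then show "p \<in> (\<Union>S. cube_face S)" by blast
qed (auto simp: cube_face_def split: if_splits, (metis less_imp_le order_refl zero_less_one)+)

text \<open>The smaller face is a translate of the slice of the larger one at height 1/2.\<close>

lemma aff_dim_cube_face_insert:
  fixes S :: "'n::finite set"
  assumes "i \<notin> S"
  shows "aff_dim (cube_face (insert i S)) = aff_dim (cube_face S) + 1"
proof -
  let ?C = "cube_face (insert i S)"
  obtain q where q: "q \<in> cube_face S" using cube_face by blast
  have ia: "axis i 1 \<bullet> x = x $ i" for x :: "real^'n" by (simp add: inner_axis')
  have in_C: "axis i c + p \<in> ?C" if "p \<in> cube_face S" "0 < c" "c < 1" for p c
    using that assms by (auto simp: cube_face_def axis_def split: if_splits)
  have "(\<lambda>p. axis i (1/2) + p) ` cube_face S = ?C \<inter> {x. axis i 1 \<bullet> x = 1/2}"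
    unfolding ia
  proof (intro equalityI subsetI)
    fix x assume "x \<in> (\<lambda>p. axis i (1/2) + p) ` cube_face S"
    then obtain p where p: "p \<in> cube_face S" "x = axis i (1/2) + p" by blast
    then have "p $ i = 0" using assms by (auto simp: cube_face_def split: if_splits)
    then show "x \<in> ?C \<inter> {x. x $ i = 1/2}" using p in_C[of p "1/2"] by (simp add: axis_nth)
  next
    fix x assume x: "x \<in> ?C \<inter> {x. x $ i = 1/2}"
    then have "x - axis i (1/2) \<in> cube_face S"
      using assms by (auto simp: cube_face_def axis_def split: if_splits)
    then show "x \<in> (\<lambda>p. axis i (1/2) + p) ` cube_face S" by (intro image_eqI) auto
  qed
  then have "aff_dim (?C \<inter> {x. axis i 1 \<bullet> x = 1/2}) = aff_dim (cube_face S)"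
    by (metis aff_dim_translation_eq)
  moreover have "aff_dim (?C \<inter> {x. axis i 1 \<bullet> x = 1/2}) = aff_dim ?C - 1"
  proof (rule aff_dim_slice)
    have qi: "q $ i = 0" using q assms by (auto simp: cube_face_def split: if_splits)
    show "axis i (1/2) + q \<in> ?C" using in_C q by simp
    show "axis i 1 \<bullet> (axis i (1/2) + q) = 1/2" using qi by (simp add: ia axis_nth)
    have "axis i (1/3) + q \<in> ?C" using in_C q by simp
    moreover have "axis i 1 \<bullet> (axis i (1/3) + q) = 1/3" using qi by (simp add: ia axis_nth)
    ultimately show "\<not> ?C \<subseteq> {x. axis i 1 \<bullet> x = 1/2}" by (auto dest!: subsetD)
  qed (use cube_face in auto)
  ultimately show ?thesis by linarith
qed

lemma sum_Pow_insert:
  assumes "finite B" "a \<notin> B"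
  shows "(\<Sum>S\<in>Pow (insert a B). F S) = (\<Sum>S\<in>Pow B. F S + F (insert a S))"
proof -
  have "inj_on (insert a) (Pow B)" using assms(2) by (auto simp: inj_on_def)
  moreover have "Pow B \<inter> insert a ` Pow B = {}" using assms(2) by auto
  ultimately show ?thesis
    using assms(1) by (simp add: Pow_insert sum.union_disjoint sum.reindex sum.distrib)
qed

text \<open>Toggling one coordinate \<open>i\<close> pairs the faces with opposite signs.\<close>

lemma euler_cube: "(\<Sum>S\<in>UNIV. (-1::int) ^ nat (aff_dim (cube_face (S :: 'n::finite set)))) = 0"
proof -
  let ?f = "\<lambda>S :: 'n set. (-1::int) ^ nat (aff_dim (cube_face S))"
  obtain i :: 'n where True by blast
  have "?f S + ?f (insert i S) = 0" if "S \<in> Pow (UNIV - {i})" for S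
  proof -
    have "aff_dim (cube_face S) \<ge> 0" using cube_face[of S] by (metis aff_dim_negative_iff not_less)
    moreover have "aff_dim (cube_face (insert i S)) = aff_dim (cube_face S) + 1"
      using that by (intro aff_dim_cube_face_insert) auto
    ultimately show ?thesis by (simp add: nat_add_distrib)
  qed
  then have "(\<Sum>S\<in>Pow (UNIV - {i}). ?f S + ?f (insert i S)) = 0" by (rule sum.neutral[OF ballI])
  then have "(\<Sum>S\<in>Pow (insert i (UNIV - {i})). ?f S) = 0" by (subst sum_Pow_insert) auto
  moreover have "Pow (insert i (UNIV - {i})) = UNIV" by auto
  ultimately show ?thesis by simp
qed

lemma comp_rel_representatives:
  assumes "colored_graph V adj"
  obtains R where "R \<subseteq> V" "card R = g_comp V adj C"
    "\<And>w. w \<in> V \<Longrightarrow> \<exists>v\<in>R. (w, v) \<in> comp_rel V adj C"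
    "\<And>v w. v \<in> R \<Longrightarrow> w \<in> R \<Longrightarrow> (v, w) \<in> comp_rel V adj C \<Longrightarrow> v = w"
proof -
  let ?r = "comp_rel V adj C"
  note eq = comp_rel_equiv[OF assms, of C]
  define s where "s X = (SOME v. v \<in> X)" for X :: "'a set"
  have s: "s X \<in> X" if "X \<in> V // ?r" for X
    unfolding s_def using in_quotient_imp_non_empty[OF eq that] by (simp add: some_in_eq)
  have sub: "X \<subseteq> V" if "X \<in> V // ?r" for X using in_quotient_imp_subset[OF eq that] .
  have inj: "X = Y" if "X \<in> V // ?r" "Y \<in> V // ?r" "(s X, s Y) \<in> ?r" for X Y
    using quotient_eqI[OF eq that(1,2) s[OF that(1)] s[OF that(2)] that(3)] .
  show ?thesis
  proof (rule that[of "s ` (V // ?r)"])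
    show "s ` (V // ?r) \<subseteq> V" using s sub by blast
    have "inj_on s (V // ?r)"
    proof (rule inj_onI)
      fix X Y assume XY: "X \<in> V // ?r" "Y \<in> V // ?r" "s X = s Y"
      have "s X \<in> V" using s sub XY(1) by blast
      then have "(s X, s Y) \<in> ?r" using XY(3) by (simp add: comp_rel_def)
      then show "X = Y" using inj XY by blast
    qed
    then show "card (s ` (V // ?r)) = g_comp V adj C" by (simp add: card_image g_comp_def)
    show "\<exists>v\<in>s ` (V // ?r). (w, v) \<in> ?r" if "w \<in> V" for w
    proof -
      have "?r `` {w} \<in> V // ?r" using that by (rule quotientI)
      then show ?thesis using s by (intro bexI[of _ "s (?r `` {w})"]) auto
    qed
    show "v = w" if "v \<in> s ` (V // ?r)" "w \<in> s ` (V // ?r)" "(v, w) \<in> ?r" for v w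
      using that inj by blast
  qed
qed

section \<open>Subdividing the simplices of a gem\<close>

context torus_gem
begin

text \<open>What the cells of one simplex must respect: the zero pattern puts each into one open
  face, and constant floors let a single integer vector move its affine image into the half-open
  cube.\<close>

definition subdivides :: "((real^'c) \<times> real) set \<Rightarrow> 'v \<Rightarrow> bool" where
  "subdivides H v \<longleftrightarrow> finite H \<and>
    (\<forall>x\<in>std_simplex. \<forall>y\<in>cell H x. y \<in> std_simplex \<and>
      (\<forall>i. y $ i = 0 \<longleftrightarrow> x $ i = 0) \<and> (\<forall>i. \<lfloor>h v y $ i\<rfloor> = \<lfloor>h v x $ i\<rfloor>)) \<and>
    (\<forall>x\<in>std_simplex. \<exists>L b. linear L \<and> (\<forall>y\<in>cell H x. h v y = L y + b))"

text \<open>It suffices to unite the hyperplanes bounding the pieces of \<open>T v\<close>, the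
  integer levels of the lift on each piece, and the coordinate hyperplanes for the zero
  pattern.\<close>

lemma subdivision:
  assumes v: "v \<in> V"
  shows "\<exists>H. subdivides H v"
proof -
  have "\<exists>K. \<forall>x\<in>std_simplex. norm (h v x) \<le> K"
    using compact_continuous_image[OF continuous_h[OF v] compact_std_simplex]
    by (auto dest!: compact_imp_bounded simp: bounded_iff)
  then obtain K where K: "\<And>x. x \<in> std_simplex \<Longrightarrow> norm (h v x) \<le> K" by blast
  have "\<exists>Ht L b. finite Ht \<and> linear L \<and> (\<forall>x\<in>t. h v x = L x + b) \<and>
      (\<forall>x\<in>t. \<forall>G. Ht \<subseteq> G \<longrightarrow> cell G x \<subseteq> t \<and> (\<forall>y\<in>cell G x. \<forall>i. \<lfloor>h v y $ i\<rfloor> = \<lfloor>h v x $ i\<rfloor>))"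
    if t: "t \<in> T v" for t
  proof -
    obtain F where F: "finite F" "t = convex hull F" using polytope_T[OF v t] by blast
    obtain H1 where H1: "finite H1" "\<And>x G. x \<in> t \<Longrightarrow> H1 \<subseteq> G \<Longrightarrow> cell G x \<subseteq> t"
      using polytope_cell[OF F(1)] unfolding F(2)[symmetric] by blast
    obtain L b where L: "linear L" "\<And>x. x \<in> t \<Longrightarrow> h v x = L x + b" using affine_T[OF v t] by blast
    have ts: "t \<subseteq> std_simplex" using Union_T[OF v] t by blast
    have "\<exists>H. finite H \<and> (\<forall>x\<in>t. \<forall>G. H \<subseteq> G \<longrightarrow> (\<forall>y\<in>cell G x. \<lfloor>(L y + b) $ i\<rfloor> = \<lfloor>(L x + b) $ i\<rfloor>))" for i
    proof (rule floor_cell[OF L(1)])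
      fix x assume "x \<in> t"
      then show "\<bar>(L x + b) $ i\<bar> \<le> K"
        using K[of x] L(2)[of x] ts component_le_norm_cart[of "h v x" i] by auto
    qed
    then obtain H2 where H2: "\<And>i. finite (H2 i)"
      "\<And>i x G y. x \<in> t \<Longrightarrow> H2 i \<subseteq> G \<Longrightarrow> y \<in> cell G x \<Longrightarrow> \<lfloor>(L y + b) $ i\<rfloor> = \<lfloor>(L x + b) $ i\<rfloor>"
      by metis
    have "cell G x \<subseteq> t \<and> (\<forall>y\<in>cell G x. \<forall>i. \<lfloor>h v y $ i\<rfloor> = \<lfloor>h v x $ i\<rfloor>)"
      if "x \<in> t" "H1 \<union> (\<Union>i. H2 i) \<subseteq> G" for x G
    proof -
      have "H1 \<subseteq> G" "\<And>i. H2 i \<subseteq> G" using that(2) by auto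
      then show ?thesis using H1(2)[OF that(1)] H2(2)[OF that(1)] L(2) that(1) by (metis subsetD)
    qed
    then show ?thesis using H1(1) H2(1) L
      by (intro exI[of _ "H1 \<union> (\<Union>i. H2 i)"] exI[of _ L] exI[of _ b]) auto
  qed
  then obtain Ht where Ht: "\<And>t. t \<in> T v \<Longrightarrow> finite (Ht t)"
    "\<And>t. t \<in> T v \<Longrightarrow> \<exists>L b. linear L \<and> (\<forall>x\<in>t. h v x = L x + b)"
    "\<And>t x G. t \<in> T v \<Longrightarrow> x \<in> t \<Longrightarrow> Ht t \<subseteq> G \<Longrightarrow>
       cell G x \<subseteq> t \<and> (\<forall>y\<in>cell G x. \<forall>i. \<lfloor>h v y $ i\<rfloor> = \<lfloor>h v x $ i\<rfloor>)"
    by metis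
  define H where "H = (\<lambda>i. (axis i 1 :: real^'c, 0)) ` UNIV \<union> (\<Union>t\<in>T v. Ht t)"
  have fin: "finite H" unfolding H_def using Ht(1) finite_T[OF v] by auto
  have main: "(y \<in> std_simplex \<and> (\<forall>i. y $ i = 0 \<longleftrightarrow> x $ i = 0) \<and> (\<forall>i. \<lfloor>h v y $ i\<rfloor> = \<lfloor>h v x $ i\<rfloor>))
      \<and> (\<exists>t\<in>T v. cell H x \<subseteq> t)" if x: "x \<in> std_simplex" and y: "y \<in> cell H x" for x y
  proof -
    obtain t where t: "t \<in> T v" "x \<in> t" using x Union_T[OF v] by blast
    have "Ht t \<subseteq> H" using t by (auto simp: H_def)
    note * = Ht(3)[OF t this]
    have "y \<in> std_simplex" using * y t Union_T[OF v] by blast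
    moreover have "y $ i = 0 \<longleftrightarrow> x $ i = 0" for i
    proof -
      have "(axis i 1, 0) \<in> H" by (auto simp: H_def)
      then have "sgn (y $ i) = sgn (x $ i)" using y by (force simp: cell_def inner_axis')
      then show ?thesis by (metis sgn_0_0)
    qed
    ultimately show ?thesis using * y t by blast
  qed
  have aff: "\<exists>L b. linear L \<and> (\<forall>y\<in>cell H x. h v y = L y + b)" if x: "x \<in> std_simplex" for x
  proof -
    obtain t where "t \<in> T v" "cell H x \<subseteq> t" using main[OF x cell_self] by blast
    then show ?thesis using Ht(2) by (meson subsetD)
  qed
  have "subdivides H v"
    unfolding subdivides_def
    by (intro conjI ballI fin aff) (use main in simp_all)
  then show ?thesis by (rule exI)
qed

lemma inj_on_h:
  assumes "v \<in> V"
  shows "inj_on (h v) std_simplex"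
proof (rule inj_onI)
  fix x y assume "x \<in> std_simplex" "y \<in> std_simplex" "h v x = h v y"
  then show "x = y" using torus_cover_h_eq_iff[OF assms assms, of x y] by simp
qed

text \<open>A simplex of the complex with label set \<open>A\<close> is a residue of the colours
  outside \<open>A\<close> and has dimension \<open>card A - 1\<close>, so the sum is the Euler
  characteristic of the complex.\<close>

theorem euler_characteristic:
  "(\<Sum>A\<in>Pow UNIV - {{}}. (-1) ^ (card A - 1) * int (g_comp V adj (- A))) = 0"
proof -
  obtain H where sub: "\<And>v. v \<in> V \<Longrightarrow> subdivides (H v) v" using subdivision by metis
  have H: "\<And>v. v \<in> V \<Longrightarrow> finite (H v)"
    "\<And>v x y. v \<in> V \<Longrightarrow> x \<in> std_simplex \<Longrightarrow> y \<in> cell (H v) x \<Longrightarrow> y \<in> std_simplex \<and>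
       (\<forall>i. y $ i = 0 \<longleftrightarrow> x $ i = 0) \<and> (\<forall>i. \<lfloor>h v y $ i\<rfloor> = \<lfloor>h v x $ i\<rfloor>)"
    "\<And>v x. v \<in> V \<Longrightarrow> x \<in> std_simplex \<Longrightarrow> \<exists>L b. linear L \<and> (\<forall>y\<in>cell (H v) x. h v y = L y + b)"
    using sub unfolding subdivides_def by blast+
  \<comment> \<open>A set of representatives picks one simplex out of each residue, so that every
    open face of the complex is counted once.\<close>
  define Q where "Q C R \<longleftrightarrow> R \<subseteq> V \<and> card R = g_comp V adj C \<and> (\<forall>w\<in>V. \<exists>v\<in>R. (w, v) \<in> comp_rel V adj C) \<and>
      (\<forall>v\<in>R. \<forall>w\<in>R. (v, w) \<in> comp_rel V adj C \<longrightarrow> v = w)" for C R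
  have "\<exists>R. Q C R" for C
    by (rule comp_rel_representatives[OF graph, of C]) (unfold Q_def, blast)
  then obtain R where RQ: "\<And>C. Q C (R C)" by metis
  have R: "\<And>C. R C \<subseteq> V" "\<And>C. card (R C) = g_comp V adj C"
    "\<And>C w. w \<in> V \<Longrightarrow> \<exists>v\<in>R C. (w, v) \<in> comp_rel V adj C"
    "\<And>C v w. v \<in> R C \<Longrightarrow> w \<in> R C \<Longrightarrow> (v, w) \<in> comp_rel V adj C \<Longrightarrow> v = w"
    using RQ unfolding Q_def by blast+
  define \<P> where "\<P> v A = {c \<in> cell (H v) ` std_simplex. c \<subseteq> open_face A}" for v A
  have fin_P: "finite (\<P> v A)" if "v \<in> V" for v A
  proof (rule finite_subset)
    show "\<P> v A \<subseteq> range (cell (H v))" by (auto simp: \<P>_def)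
  qed (rule finite_cells[OF H(1)[OF that]])
  have P_cell: "\<exists>z. z \<in> std_simplex \<and> c = cell (H v) z" if "c \<in> \<P> v A" for v A c
    using that by (auto simp: \<P>_def)
  have P_props: "convex c \<and> rel_open c \<and> bounded c \<and> c \<noteq> {} \<and> c \<subseteq> std_simplex"
    if v: "v \<in> V" and c: "c \<in> \<P> v A" for v A c
  proof -
    obtain z where z: "z \<in> std_simplex" "c = cell (H v) z" using P_cell[OF c] by blast
    have "c \<subseteq> std_simplex" using H(2)[OF v z(1)] z(2) by blast
    then show ?thesis
      using convex_rel_open_cell[OF H(1)[OF v]] cell_self[of z "H v"] z(2)
        bounded_subset[OF bounded_std_simplex] by auto
  qed
  have P_disj: "c = c'" if "c \<in> \<P> v A" "c' \<in> \<P> v A'" "x \<in> c" "x \<in> c'" for v A A' c c' x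
    using that P_cell cell_eq by metis
  have P_cover: "\<exists>c\<in>\<P> v A. x \<in> c" if v: "v \<in> V" and x: "x \<in> open_face A" for v A x
  proof -
    have xs: "x \<in> std_simplex" using x by (simp add: open_face_def)
    have "cell (H v) x \<subseteq> open_face A" using H(2)[OF v xs] x by (auto simp: open_face_def)
    then show ?thesis using xs cell_self[of x "H v"] by (auto simp: \<P>_def)
  qed
  have E3: "(\<Sum>c\<in>\<P> v A. (-1) ^ nat (aff_dim c)) = (-1::int) ^ (card A - 1)"
    if v: "v \<in> V" and A: "A \<noteq> {}" for v A
  proof -
    have "(\<Sum>c\<in>\<P> v A. (-1) ^ nat (aff_dim c)) = (\<Sum>u\<in>{()}. (-1::int) ^ nat (aff_dim (open_face A)))"
    proof (rule euler_two_partitions)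
      show "finite (\<P> v A)" by (rule fin_P[OF v])
      show "convex c \<and> rel_open c \<and> bounded c \<and> c \<noteq> {}" if "c \<in> \<P> v A" for c
        using P_props[OF v that] by blast
      show "convex (open_face A) \<and> rel_open (open_face A) \<and> bounded (open_face A) \<and> open_face A \<noteq> {}"
        using open_face[OF A] by blast
      show "c = c'" if "c \<in> \<P> v A" "c' \<in> \<P> v A" "x \<in> c" "x \<in> c'" for c c' x
        using P_disj that by blast
      show "(\<Union>c\<in>\<P> v A. c) = (\<Union>u\<in>{()}. open_face A)"
        using P_cover[OF v] by (auto simp: \<P>_def)
    qed auto
    moreover have "nat (aff_dim (open_face A)) = card A - 1" using open_face[OF A] by simp
    ultimately show ?thesis by simp
  qed
  \<comment> \<open>The vector of floors, the same at all points of a cell; subtracting it moves the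
    image of the cell into the half-open cube.\<close>
  define n where "n v c = (\<chi> i. real_of_int \<lfloor>h v (SOME x. x \<in> c) $ i\<rfloor>)" for v c
  have n: "n v c $ i = of_int \<lfloor>h v x $ i\<rfloor>" if v: "v \<in> V" and c: "c \<in> \<P> v A" and x: "x \<in> c" for v A c x i
  proof -
    obtain z where z: "z \<in> std_simplex" "c = cell (H v) z" using P_cell[OF c] by blast
    have "(SOME x. x \<in> c) \<in> c" using x by (rule someI)
    then have "\<lfloor>h v (SOME x. x \<in> c) $ i\<rfloor> = \<lfloor>h v z $ i\<rfloor>" "\<lfloor>h v x $ i\<rfloor> = \<lfloor>h v z $ i\<rfloor>"
      using H(2)[OF v z(1)] z(2) x by auto
    then show ?thesis by (simp add: n_def)
  qed
  define im where "im = (\<lambda>(A :: 'c set, v, c). (\<lambda>x. h v x - n v c) ` c)"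
  define I where "I = (SIGMA A:Pow UNIV - {{}}. SIGMA v:R (- A). \<P> v A)"
  have I: "A \<noteq> {} \<and> v \<in> R (- A) \<and> v \<in> V \<and> c \<in> \<P> v A" if "(A, v, c) \<in> I" for A v c
    using that R(1) by (auto simp: I_def)
  have im_props: "convex (im k) \<and> rel_open (im k) \<and> bounded (im k) \<and> im k \<noteq> {} \<and>
      aff_dim (im k) = aff_dim (snd (snd k))" if "k \<in> I" for k
  proof -
    obtain A v c where k: "k = (A, v, c)" by (cases k)
    have vc: "v \<in> V" "c \<in> \<P> v A" using that I k by blast+
    note c = P_props[OF vc]
    obtain L b where L: "linear L" "\<And>y. y \<in> c \<Longrightarrow> h v y = L y + b"
      using P_cell[OF vc(2)] H(3)[OF vc(1)] by metis
    have imk: "im k = (\<lambda>y. (b - n v c) + y) ` (L ` c)"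
      using L(2) by (auto simp: im_def k image_image algebra_simps)
    have "inj_on L c"
    proof (rule inj_onI)
      fix x y assume xy: "x \<in> c" "y \<in> c" "L x = L y"
      then have "h v x = h v y" using L(2) by simp
      then show "x = y" using inj_on_h[OF vc(1)] xy c by (meson inj_onD subsetD)
    qed
    then have "aff_dim (im k) = aff_dim c"
      unfolding imk aff_dim_translation_eq using c L(1) by (intro aff_dim_linear_image_inj_on) auto
    moreover have Lc: "convex (L ` c) \<and> rel_open (L ` c)"
      using c L(1) by (intro convex_rel_open_linear_image) auto
    then have "convex (im k)" unfolding imk by (intro convex_translation) auto
    moreover have "rel_open (im k)"
      using Lc unfolding imk rel_open_def by (simp add: rel_interior_translation)
    moreover have "bounded (im k)"
      unfolding imk using c L(1) by (intro bounded_translation bounded_linear_image)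
        (auto simp: linear_conv_bounded_linear)
    moreover have "im k \<noteq> {}" using c by (simp add: imk)
    ultimately show ?thesis by (simp add: k)
  qed
  have finR: "finite (R C)" for C using R(1) finite_V by (rule finite_subset)
  have finP: "finite (\<P> v A)" if "v \<in> R C" for v A C using fin_P R(1) that by blast
  have finI: "finite I" unfolding I_def using finR finP by (intro finite_SigmaI) auto
  \<comment> \<open>Points congruent modulo the lattice come from one point of the complex, and the
    choice of representatives leaves a single cell for it.\<close>
  have same: "k = k'" if kI: "k \<in> I" "k' \<in> I" "p \<in> im k" "p \<in> im k'" for k k' p
  proof -
    obtain A v c A' v' c' where k: "k = (A, v, c)" "k' = (A', v', c')" by (cases k, cases k')
    have 1: "A \<noteq> {}" "v \<in> R (- A)" "v \<in> V" "c \<in> \<P> v A" using I[of A v c] kI(1) k(1) by auto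
    have 2: "A' \<noteq> {}" "v' \<in> R (- A')" "v' \<in> V" "c' \<in> \<P> v' A'" using I[of A' v' c'] kI(2) k(2) by auto
    obtain x where x: "x \<in> c" "p = h v x - n v c" using kI(3) k(1) by (auto simp: im_def)
    obtain y where y: "y \<in> c'" "p = h v' y - n v' c'" using kI(4) k(2) by (auto simp: im_def)
    have xy: "x \<in> open_face A" "y \<in> open_face A'" using 1(4) 2(4) x y by (auto simp: \<P>_def)
    then have s: "x \<in> std_simplex" "y \<in> std_simplex" by (auto simp: open_face_def)
    have "h v x $ i - h v' y $ i \<in> \<int>" for i
    proof -
      have "(h v x - n v c) $ i = (h v' y - n v' c') $ i" using x(2) y(2) by simp
      then have "h v x $ i - h v' y $ i = n v c $ i - n v' c' $ i" by simp
      also have "\<dots> \<in> \<int>" by (simp add: n_def)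
      finally show ?thesis .
    qed
    then have "torus_cover (h v x) = torus_cover (h v' y)" by (simp add: torus_cover_eq_iff)
    then have e: "x = y" "(v, v') \<in> comp_rel V adj {j. x $ j = 0}"
      using torus_cover_h_eq_iff[OF 1(3) 2(3) s] by auto
    have "{j. x $ j = 0} = - A" "A = A'" using xy e(1) by (auto simp: open_face_def)
    then have "v = v'" using R(4)[of v "- A" v'] e 1 2 by auto
    then show ?thesis using P_disj[of c v A c' A' x] x y e(1) \<open>A = A'\<close> 1 2 k by auto
  qed
  \<comment> \<open>Reduction by floors gives fractional parts, so images lie in the half-open cube;
    conversely, a point of the cube is recovered from any congruent lifted point.\<close>
  have cover: "(\<Union>k\<in>I. im k) = (\<Union>S\<in>UNIV. cube_face (S :: 4 set))"
  proof (intro equalityI subsetI)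
    fix p assume "p \<in> (\<Union>k\<in>I. im k)"
    then obtain A v c x where k: "(A, v, c) \<in> I" "x \<in> c" "p = h v x - n v c" by (auto simp: im_def)
    have "p $ i = frac (h v x $ i)" for i
      using n[of v c A x i] I[OF k(1)] k by (simp add: frac_def)
    then have "0 \<le> p $ i \<and> p $ i < 1" for i by (simp add: frac_lt_1)
    then show "p \<in> (\<Union>S\<in>UNIV. cube_face (S :: 4 set))" by (simp add: Union_cube_faces)
  next
    fix p assume "p \<in> (\<Union>S\<in>UNIV. cube_face (S :: 4 set))"
    then have p: "0 \<le> p $ i \<and> p $ i < 1" for i by (simp add: Union_cube_faces)
    obtain w x where w: "w \<in> V" "x \<in> std_simplex" "torus_cover (h w x) = torus_cover p" using surj by blast
    define A where "A = {j. x $ j \<noteq> 0}"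
    have "A \<noteq> {}"
    proof
      assume "A = {}"
      then have "x $ j = 0" for j by (auto simp: A_def)
      then show False using w(2) by (simp add: std_simplex_def)
    qed
    have xA: "x \<in> open_face A" using w(2) by (auto simp: A_def open_face_def)
    have Z: "{j. x $ j = 0} = - A" by (auto simp: A_def)
    obtain v where v: "v \<in> R (- A)" "(w, v) \<in> comp_rel V adj (- A)" using R(3)[OF w(1)] by blast
    have vV: "v \<in> V" using v R(1) by blast
    have "torus_cover (h w x) = torus_cover (h v x)"
      using torus_cover_h_eq_iff[OF w(1) vV w(2) w(2)] v Z by simp
    then have "torus_cover (h v x) = torus_cover p" using w(3) by simp
    then have int: "h v x $ i - p $ i \<in> \<int>" for i by (simp add: torus_cover_eq_iff)
    obtain c where c: "c \<in> \<P> v A" "x \<in> c" using P_cover[OF vV xA] by blast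
    have "p = h v x - n v c"
    proof (subst vec_eq_iff, rule allI)
      fix i
      obtain m where m: "h v x $ i - p $ i = of_int m" using int[of i] by (auto elim: Ints_cases)
      then have "\<lfloor>h v x $ i\<rfloor> = m" using p[of i] by (intro floor_unique) linarith+
      then show "p $ i = (h v x - n v c) $ i" using m n[OF vV c(1,2), of i] by simp
    qed
    then have "p \<in> im (A, v, c)" using c by (auto simp: im_def)
    moreover have "(A, v, c) \<in> I" using c v \<open>A \<noteq> {}\<close> by (auto simp: I_def)
    ultimately show "p \<in> (\<Union>k\<in>I. im k)" by blast
  qed
  have "(\<Sum>k\<in>I. (-1) ^ nat (aff_dim (im k))) = (\<Sum>S\<in>UNIV. (-1::int) ^ nat (aff_dim (cube_face (S :: 4 set))))"
  proof (rule euler_two_partitions[OF finI])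
    show "finite (UNIV :: 4 set set)" by simp
    show "convex (im k) \<and> rel_open (im k) \<and> bounded (im k) \<and> im k \<noteq> {}" if "k \<in> I" for k
      using im_props[OF that] by blast
    show "k = k'" if "k \<in> I" "k' \<in> I" "p \<in> im k" "p \<in> im k'" for k k' p using same that by blast
    show "S = S'" if "p \<in> cube_face S" "p \<in> cube_face S'" for S S' :: "4 set" and p
      using disjoint_cube_faces that by blast
  qed (use cube_face cover in auto)
  then have "0 = (\<Sum>k\<in>I. (-1::int) ^ nat (aff_dim (im k)))" by (simp add: euler_cube)
  also have "\<dots> = (\<Sum>(A, v, c)\<in>I. (-1) ^ nat (aff_dim c))"
    using im_props by (intro sum.cong) auto
  also have "\<dots> = (\<Sum>A\<in>Pow UNIV - {{}}. \<Sum>v\<in>R (- A). \<Sum>c\<in>\<P> v A. (-1) ^ nat (aff_dim c))"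
  proof -
    have "(\<Sum>A\<in>Pow UNIV - {{}}. \<Sum>v\<in>R (- A). \<Sum>c\<in>\<P> v A. (-1::int) ^ nat (aff_dim c))
       = (\<Sum>A\<in>Pow UNIV - {{}}. \<Sum>(v, c)\<in>(SIGMA v:R (- A). \<P> v A). (-1) ^ nat (aff_dim c))"
      using finR finP by (intro sum.cong refl sum.Sigma) auto
    also have "\<dots> = (\<Sum>(A, v, c)\<in>I. (-1) ^ nat (aff_dim c))"
      unfolding I_def using finR finP by (intro sum.Sigma ballI finite_SigmaI) auto
    finally show ?thesis by simp
  qed
  also have "\<dots> = (\<Sum>A\<in>Pow UNIV - {{}}. (-1) ^ (card A - 1) * int (g_comp V adj (- A)))"
  proof (intro sum.cong refl)
    fix A :: "'c set" assume A: "A \<in> Pow UNIV - {{}}"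
    have "(\<Sum>v\<in>R (- A). \<Sum>c\<in>\<P> v A. (-1::int) ^ nat (aff_dim c)) = (\<Sum>v\<in>R (- A). (-1) ^ (card A - 1))"
      using E3 A R(1) by (intro sum.cong refl) auto
    then show "(\<Sum>v\<in>R (- A). \<Sum>c\<in>\<P> v A. (-1::int) ^ nat (aff_dim c)) = (-1) ^ (card A - 1) * int (g_comp V adj (- A))"
      by (simp add: R(2))
  qed
  finally show ?thesis by simp
qed

end

section \<open>The lower bound\<close>

lemma torus_gem_exists:
  assumes "colored_graph V adj" "K_PL_homeomorphic_T4 V adj"
  shows "\<exists>h T. torus_gem V adj h T"
proof -
  obtain f where f: "\<forall>v\<in>V. pl_simplex_to_torus4 (f v)" "\<forall>v\<in>V. \<forall>x\<in>std_simplex. f v x \<in> torus4"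
    "\<And>v x w y. ((v, x), (w, y)) \<in> K_ident V adj \<Longrightarrow> f v x = f w y"
    "torus4 \<subseteq> (\<Union>v\<in>V. f v ` std_simplex)"
    "\<And>v w x y. v \<in> V \<Longrightarrow> w \<in> V \<Longrightarrow> x \<in> std_simplex \<Longrightarrow> y \<in> std_simplex \<Longrightarrow>
       f v x = f w y \<Longrightarrow> ((v, x), (w, y)) \<in> (K_ident V adj)\<^sup>*"
    using assms(2) unfolding K_PL_homeomorphic_T4_def by (elim exE conjE) (rule that, auto)
  obtain h T where hT: "\<And>v. v \<in> V \<Longrightarrow> (\<forall>x\<in>std_simplex. torus_cover (h v x) = f v x) \<and>
      finite (T v) \<and> \<Union>(T v) = std_simplex \<and>
      (\<forall>t\<in>T v. (\<exists>F. finite F \<and> t = convex hull F) \<and> (\<exists>L b. linear L \<and> (\<forall>x\<in>t. h v x = L x + b)))"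
    using f(1) unfolding pl_simplex_to_torus4_def by metis
  then have cover: "torus_cover (h v x) = f v x" if "v \<in> V" "x \<in> std_simplex" for v x using that by blast
  have "torus_gem V adj h T"
  proof
    show "colored_graph V adj" by fact
    fix v w x y j
    show "torus_cover (h (adj j v) x) = torus_cover (h v x)" if "v \<in> V" "x \<in> std_simplex" "x $ j = 0"
    proof -
      have "((v, x), (adj j v, x)) \<in> K_ident V adj" using that by (auto simp: K_ident_def)
      moreover have "adj j v \<in> V" using assms(1) that by (auto simp: colored_graph_def)
      ultimately show ?thesis using f(3) cover that by metis
    qed
    show "\<exists>v\<in>V. \<exists>x\<in>std_simplex. torus_cover (h v x) = torus_cover p" for p
    proof -
      have "torus_cover p \<in> torus4" using range_torus_cover by blast
      then obtain v x where "v \<in> V" "x \<in> std_simplex" "torus_cover p = f v x" using f(4) by blast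
      then show ?thesis using cover by metis
    qed
    show "((v, x), (w, y)) \<in> (K_ident V adj)\<^sup>*"
      if "v \<in> V" "w \<in> V" "x \<in> std_simplex" "y \<in> std_simplex" "torus_cover (h v x) = torus_cover (h w y)"
      using f(5) cover that by metis
  qed (use hT in auto)
  then show ?thesis by blast
qed

lemma lessThan_5: "{..<5::nat} = {0, 1, 2, 3, 4}"
  by auto

context
  fixes V :: "'v set" and adj :: "5 \<Rightarrow> 'v \<Rightarrow> 'v" and h T and e :: "nat \<Rightarrow> 5"
  assumes gem: "torus_gem V adj h T" and e: "bij_betw e {..<5} UNIV"
begin

interpretation torus_gem V adj h T by (rule gem)

lemma compl_image: "S \<subseteq> {..<5} \<Longrightarrow> - (e ` S) = e ` ({..<5} - S)"
  using e inj_on_image_set_diff[of e UNIV "{..<5}" S]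
  by (subst inj_on_image_set_diff[of e "{..<5}"]) (auto simp: bij_betw_def)

lemma e_neq: "i < 5 \<Longrightarrow> j < 5 \<Longrightarrow> e i = e j \<longleftrightarrow> i = j"
  using e by (auto simp: bij_betw_def inj_on_def)

text \<open>Indexed by positions in the cyclic order \<open>e\<close>, so that consecutive positions
  mean the same for every \<open>e\<close>.\<close>

definition residues :: "nat set \<Rightarrow> int" where
  "residues S = int (g_comp V adj (e ` S))"

lemma euler_residues:
  "(\<Sum>S\<in>Pow {0, 1, 2, 3, 4}. if S = {} then 0 else (-1) ^ (card S - 1) * residues ({0, 1, 2, 3, 4} - S)) = 0"
proof -
  let ?F = "\<lambda>A. if A = {} then 0 else (-1) ^ (card A - 1) * int (g_comp V adj (- A))"
  have "0 = (\<Sum>A\<in>Pow UNIV. ?F A)"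
    using euler_characteristic by (subst sum.remove[of _ "{}"]) (auto intro!: sum.cong)
  also have "\<dots> = (\<Sum>S\<in>Pow {..<5}. ?F (e ` S))"
    by (rule sum.reindex_bij_betw[symmetric, OF bij_betw_Pow[OF e]])
  also have "\<dots> = (\<Sum>S\<in>Pow {..<5}. if S = {} then 0 else (-1) ^ (card S - 1) * residues ({..<5} - S))"
  proof (intro sum.cong refl)
    fix S assume S: "S \<in> Pow {..<5::nat}"
    then have "card (e ` S) = card S" using e by (intro card_image) (auto simp: bij_betw_def intro: inj_on_subset)
    then show "?F (e ` S) = (if S = {} then 0 else (-1) ^ (card S - 1) * residues ({..<5} - S))"
      using S by (simp add: compl_image residues_def)
  qed
  finally show ?thesis by (simp only: lessThan_5)
qed

lemma surface_residues:
  "2 * (residues {i, j} + residues {i, k} + residues {j, k}) \<le> 4 * residues {i, j, k} + int (card V)"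
  using surface_inequality[OF graph, of "e i" "e j" "e k"] by (simp add: residues_def)

lemma edge_residues:
  assumes "l < 5" "m < 5" "l \<noteq> m"
  shows "residues ({0, 1, 2, 3, 4} - {l}) + residues ({0, 1, 2, 3, 4} - {m}) + 3 \<le> residues ({0, 1, 2, 3, 4} - {l, m})"
proof -
  have "UNIV - {e l} = e ` ({..<5} - {l})" "UNIV - {e m} = e ` ({..<5} - {m})"
    "UNIV - {e l, e m} = e ` ({..<5} - {l, m})"
    using compl_image[of "{l}"] compl_image[of "{m}"] compl_image[of "{l, m}"] assms
    by (simp_all add: Compl_eq_Diff_UNIV)
  then show ?thesis
    using edge_count[of "e l" "e m"] e_neq[of l m] assms unfolding lessThan_5[symmetric] by (simp add: residues_def)
qed

lemma rho_eps_residues: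
  "rho_eps V adj e = 1 - (of_int (residues {0, 1} + residues {1, 2} + residues {2, 3} + residues {3, 4} + residues {0, 4}) - 3 * of_nat (card V) / 2) / 2"
proof -
  have "(\<Sum>i<5. real (g_comp V adj {e i, e ((i + 1) mod 5)}))
      = of_int (residues {0, 1} + residues {1, 2} + residues {2, 3} + residues {3, 4} + residues {0, 4})"
    by (simp add: lessThan_5 residues_def insert_commute numeral_2_eq_2[symmetric])
  then show ?thesis unfolding rho_eps_def chi_eps_def by simp
qed

lemma rho_eps_ge: "rho_eps V adj e \<ge> 16"
proof -
  have G0: "residues {} = int (card V)" by (simp add: residues_def g_comp_empty[OF graph])
  have G1: "2 * residues {i} = int (card V)" for i
    using g_comp_singleton[OF graph, of "e i"] by (simp add: residues_def)
  have euler: "residues {1,2,3,4} + residues {0,2,3,4} + residues {0,1,3,4} + residues {0,1,2,4} + residues {0,1,2,3}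
     - (residues {2,3,4} + residues {1,3,4} + residues {1,2,4} + residues {1,2,3} + residues {0,3,4} + residues {0,2,4} + residues {0,2,3} + residues {0,1,4} + residues {0,1,3} + residues {0,1,2})
     + (residues {0,1} + residues {0,2} + residues {0,3} + residues {0,4} + residues {1,2} + residues {1,3} + residues {1,4} + residues {2,3} + residues {2,4} + residues {3,4})
     - (residues {0} + residues {1} + residues {2} + residues {3} + residues {4}) + residues {} = 0"
    using euler_residues by (simp add: sum_Pow_insert insert_Diff_if)
  \<comment> \<open>The label pairs are those not neighbours in the cyclic order; their complements
    are the nonconsecutive triples.\<close>
  have edges: "residues {1,2,3,4} + residues {0,1,3,4} + 3 \<le> residues {1,3,4}" "residues {1,2,3,4} + residues {0,1,2,4} + 3 \<le> residues {1,2,4}"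
    "residues {0,2,3,4} + residues {0,1,2,4} + 3 \<le> residues {0,2,4}" "residues {0,2,3,4} + residues {0,1,2,3} + 3 \<le> residues {0,2,3}"
    "residues {0,1,3,4} + residues {0,1,2,3} + 3 \<le> residues {0,1,3}"
    using edge_residues[of 0 2] edge_residues[of 0 3] edge_residues[of 1 3] edge_residues[of 1 4] edge_residues[of 2 4]
    by (simp_all add: insert_Diff_if)
  \<comment> \<open>\<open>A\<close> and \<open>B\<close> collect the consecutive and the other
    pairs, \<open>C\<close> and \<open>N\<close> the triples of either kind, and \<open>V4\<close>
    the quadruples, that is, the vertices of the complex.\<close>
  define A B C N V4 where "A = residues {0,1} + residues {1,2} + residues {2,3} + residues {3,4} + residues {0,4}"
    and "B = residues {0,2} + residues {0,3} + residues {1,3} + residues {1,4} + residues {2,4}"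
    and "C = residues {0,1,2} + residues {1,2,3} + residues {2,3,4} + residues {0,3,4} + residues {0,1,4}"
    and "N = residues {0,1,3} + residues {1,2,4} + residues {0,2,3} + residues {1,3,4} + residues {0,2,4}"
    and "V4 = residues {1,2,3,4} + residues {0,2,3,4} + residues {0,1,3,4} + residues {0,1,2,4} + residues {0,1,2,3}"
  \<comment> \<open>A consecutive triple contains two consecutive pairs and one other pair; in the
    remaining triples the proportion is reversed.\<close>
  have consecutive: "2 * (2 * A + B) \<le> 4 * C + 5 * int (card V)"
    using add_mono[OF surface_residues[of 0 1 2] add_mono[OF surface_residues[of 1 2 3] add_mono[OF surface_residues[of 2 3 4]
      add_mono[OF surface_residues[of 0 3 4] surface_residues[of 0 1 4]]]]]
    unfolding A_def B_def C_def by (simp add: algebra_simps)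
  have nonconsecutive: "2 * (A + 2 * B) \<le> 4 * N + 5 * int (card V)"
    using add_mono[OF surface_residues[of 0 1 3] add_mono[OF surface_residues[of 1 2 4] add_mono[OF surface_residues[of 0 2 3]
      add_mono[OF surface_residues[of 1 3 4] surface_residues[of 0 2 4]]]]]
    unfolding A_def B_def N_def by (simp add: algebra_simps)
  have euler': "2 * V4 - 2 * (C + N) + 2 * (A + B) - 5 * int (card V) + 2 * int (card V) = 0"
  proof -
    have "V4 - (C + N) + (A + B) - (residues {0} + residues {1} + residues {2} + residues {3} + residues {4}) + residues {} = 0"
      using euler unfolding A_def B_def C_def N_def V4_def by (simp add: algebra_simps)
    moreover have "2 * (residues {0} + residues {1} + residues {2} + residues {3} + residues {4}) = 5 * int (card V)"
      using G1 by (simp add: distrib_left)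
    ultimately show ?thesis using G0 by simp
  qed
  \<comment> \<open>Each label occurs in two of the five pairs, and 15 = 5 * 3.\<close>
  have edges': "2 * V4 + 15 \<le> N" 
    using add_mono[OF edges(1) add_mono[OF edges(2) add_mono[OF edges(3) add_mono[OF edges(4,5)]]]]
    unfolding N_def V4_def by (simp add: algebra_simps)
  \<comment> \<open>Substituting for \<open>C\<close> removes \<open>A\<close> from
    \<open>consecutive\<close> and leaves a lower bound for \<open>B\<close>;
    \<open>nonconsecutive\<close> turns it into an upper bound for \<open>A\<close>.\<close>
  have "4 * C = 4 * V4 - 4 * N + 4 * A + 4 * B - 6 * int (card V)" using euler' by simp
  with consecutive have "int (card V) + 4 * N - 4 * V4 \<le> 2 * B" by simp
  with nonconsecutive have "2 * A \<le> 3 * int (card V) - 4 * N + 8 * V4" by simp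
  with edges' have "2 * A \<le> 3 * int (card V) - 60" by simp
  then have "real_of_int (2 * A) \<le> of_int (3 * int (card V) - 60)" by (simp only: of_int_le_iff)
  moreover have "rho_eps V adj e = 1 - (of_int A - 3 * of_nat (card V) / 2) / 2"
    unfolding A_def by (rule rho_eps_residues)
  ultimately show ?thesis by (simp add: field_simps)
qed

end

lemma bij_5_exists: "bij_betw (of_nat :: nat \<Rightarrow> 5) {..<5} UNIV"
proof -
  have "inj_on (of_nat :: nat \<Rightarrow> 5) {..<5}"
    unfolding lessThan_5 by (auto simp: inj_on_def)
  moreover from this have "card ((of_nat :: nat \<Rightarrow> 5) ` {..<5}) = card (UNIV :: 5 set)"
    by (simp add: card_image)
  then have "(of_nat :: nat \<Rightarrow> 5) ` {..<5} = UNIV" by (intro card_subset_eq) auto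
  ultimately show ?thesis by (simp add: bij_betw_def)
qed

text \<open>The set of all \<open>e\<close> is infinite because values from 5 on are arbitrary, but
  \<open>rho_eps\<close> does not see them.\<close>

lemma finite_rho_eps:
  fixes adj :: "5 \<Rightarrow> 'v \<Rightarrow> 'v"
  shows "finite (rho_eps V adj ` {e. bij_betw e {..<CARD(5)} UNIV})"
proof (rule finite_subset)
  show "rho_eps V adj ` {e. bij_betw e {..<CARD(5)} UNIV} \<subseteq> rho_eps V adj ` (Pi\<^sub>E {..<5} (\<lambda>_. UNIV))"
  proof (rule image_subsetI)
    fix e :: "nat \<Rightarrow> 5"
    have "rho_eps V adj e = rho_eps V adj (restrict e {..<5})" by (simp add: rho_eps_def chi_eps_def)
    then show "rho_eps V adj e \<in> rho_eps V adj ` (Pi\<^sub>E {..<5} (\<lambda>_. UNIV))"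
      by (intro image_eqI[of _ _ "restrict e {..<5}"]) auto
  qed
  show "finite (rho_eps V adj ` (Pi\<^sub>E {..<5} (\<lambda>_. UNIV)))"
    by (intro finite_imageI finite_PiE) auto
qed

lemma reg_genus_graph_ge:
  assumes "gem_T4 V adj"
  shows "reg_genus_graph V adj \<ge> 16"
proof -
  obtain h T where "torus_gem V adj h T" using assms torus_gem_exists unfolding gem_T4_def by blast
  then have "16 \<le> rho_eps V adj e" if "bij_betw e {..<CARD(5)} UNIV" for e
    using rho_eps_ge that by simp
  moreover have "{e :: nat \<Rightarrow> 5. bij_betw e {..<CARD(5)} UNIV} \<noteq> {}" using bij_5_exists by auto
  ultimately show ?thesis
    unfolding reg_genus_graph_def using finite_rho_eps by (subst Min_ge_iff) auto
qed

section \<open>The Cayley graph of the symmetric group\<close>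

text \<open>Colours are integers modulo 5. This is the linear order \<open>c + 1\<close>, ...,
  \<open>c + 5 = c\<close> obtained by cutting the cycle open after \<open>c\<close>;
  \<open>idx\<close> inverts it. The swaps of colours other than \<open>c\<close> are its adjacent
  transpositions.\<close>

definition pos :: "5 \<Rightarrow> nat \<Rightarrow> 5" where
  "pos c n = c + 1 + of_nat n"

definition idx :: "5 \<Rightarrow> 5 \<Rightarrow> nat" where
  "idx c k = inv_into {..<5} (pos c) k"

lemma five_eq_0: "(5::5) = 0"
  by simp

lemma pos_Suc: "pos c (Suc n) = pos c n + 1"
  by (simp add: pos_def algebra_simps)

lemma pos_last: "pos c 4 = c"
proof -
  have "pos c 4 = c + 5" by (simp add: pos_def)
  then show ?thesis by simp
qed

lemma bij_pos: "bij_betw (pos c) {..<5} UNIV"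
proof -
  have "bij (\<lambda>k. c + 1 + k)" by (rule bij_betw_byWitness[where f' = "\<lambda>k. k - (c + 1)"]) auto
  from bij_betw_trans[OF bij_5_exists this] show ?thesis by (simp add: pos_def o_def cong: bij_betw_cong)
qed

lemma idx_less: "idx c k < 5"
  unfolding idx_def using bij_pos[of c] by (metis UNIV_I bij_betw_def inv_into_into lessThan_iff)

lemma pos_idx: "pos c (idx c k) = k"
  unfolding idx_def using bij_pos[of c] by (metis UNIV_I bij_betw_inv_into_right)

lemma idx_pos: "n < 5 \<Longrightarrow> idx c (pos c n) = n"
  unfolding idx_def using bij_pos[of c] by (simp add: bij_betw_inv_into_left)

lemma idx_eq_4: "idx c k = 4 \<longleftrightarrow> k = c"
  using pos_idx[of c k] idx_pos[of 4 c] pos_last[of c] by auto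

lemma idx_Suc: "k \<noteq> c \<Longrightarrow> idx c (k + 1) = Suc (idx c k)"
proof -
  assume "k \<noteq> c"
  then have "Suc (idx c k) < 5" using idx_less[of c k] idx_eq_4[of c k] by linarith
  moreover have "pos c (Suc (idx c k)) = k + 1" by (simp add: pos_Suc pos_idx)
  ultimately show ?thesis using idx_pos by metis
qed

lemma idx_inj: "idx c k = idx c l \<longleftrightarrow> k = l"
  using pos_idx by metis

lemma idx_first: "idx c (c + 1) = 0"
  using idx_pos[of 0 c] by (simp add: pos_def)

lemma antitone_idx:
  fixes F :: "5 \<Rightarrow> real"
  assumes "\<And>k. k \<noteq> c \<Longrightarrow> F (k + 1) \<le> F k" "idx c k \<le> idx c l"
  shows "F l \<le> F k"
proof -
  have "F (pos c n) \<le> F (pos c m)" if "m \<le> n" "n < 5" for m n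
    using that
  proof (induction n rule: dec_induct)
    case (step n)
    then have "pos c n \<noteq> c" using idx_pos[of n c] idx_eq_4[of c c] by auto
    then show ?case using step assms(1)[of "pos c n"] by (simp add: pos_Suc)
  qed simp
  from this[OF assms(2) idx_less] show ?thesis by (simp add: pos_idx)
qed

abbreviation swap :: "5 \<Rightarrow> 5 \<Rightarrow> 5" where
  "swap k \<equiv> Transposition.transpose k (k + 1)"

text \<open>Exchanging neighbours changes the position-weighted sum by one difference; this sum is
  the potential in both sorting arguments.\<close>

lemma sum_idx_swap:
  fixes g :: "5 \<Rightarrow> real"
  assumes "j \<noteq> c"
  shows "(\<Sum>k\<in>UNIV. idx c k * g (swap j k)) = (\<Sum>k\<in>UNIV. idx c k * g k) + g j - g (j + 1)"
proof -
  have "bij (swap j)" by simp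
  then have "(\<Sum>k\<in>UNIV. idx c k * g (swap j k)) = (\<Sum>k\<in>UNIV. idx c (swap j k) * g (swap j (swap j k)))"
    by (rule sum.reindex_bij_betw[symmetric])
  also have "\<dots> = (\<Sum>k\<in>UNIV. idx c k * g k + ((if k = j then g j else 0) - (if k = j + 1 then g (j + 1) else 0)))"
    by (intro sum.cong) (auto simp: Transposition.transpose_def idx_Suc[OF assms] distrib_right)
  also have "\<dots> = (\<Sum>k\<in>UNIV. idx c k * g k) + g j - g (j + 1)"
    by (simp add: sum.distrib sum_subtractf)
  finally show ?thesis .
qed

lemma finite_has_minimizer:
  fixes f :: "'a \<Rightarrow> 'b::linorder"
  assumes "finite S" "S \<noteq> {}"
  shows "\<exists>m\<in>S. \<forall>x\<in>S. f m \<le> f x"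
proof -
  have "Min (f ` S) \<in> f ` S" using assms by (intro Min_in) auto
  then obtain m where "m \<in> S" "f m = Min (f ` S)" by auto
  then show ?thesis using assms(1) by (intro bexI[of _ m]) auto
qed

text \<open>A minimizer of the position-weighted sum admits no improving adjacent exchange, so it is
  sorted.\<close>

lemma sorting_bijection:
  fixes f :: "5 \<Rightarrow> real" and c :: 5
  shows "\<exists>q. bij q \<and> (\<forall>k. k \<noteq> c \<longrightarrow> f (q (k + 1)) \<le> f (q k))"
proof -
  let ?W = "\<lambda>q. \<Sum>k\<in>UNIV. idx c k * f (q k)"
  let ?B = "{q :: 5 \<Rightarrow> 5. bij q}"
  have "id \<in> ?B" by simp
  then have "\<exists>q\<in>?B. \<forall>r\<in>?B. ?W q \<le> ?W r" by (intro finite_has_minimizer) (simp, blast)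
  then obtain q where q: "bij q" "\<And>r. bij r \<Longrightarrow> ?W q \<le> ?W r" by auto
  have "f (q (k + 1)) \<le> f (q k)" if "k \<noteq> c" for k
  proof -
    have "bij (q \<circ> swap k)" using q(1) by (intro bij_comp) auto
    from q(2)[OF this] have "?W q \<le> ?W q + f (q k) - f (q (k + 1))"
      using sum_idx_swap[OF that, of "\<lambda>k. f (q k)"] by simp
    then show ?thesis by simp
  qed
  then show ?thesis using q(1) by blast
qed

text \<open>The superlevel sets of both arrangements are initial segments of the order and, by
  bijectivity, equally large; hence they coincide.\<close>

lemma antitone_rearrangement:
  fixes F :: "5 \<Rightarrow> real"
  assumes F: "\<And>k. k \<noteq> c \<Longrightarrow> F (k + 1) \<le> F k" and G: "\<And>k. k \<noteq> c \<Longrightarrow> F (\<tau> (k + 1)) \<le> F (\<tau> k)"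
    and bij: "bij \<tau>"
  shows "F (\<tau> k) = F k"
proof -
  have eq: "{k. t \<le> F (\<tau> k)} = {k. t \<le> F k}" for t
  proof -
    let ?A = "{k. t \<le> F (\<tau> k)}" and ?B = "{k. t \<le> F k}"
    have "\<tau> ` ?A = ?B" using bij by (auto simp: bij_def surj_def image_iff)
    then have card: "card ?A = card ?B"
      using card_image[of \<tau> ?A] bij by (metis bij_is_inj inj_on_subset subset_UNIV)
    have downA: "k \<in> ?A" if "l \<in> ?A" "idx c k \<le> idx c l" for k l
      using antitone_idx[of c "\<lambda>k. F (\<tau> k)", OF G that(2)] that(1) by auto
    have downB: "k \<in> ?B" if "l \<in> ?B" "idx c k \<le> idx c l" for k l
      using antitone_idx[of c F, OF F that(2)] that(1) by auto
    have "?A \<subseteq> ?B \<or> ?B \<subseteq> ?A"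
    proof (rule ccontr)
      assume "\<not> ?thesis"
      then obtain a b where "a \<in> ?A" "a \<notin> ?B" "b \<in> ?B" "b \<notin> ?A" by blast
      then show False using downA[of a b] downB[of b a] nat_le_linear[of "idx c a" "idx c b"] by blast
    qed
    then show ?thesis using card by (metis card_subset_eq finite)
  qed
  have "k \<in> {l. F k \<le> F l}" by simp
  then have "F k \<le> F (\<tau> k)" using eq[of "F k"] by blast
  moreover have "k \<in> {l. F (\<tau> k) \<le> F (\<tau> l)}" by simp
  then have "F (\<tau> k) \<le> F k" using eq[of "F (\<tau> k)"] by blast
  ultimately show ?thesis by simp
qed

lemma increasing_idx_imp_id:
  assumes "bij \<sigma>" "\<And>k. k \<noteq> c \<Longrightarrow> idx c (\<sigma> k) \<le> idx c (\<sigma> (k + 1))"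
  shows "\<sigma> = id"
proof -
  let ?t = "\<lambda>n. idx c (\<sigma> (pos c n))"
  have inc: "?t n < ?t (Suc n)" if "n < 4" for n
  proof -
    have "pos c n \<noteq> c" using that idx_pos[of n c] idx_eq_4[of c c] by auto
    then have "?t n \<le> ?t (Suc n)" using assms(2)[of "pos c n"] by (simp add: pos_Suc)
    moreover have "?t n \<noteq> ?t (Suc n)"
    proof -
      have "pos c n \<noteq> pos c (Suc n)" by (simp add: pos_Suc)
      then show ?thesis using assms(1) by (simp add: idx_inj bij_is_inj inj_eq)
    qed
    ultimately show ?thesis by simp
  qed
  have "?t 0 < ?t 1" "?t 1 < ?t 2" "?t 2 < ?t 3" "?t 3 < ?t 4" "?t 4 < 5"
    using inc[of 0] inc[of 1] inc[of 2] inc[of 3] idx_less by (simp_all add: eval_nat_numeral)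
  then have "?t 0 = 0 \<and> ?t 1 = 1 \<and> ?t 2 = 2 \<and> ?t 3 = 3 \<and> ?t 4 = 4" by presburger
  then have "?t n = n" if "n < 5" for n
    using that less_Suc_eq by (auto simp: eval_nat_numeral less_Suc_eq)
  then have "idx c (\<sigma> k) = idx c k" for k
    using idx_less[of c k] pos_idx[of c k] by metis
  then show ?thesis by (auto simp: idx_inj)
qed

lemma equiv_imp_trans: "equiv A r \<Longrightarrow> trans r"
  by (auto elim: equivE)

section \<open>The permutation graph and its residues\<close>

definition perms :: "(5 \<Rightarrow> 5) set" where
  "perms = {\<pi>. bij \<pi>}"

text \<open>Composition on the right exchanges positions, not values, so the colour is the type of
  the wall crossed and adjacent alcoves have matching vertex labels.\<close>

definition perm_adj :: "5 \<Rightarrow> (5 \<Rightarrow> 5) \<Rightarrow> 5 \<Rightarrow> 5" where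
  "perm_adj k \<pi> = \<pi> \<circ> swap k"

lemma card_perms: "card perms = 120"
proof -
  have "perms = {p. p permutes (UNIV :: 5 set)}"
    by (auto simp: perms_def permutes_bij intro: bij_imp_permutes)
  then show ?thesis using card_permutations[of "UNIV :: 5 set" 5] by (simp add: fact_numeral)
qed

lemma perm_adj_involution: "perm_adj k (perm_adj k \<pi>) = \<pi>"
  by (simp add: perm_adj_def fun_eq_iff)

lemma colored_graph_perms: "colored_graph perms perm_adj"
  unfolding colored_graph_def
proof (intro conjI allI impI)
  show "finite perms" by simp
  fix k \<pi> assume p: "\<pi> \<in> perms"
  show "perm_adj k \<pi> \<in> perms" using p by (simp add: perms_def perm_adj_def bij_comp)
  show "perm_adj k (perm_adj k \<pi>) = \<pi>" by (rule perm_adj_involution)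
  show "perm_adj k \<pi> \<noteq> \<pi>"
  proof
    assume "perm_adj k \<pi> = \<pi>"
    then have "\<pi> (k + 1) = \<pi> k" by (metis comp_apply perm_adj_def transpose_apply_first)
    then have "k + 1 = k" using p by (simp add: perms_def bij_is_inj inj_eq)
    then show False by simp
  qed
qed

text \<open>Bubble sort: a permutation preserving a weakly decreasing profile is a product of adjacent
  transpositions exchanging equal values.\<close>
lemma comp_rel_perms:
  fixes s :: "5 \<Rightarrow> real"
  assumes "\<pi> \<in> perms" "bij \<tau>" "\<And>k. k \<noteq> c \<Longrightarrow> s (k + 1) \<le> s k"
    and C: "\<And>k. k \<noteq> c \<Longrightarrow> s k = s (k + 1) \<Longrightarrow> k \<in> C" and \<tau>: "\<And>k. s (\<tau> k) = s k"
  shows "(\<pi>, \<pi> \<circ> \<tau>) \<in> comp_rel perms perm_adj C"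
proof -
  let ?R = "comp_rel perms perm_adj C"
  note eqR = comp_rel_equiv[OF colored_graph_perms, of C]
  \<comment> \<open>The weight measures sortedness: a maximizer within the class has no adjacent
    inversion and so is the identity.\<close>
  let ?W = "\<lambda>\<sigma>. \<Sum>k\<in>UNIV. idx c k * real (idx c (\<sigma> k))"
  let ?B = "{\<sigma>. bij \<sigma> \<and> (\<forall>k. s (\<sigma> k) = s k) \<and> (\<pi> \<circ> \<tau>, \<pi> \<circ> \<sigma>) \<in> ?R}"
  have "\<pi> \<circ> \<tau> \<in> perms" using assms(1,2) by (simp add: perms_def bij_comp)
  then have "\<tau> \<in> ?B" using assms(2) \<tau> by (auto simp: comp_rel_def)
  then have B: "finite ?B" "?B \<noteq> {}" by auto
  obtain \<sigma> where \<sigma>: "\<sigma> \<in> ?B" "\<And>r. r \<in> ?B \<Longrightarrow> - ?W \<sigma> \<le> - ?W r"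
    using finite_has_minimizer[OF B, of "\<lambda>\<sigma>. - ?W \<sigma>"] by blast
  \<comment> \<open>An inversion at \<open>k\<close> is compatible with the monotonicity of
    \<open>s\<close> only if \<open>s k = s (k + 1)\<close>; then the colour \<open>k\<close> is
    available to remove it.\<close>
  have "idx c (\<sigma> k) \<le> idx c (\<sigma> (k + 1))" if k: "k \<noteq> c" for k
  proof (rule ccontr)
    assume neg: "\<not> ?thesis"
    then have "s (\<sigma> k) \<le> s (\<sigma> (k + 1))" by (intro antitone_idx[of c s, OF assms(3)]) auto
    then have eq: "s k = s (k + 1)" using \<sigma>(1) assms(3)[OF k] by simp
    have "\<pi> \<circ> \<sigma> \<in> perms" using \<sigma>(1) assms(1) by (simp add: perms_def bij_comp)
    then have "(\<pi> \<circ> \<sigma>, perm_adj k (\<pi> \<circ> \<sigma>)) \<in> ?R"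
      by (intro comp_rel_step[OF colored_graph_perms] C[OF k eq])
    then have "(\<pi> \<circ> \<tau>, \<pi> \<circ> (\<sigma> \<circ> swap k)) \<in> ?R"
      using \<sigma>(1) transD[OF equiv_imp_trans[OF eqR]] by (auto simp: perm_adj_def comp_assoc)
    moreover have "s ((\<sigma> \<circ> swap k) l) = s l" for l
      using \<sigma>(1) eq by (auto simp: Transposition.transpose_def)
    ultimately have "\<sigma> \<circ> swap k \<in> ?B" using \<sigma>(1) by (auto intro: bij_comp)
    from \<sigma>(2)[OF this] show False
      using sum_idx_swap[OF k, of "\<lambda>l. real (idx c (\<sigma> l))"] neg by simp
  qed
  then have "\<sigma> = id" using \<sigma>(1) by (intro increasing_idx_imp_id) auto
  then have "(\<pi> \<circ> \<tau>, \<pi>) \<in> ?R" using \<sigma>(1) by simp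
  then show ?thesis using eqR by (auto elim!: equivE dest: symD)
qed

text \<open>For a constant profile the bubble sort may use every colour except \<open>c\<close> and
  reaches all permutations.\<close>

lemma g_comp_perms_connected: "g_comp perms perm_adj (UNIV - {c}) = 1"
proof -
  let ?R = "comp_rel perms perm_adj (UNIV - {c})"
  have "(\<pi>, \<sigma>) \<in> ?R" if "\<pi> \<in> perms" "\<sigma> \<in> perms" for \<pi> \<sigma>
  proof -
    have "bij (inv \<pi> \<circ> \<sigma>)" using that by (simp add: perms_def bij_comp bij_imp_bij_inv)
    then have "(\<pi>, \<pi> \<circ> (inv \<pi> \<circ> \<sigma>)) \<in> ?R"
      using that by (intro comp_rel_perms[of _ _ c "\<lambda>_. 0"]) auto
    moreover have "\<pi> \<circ> (inv \<pi> \<circ> \<sigma>) = \<sigma>"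
      using that by (auto simp: perms_def fun_eq_iff bij_is_surj surj_f_inv_f)
    ultimately show ?thesis by simp
  qed
  then have "?R `` {\<pi>} = perms" if "\<pi> \<in> perms" for \<pi> using that by (auto simp: comp_rel_def)
  then have "120 * g_comp perms perm_adj (UNIV - {c}) = card perms"
    using card_perms by (intro g_comp_uniform[OF colored_graph_perms]) simp
  then show ?thesis by (simp add: card_perms)
qed

text \<open>The two transpositions are disjoint, so all these residues are squares, and 30 = 120 /
  4.\<close>

lemma g_comp_perms_commuting: "g_comp perms perm_adj {k, k + 2} = 30"
proof -
  have d: "k \<noteq> k + 1" "k \<noteq> k + 2" "k \<noteq> k + 3" "k + 1 \<noteq> k + 2" "k + 1 \<noteq> k + 3" "k + 2 \<noteq> k + 3"
    by simp_all
  have k3: "k + 2 + 1 = k + 3" by simp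
  have comm: "swap k \<circ> swap (k + 2) = swap (k + 2) \<circ> swap k"
    using d unfolding k3 by (auto simp: Transposition.transpose_def fun_eq_iff)
  have "card (comp_rel perms perm_adj {k, k + 2} `` {\<pi>}) = 4" if p: "\<pi> \<in> perms" for \<pi>
  proof -
    let ?a = "perm_adj k" and ?b = "perm_adj (k + 2)" and ?R = "comp_rel perms perm_adj {k, k + 2}"
    have c: "?a (?b \<sigma>) = ?b (?a \<sigma>)" for \<sigma>
      using comm unfolding perm_adj_def by (simp add: comp_assoc)
    have inv: "?a (?a \<sigma>) = \<sigma>" "?b (?b \<sigma>) = \<sigma>" for \<sigma> by (rule perm_adj_involution)+
    have V: "?a \<sigma> \<in> perms" "?b \<sigma> \<in> perms" "?a \<sigma> \<noteq> \<sigma>" "?b \<sigma> \<noteq> \<sigma>" if "\<sigma> \<in> perms" for \<sigma>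
      using colored_graph_perms that by (auto simp: colored_graph_def)
    have "?R `` {\<pi>} = {\<pi>, ?a \<pi>, ?b \<pi>, ?a (?b \<pi>)}"
    proof (rule comp_rel_class_eqI[OF colored_graph_perms])
      show "{\<pi>, ?a \<pi>, ?b \<pi>, ?a (?b \<pi>)} \<in> color_closed perms perm_adj {k, k + 2}"
        using p V inv c by (auto simp: color_closed_def)
      have 1: "(\<pi>, \<pi>) \<in> ?R" using p by (simp add: comp_rel_def)
      have 2: "(\<pi>, ?a \<pi>) \<in> ?R" "(\<pi>, ?b \<pi>) \<in> ?R" "(?b \<pi>, ?a (?b \<pi>)) \<in> ?R"
        using p V by (auto intro!: comp_rel_step[OF colored_graph_perms])
      then have "(\<pi>, ?a (?b \<pi>)) \<in> ?R"
        using transD[OF equiv_imp_trans[OF comp_rel_equiv[OF colored_graph_perms]]] by blast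
      then show "\<And>w. w \<in> {\<pi>, ?a \<pi>, ?b \<pi>, ?a (?b \<pi>)} \<Longrightarrow> (\<pi>, w) \<in> ?R" using 1 2 by auto
    qed simp
    moreover have "?a \<pi> \<noteq> ?b \<pi>"
    proof
      assume "?a \<pi> = ?b \<pi>"
      then have "\<pi> (swap k k) = \<pi> (swap (k + 2) k)" by (metis comp_apply perm_adj_def)
      then have "swap k k = swap (k + 2) k" using p by (simp add: perms_def bij_is_inj inj_eq)
      then show False using d unfolding k3 by (simp add: Transposition.transpose_def split: if_splits)
    qed
    moreover from this have "?a (?b \<pi>) \<noteq> \<pi>" using inv by metis
    ultimately show ?thesis using p V[of \<pi>] V[of "?b \<pi>"] V[of "?a \<pi>"] c by auto
  qed
  then have "4 * g_comp perms perm_adj {k, k + 2} = card perms"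
    by (intro g_comp_uniform[OF colored_graph_perms]) simp
  then show ?thesis by (simp add: card_perms)
qed

section \<open>The Coxeter complex of affine type A4\<close>

text \<open>The point of the fundamental alcove with barycentric coordinates \<open>x\<close>, in
  the hyperplane of sum 0. The vertex labelled 4 is the origin; the vertex labelled
  \<open>j \<noteq> 4\<close> is a fundamental coweight, the indicator of the positions up to
  \<open>j\<close> minus its mean.\<close>

definition profile :: "real^5 \<Rightarrow> 5 \<Rightarrow> real" where
  "profile x k = (\<Sum>j\<in>UNIV. if idx 4 k \<le> idx 4 j \<and> j \<noteq> 4 then x $ j else 0)
     - (\<Sum>l\<in>UNIV. \<Sum>j\<in>UNIV. if idx 4 l \<le> idx 4 j \<and> j \<noteq> 4 then x $ j else 0) / 5"

lemma idx_4_0: "idx 4 0 = 0"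
  using idx_first[of 4] by (simp add: five_eq_0)

text \<open>Barycentric coordinates are the gaps along the cycle; the 1 at the colour 4 belongs to
  the affine wall.\<close>

lemma profile_gap:
  assumes "x \<in> std_simplex"
  shows "profile x k - profile x (k + 1) = x $ k - (if k = 4 then 1 else 0)"
proof -
  let ?r = "\<lambda>k. \<Sum>j\<in>UNIV. if idx 4 k \<le> idx 4 j \<and> j \<noteq> 4 then x $ j else 0"
  have "?r k - ?r (k + 1) = x $ k - (if k = 4 then 1 else 0)"
  proof (cases "k = 4")
    case True
    have "?r 4 = 0"
    proof (rule sum.neutral, rule ballI)
      fix j :: 5
      show "(if idx 4 4 \<le> idx 4 j \<and> j \<noteq> 4 then x $ j else 0) = 0"
        using idx_less[of 4 j] idx_eq_4[of 4 j] idx_eq_4[of 4 4] by auto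
    qed
    moreover have "?r 0 = (\<Sum>j\<in>UNIV. x $ j - (if j = 4 then x $ j else 0))"
      by (intro sum.cong) (auto simp: idx_4_0)
    then have "?r 0 = 1 - x $ 4" using assms by (simp add: sum_subtractf std_simplex_def)
    moreover have "(4::5) + 1 = 0" by simp
    ultimately show ?thesis using True by (simp add: five_eq_0)
  next
    case False
    have "?r k - ?r (k + 1) = (\<Sum>j\<in>UNIV. if j = k then x $ j else 0)"
      unfolding sum_subtractf[symmetric]
    proof (rule sum.cong[OF refl])
      fix j :: 5
      have "idx 4 k \<le> idx 4 j \<longleftrightarrow> j = k \<or> Suc (idx 4 k) \<le> idx 4 j"
        using idx_inj[of 4 j k] by auto
      then show "(if idx 4 k \<le> idx 4 j \<and> j \<noteq> 4 then x $ j else 0) -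
          (if idx 4 (k + 1) \<le> idx 4 j \<and> j \<noteq> 4 then x $ j else 0) = (if j = k then x $ j else 0)"
        using False idx_Suc[OF False] by auto
    qed
    then show ?thesis using False by simp
  qed
  then show ?thesis by (simp add: profile_def)
qed

lemma profile_sum: "(\<Sum>k\<in>UNIV. profile x k) = 0"
  by (simp add: profile_def sum_subtractf)

text \<open>The gaps determine the values up to a common constant, which the sum fixes.\<close>

lemma profile_unique:
  assumes "x \<in> std_simplex" "\<And>k. F k - F (k + 1) = x $ k - (if k = 4 then 1 else 0)"
    "(\<Sum>k\<in>UNIV. F k) = 0"
  shows "F k = profile x k"
proof -
  let ?D = "\<lambda>k. F k - profile x k"
  have step: "?D (k + 1) = ?D k" for k using assms(2)[of k] profile_gap[OF assms(1), of k] by simp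
  have const: "?D (pos 4 n) = ?D (pos 4 0)" for n
    by (induction n) (simp_all add: pos_Suc step)
  have "?D k = ?D (pos 4 0)" for k using const[of "idx 4 k"] by (simp add: pos_idx)
  moreover have "(\<Sum>k\<in>UNIV. ?D k) = 0" by (simp add: sum_subtractf assms(3) profile_sum)
  ultimately have "(\<Sum>k\<in>(UNIV :: 5 set). ?D (pos 4 0)) = 0" by (metis (no_types, lifting) sum.cong)
  then have "?D (pos 4 0) = 0" by simp
  then show ?thesis using \<open>\<And>k. ?D k = ?D (pos 4 0)\<close>[of k] by simp
qed

lemma profile_antitone:
  assumes "x \<in> std_simplex" "k \<noteq> 4"
  shows "profile x (k + 1) \<le> profile x k"
proof -
  have "x $ k \<ge> 0" using assms(1) by (simp add: std_simplex_def)
  then show ?thesis using profile_gap[OF assms(1), of k] assms(2) by simp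
qed

lemma profile_bounds:
  assumes "x \<in> std_simplex"
  shows "profile x k \<le> profile x 0" "profile x 4 \<le> profile x k" "profile x 0 = profile x 4 + 1 - x $ 4"
proof -
  show "profile x k \<le> profile x 0"
    by (rule antitone_idx[of 4]) (use profile_antitone[OF assms] idx_4_0 in auto)
  show "profile x 4 \<le> profile x k"
    by (rule antitone_idx[of 4]) (use profile_antitone[OF assms] idx_less[of 4 k] idx_eq_4[of 4 4] in auto)
  show "profile x 0 = profile x 4 + 1 - x $ 4"
    using profile_gap[OF assms, of 4] by (simp add: five_eq_0)
qed

text \<open>The fundamental alcove moved by a permutation of coordinates: coordinate
  \<open>\<pi> k\<close> receives the value at position \<open>k\<close> of the decreasing
  profile.\<close>

definition alcove_point :: "(5 \<Rightarrow> 5) \<Rightarrow> real^5 \<Rightarrow> 5 \<Rightarrow> real" where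
  "alcove_point \<pi> x a = profile x (inv \<pi> a)"

lemma alcove_point_sum:
  assumes "\<pi> \<in> perms"
  shows "(\<Sum>a\<in>UNIV. alcove_point \<pi> x a) = 0"
proof -
  have "bij (inv \<pi>)" using assms by (simp add: perms_def bij_imp_bij_inv)
  then have "(\<Sum>a\<in>UNIV. profile x (inv \<pi> a)) = (\<Sum>k\<in>UNIV. profile x k)" by (rule sum.reindex_bij_betw)
  then show ?thesis by (simp add: alcove_point_def profile_sum)
qed

lemma alcove_point_perm: "\<pi> \<in> perms \<Longrightarrow> alcove_point \<pi> x (\<pi> k) = profile x k"
  by (simp add: alcove_point_def perms_def bij_is_inj inv_f_f)

text \<open>Forgetting coordinate 4 identifies the hyperplane of sum 0 with R^4, and its integer
  vectors, the root lattice, with all of Z^4.\<close>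

definition emb :: "4 \<Rightarrow> 5" where
  "emb = (SOME f. bij_betw f UNIV (UNIV - {4}))"

lemma bij_emb: "bij_betw emb UNIV (UNIV - {4})"
proof -
  have "card (UNIV :: 4 set) = card (UNIV - {4 :: 5})" by simp
  then have "\<exists>f :: 4 \<Rightarrow> 5. bij_betw f UNIV (UNIV - {4})" by (intro finite_same_card_bij) auto
  then show ?thesis unfolding emb_def by (rule someI_ex)
qed

definition chart :: "(5 \<Rightarrow> 5) \<Rightarrow> real^5 \<Rightarrow> real^4" where
  "chart \<pi> x = (\<chi> i. alcove_point \<pi> x (emb i))"

lemma linear_chart: "linear (chart \<pi>)"
proof -
  have if_add: "(if P then a + b else 0) = (if P then a else 0) + (if P then b else (0::real))" for P a b by simp
  have if_mult: "(if P then c * a else 0) = c * (if P then a else (0::real))" for P a c by simp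
  have "profile (x + y) k = profile x k + profile y k" for x y k
    unfolding profile_def by (simp only: vector_add_component if_add sum.distrib add_divide_distrib)
  moreover have "profile (c *\<^sub>R x) k = c * profile x k" for c x k
    unfolding profile_def vector_scaleR_component real_scaleR_def if_mult sum_distrib_left[symmetric]
    by (simp add: right_diff_distrib)
  ultimately show ?thesis
    by (intro linearI) (simp_all add: chart_def alcove_point_def vec_eq_iff)
qed

text \<open>The forgotten coordinate is minus the sum of the others, so integrality of four
  differences gives the fifth.\<close>

lemma torus_cover_chart_iff:
  assumes "\<pi> \<in> perms" "\<sigma> \<in> perms"
  shows "torus_cover (chart \<pi> x) = torus_cover (chart \<sigma> y) \<longleftrightarrow>
    (\<forall>a. alcove_point \<pi> x a - alcove_point \<sigma> y a \<in> \<int>)"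
proof
  let ?d = "\<lambda>a. alcove_point \<pi> x a - alcove_point \<sigma> y a"
  assume "torus_cover (chart \<pi> x) = torus_cover (chart \<sigma> y)"
  then have "?d (emb i) \<in> \<int>" for i by (simp add: torus_cover_eq_iff chart_def)
  then have ne: "?d a \<in> \<int>" if "a \<noteq> 4" for a
    using bij_emb that unfolding bij_betw_def by (metis DiffI UNIV_I imageE singletonD)
  have "(\<Sum>a\<in>UNIV. ?d a) = 0" using assms by (simp add: sum_subtractf alcove_point_sum)
  then have "?d 4 = - (\<Sum>a\<in>UNIV - {4}. ?d a)" by (simp add: sum.remove[of UNIV 4])
  also have "\<dots> \<in> \<int>" using ne by (intro Ints_minus Ints_sum) auto
  finally have "?d 4 \<in> \<int>" .
  then have "?d a \<in> \<int>" for a using ne[of a] by (cases "a = 4") simp_all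
  then show "\<forall>a. ?d a \<in> \<int>" by simp
qed (simp add: torus_cover_eq_iff chart_def)

lemma alcove_point_perm_adj:
  assumes "\<pi> \<in> perms"
  shows "alcove_point (perm_adj j \<pi>) x a = profile x (swap j (inv \<pi> a))"
proof -
  have "inv (perm_adj j \<pi>) = swap j \<circ> inv \<pi>"
    using assms unfolding perm_adj_def perms_def by (subst o_inv_distrib) auto
  then show ?thesis by (simp add: alcove_point_def)
qed

text \<open>On the wall \<open>x $ j = 0\<close> the two exchanged values are equal, or differ by 1
  if \<open>j = 4\<close>; modulo integers nothing changes.\<close>

lemma chart_glue:
  assumes "\<pi> \<in> perms" "x \<in> std_simplex" "x $ j = 0"
  shows "torus_cover (chart (perm_adj j \<pi>) x) = torus_cover (chart \<pi> x)"
proof -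
  have V: "perm_adj j \<pi> \<in> perms" using colored_graph_perms assms(1) by (simp add: colored_graph_def)
  have gap: "profile x j - profile x (j + 1) \<in> \<int>"
    using profile_gap[OF assms(2), of j] assms(3) by simp
  then have gap': "profile x (j + 1) - profile x j \<in> \<int>" by (metis Ints_minus minus_diff_eq)
  have "profile x (swap j k) - profile x k \<in> \<int>" for k
    using gap gap' by (cases "k = j"; cases "k = j + 1") (simp_all add: transpose_apply_other)
  then show ?thesis
    unfolding torus_cover_chart_iff[OF V assms(1)] alcove_point_perm_adj[OF assms(1)]
    by (simp add: alcove_point_def)
qed

text \<open>The alcoves around the origin fill the region of width at most 1: sort the coordinates
  and read off the gaps.\<close>

lemma ex_chart_of_narrow:
  fixes y :: "5 \<Rightarrow> real"
  assumes "(\<Sum>a\<in>UNIV. y a) = 0" "\<And>a b. y a - y b \<le> 1"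
  shows "\<exists>\<pi>\<in>perms. \<exists>x\<in>std_simplex. \<forall>a. alcove_point \<pi> x a = y a"
proof -
  obtain q :: "5 \<Rightarrow> 5" where q: "bij q" "\<And>k. k \<noteq> 4 \<Longrightarrow> y (q (k + 1)) \<le> y (q k)"
    using sorting_bijection[of 4 y] by blast
  \<comment> \<open>The gaps of the sorted values, with 1 added at the affine wall as
    \<open>profile_gap\<close> prescribes.\<close>
  define x :: "real^5" where "x = (\<chi> k. y (q k) - y (q (k + 1)) + (if k = 4 then 1 else 0))"
  have "bij (\<lambda>k :: 5. k + 1)" by (rule bij_betw_byWitness[where f' = "\<lambda>k. k - 1"]) auto
  then have "(\<Sum>k\<in>UNIV. y (q (k + 1))) = (\<Sum>k\<in>UNIV. y (q k))" by (rule sum.reindex_bij_betw)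
  then have "(\<Sum>k\<in>UNIV. x $ k) = 1" by (simp add: x_def sum.distrib sum_subtractf)
  moreover have "0 \<le> x $ k" for k
    using q(2)[of k] assms(2)[of "q (k + 1)" "q k"] by (auto simp: x_def)
  ultimately have x: "x \<in> std_simplex" by (simp add: std_simplex_def)
  have "(\<Sum>k\<in>UNIV. y (q k)) = 0" using assms(1) sum.reindex_bij_betw[OF q(1), of y] by simp
  then have F: "y (q k) = profile x k" for k
    by (intro profile_unique[OF x]) (simp_all add: x_def)
  have "alcove_point q x a = y a" for a
    using F[of "inv q a"] q(1) by (simp add: alcove_point_def bij_is_surj surj_f_inv_f)
  then show ?thesis using q(1) x by (auto simp: perms_def)
qed

text \<open>Subtract 1 from the \<open>N\<close> largest fractional parts, where \<open>N\<close> is their sum.\<close>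
lemma ex_narrow_representative:
  fixes y :: "5 \<Rightarrow> real"
  assumes "(\<Sum>a\<in>UNIV. y a) = 0"
  obtains z where "(\<Sum>a\<in>UNIV. z a) = 0" "\<And>a b. z a - z b \<le> 1" "\<And>a. z a - y a \<in> \<int>"
proof -
  let ?f = "\<lambda>a. frac (y a)"
  obtain q :: "5 \<Rightarrow> 5" where q: "bij q" "\<And>k. k \<noteq> 4 \<Longrightarrow> ?f (q (k + 1)) \<le> ?f (q k)"
    using sorting_bijection[of 4 ?f] by blast
  have sum_f: "(\<Sum>a\<in>UNIV. ?f a) = of_int (- (\<Sum>a\<in>UNIV. \<lfloor>y a\<rfloor>))"
    using assms by (simp add: frac_def sum_subtractf)
  define N where "N = nat (- (\<Sum>a\<in>UNIV. \<lfloor>y a\<rfloor>))"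
  have "(\<Sum>a\<in>UNIV. ?f a) \<ge> 0" by (intro sum_nonneg) simp
  then have "0 \<le> - (\<Sum>a\<in>UNIV. \<lfloor>y a\<rfloor>)" unfolding sum_f by (simp only: of_int_0_le_iff)
  then have N: "(\<Sum>a\<in>UNIV. ?f a) = of_nat N" by (simp only: sum_f N_def of_nat_nat)
  have "(\<Sum>a\<in>UNIV. ?f a) < (\<Sum>a\<in>(UNIV :: 5 set). 1)"
    by (intro sum_strict_mono) (auto simp: frac_lt_1)
  then have "N < 5" using N by simp
  \<comment> \<open>The positions of the \<open>N\<close> largest fractional parts;
    \<open>N < 5\<close> ensures that there are that many.\<close>
  define K where "K = {k. idx 4 k < N}"
  have "idx 4 ` K = {..<N}"
  proof (intro equalityI subsetI)
    fix n assume "n \<in> {..<N}"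
    then have "idx 4 (pos 4 n) = n" "n < N" using \<open>N < 5\<close> by (auto intro: idx_pos)
    then show "n \<in> idx 4 ` K" by (intro image_eqI[of _ _ "pos 4 n"]) (auto simp: K_def)
  qed (auto simp: K_def)
  moreover have "inj_on (idx 4) K" by (auto simp: inj_on_def idx_inj)
  ultimately have cardK: "card K = N" by (metis card_image card_lessThan)
  define z where "z a = ?f a - (if inv q a \<in> K then 1 else 0)" for a
  show ?thesis
  proof (rule that)
    have "(\<Sum>a\<in>UNIV. if inv q a \<in> K then 1 else (0::real)) = (\<Sum>k\<in>UNIV. if k \<in> K then 1 else 0)"
      using q(1) by (intro sum.reindex_bij_betw bij_imp_bij_inv)
    also have "\<dots> = N" by (simp add: cardK sum.If_cases)
    finally show "(\<Sum>a\<in>UNIV. z a) = 0" using N by (simp add: z_def sum_subtractf)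
    show "z a - z b \<le> 1" for a b
    proof -
      have f: "?f a < 1" "?f b < 1" "0 \<le> ?f a" "0 \<le> ?f b" by (simp_all add: frac_lt_1)
      have qq: "q (inv q a) = a" "q (inv q b) = b" using q(1) by (simp_all add: bij_is_surj surj_f_inv_f)
      have "?f a \<le> ?f b" if "inv q b \<in> K" "inv q a \<notin> K"
        using antitone_idx[of 4 "\<lambda>k. ?f (q k)" "inv q b" "inv q a"] q(2) that qq by (auto simp: K_def)
      moreover have "?f a - ?f b \<le> 1" using f by linarith
      ultimately show ?thesis by (auto simp: z_def)
    qed
    show "z a - y a \<in> \<int>" for a by (simp add: z_def frac_def)
  qed
qed

lemma chart_surj: "\<exists>\<pi>\<in>perms. \<exists>x\<in>std_simplex. torus_cover (chart \<pi> x) = torus_cover p"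
proof -
  let ?e = "inv_into UNIV emb"
  define y where "y a = (if a = 4 then - (\<Sum>i\<in>UNIV. p $ i) else p $ (?e a))" for a
  have emb4: "emb i \<noteq> 4" for i using bij_emb by (auto simp: bij_betw_def)
  have e: "?e (emb i) = i" for i using bij_emb by (simp add: bij_betw_def)
  have y: "y (emb i) = p $ i" for i by (simp add: y_def emb4 e)
  have "(\<Sum>a\<in>UNIV - {4}. y a) = (\<Sum>i\<in>UNIV. p $ i)"
    using sum.reindex_bij_betw[OF bij_emb, of y] by (simp add: y)
  then have "(\<Sum>a\<in>UNIV. y a) = 0" by (simp add: sum.remove[of UNIV 4] y_def)
  then obtain z where z: "(\<Sum>a\<in>UNIV. z a) = 0" "\<And>a b. z a - z b \<le> 1" "\<And>a. z a - y a \<in> \<int>"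
    using ex_narrow_representative by blast
  obtain \<pi> x where x: "\<pi> \<in> perms" "x \<in> std_simplex" "\<And>a. alcove_point \<pi> x a = z a"
    using ex_chart_of_narrow[OF z(1,2)] by blast
  have "torus_cover (chart \<pi> x) = torus_cover p"
    using z(3) x(3) by (simp add: torus_cover_eq_iff chart_def flip: y)
  then show ?thesis using x by blast
qed

text \<open>Both sides list the same coordinates in decreasing order, so \<open>\<tau>\<close>
  preserves the profile. Equal neighbouring values mean a vanishing coordinate of \<open>x\<close>,
  so bubble sort crosses only walls through the point.\<close>

lemma alcove_point_eq_imp:
  assumes "\<pi> \<in> perms" "\<sigma> \<in> perms" "x \<in> std_simplex" "y \<in> std_simplex"
    and eq: "\<And>a. alcove_point \<pi> x a = alcove_point \<sigma> y a"
  shows "x = y \<and> (\<pi>, \<sigma>) \<in> comp_rel perms perm_adj {j. x $ j = 0}"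
proof -
  define \<tau> where "\<tau> = inv \<pi> \<circ> \<sigma>"
  have \<tau>: "bij \<tau>" using assms by (simp add: \<tau>_def perms_def bij_comp bij_imp_bij_inv)
  have \<sigma>: "\<pi> \<circ> \<tau> = \<sigma>" using assms(1) by (auto simp: \<tau>_def perms_def fun_eq_iff bij_is_surj surj_f_inv_f)
  have yx: "profile y k = profile x (\<tau> k)" for k
    using eq[of "\<sigma> k"] alcove_point_perm[OF assms(2), of y k] by (simp add: alcove_point_def \<tau>_def)
  have inv: "profile x (\<tau> k) = profile x k" for k
    by (rule antitone_rearrangement[of 4])
      (use profile_antitone[OF assms(3)] profile_antitone[OF assms(4)] yx \<tau> in auto)
  have "x $ k = y $ k" for k
    using profile_gap[OF assms(3), of k] profile_gap[OF assms(4), of k] yx inv by simp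
  then have "x = y" by (simp add: vec_eq_iff)
  moreover have "(\<pi>, \<pi> \<circ> \<tau>) \<in> comp_rel perms perm_adj {j. x $ j = 0}"
  proof (rule comp_rel_perms[where c = 4 and s = "profile x"])
    show "k \<in> {j. x $ j = 0}" if "k \<noteq> 4" "profile x k = profile x (k + 1)" for k
      using profile_gap[OF assms(3), of k] that by simp
  qed (use assms \<tau> profile_antitone inv in auto)
  ultimately show ?thesis by (simp add: \<sigma>)
qed

text \<open>Two points of the Coxeter complex that differ by a root lattice vector \<open>d\<close>: while \<open>d \<noteq> 0\<close>, crossing
  the affine wall, after reordering equal coordinates, shortens \<open>d\<close> by a root.\<close>
lemma alcove_point_cong_imp:
  assumes "\<pi> \<in> perms" "\<sigma> \<in> perms" "x \<in> std_simplex" "y \<in> std_simplex"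
    and "\<And>a. alcove_point \<pi> x a - alcove_point \<sigma> y a = of_int (d a)"
  shows "x = y \<and> (\<pi>, \<sigma>) \<in> comp_rel perms perm_adj {j. x $ j = 0}"
  using assms
proof (induction "nat (\<Sum>a\<in>UNIV. \<bar>d a\<bar>)" arbitrary: \<pi> d rule: less_induct)
  case less
  note \<pi> = less.prems(1) and \<sigma> = less.prems(2) and x = less.prems(3) and y = less.prems(4) and d = less.prems(5)
  let ?Y = "alcove_point \<pi> x" and ?Z = "alcove_point \<sigma> y" and ?R = "comp_rel perms perm_adj {j. x $ j = 0}"
  show ?case
  proof (cases "\<forall>a. d a = 0")
    case True
    then have "?Y a = ?Z a" for a using d[of a] by simp
    then show ?thesis by (rule alcove_point_eq_imp[OF \<pi> \<sigma> x y])
  next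
    case False
    have "(\<Sum>a\<in>UNIV. real_of_int (d a)) = 0"
      using alcove_point_sum[OF \<pi>, of x] alcove_point_sum[OF \<sigma>, of y] by (simp add: sum_subtractf flip: d)
    then have sum_d: "(\<Sum>a\<in>UNIV. d a) = 0" by (metis of_int_eq_0_iff of_int_sum)
    have "\<exists>i. d i > 0"
    proof (rule ccontr)
      assume "\<not> ?thesis"
      then have "\<forall>a\<in>UNIV. - d a = 0"
        using sum_nonneg_eq_0_iff[of UNIV "\<lambda>a. - d a"] sum_d by (simp add: sum_negf not_less)
      then show False using False by simp
    qed
    then obtain i where i: "d i \<ge> 1" by (metis zless_imp_add1_zle add_0)
    have "\<exists>j. d j < 0"
    proof (rule ccontr)
      assume "\<not> ?thesis"
      then have "\<forall>a\<in>UNIV. d a = 0"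
        using sum_nonneg_eq_0_iff[of UNIV d] sum_d by (simp add: not_less)
      then show False using False by simp
    qed
    then obtain j where "d j < 0" by blast
    then have j: "d j \<le> -1" by simp
    \<comment> \<open>An alcove has width at most 1. Since \<open>d\<close> raises \<open>i\<close>
      and lowers \<open>j\<close> by at least 1, the point of \<open>\<pi>\<close> attains width 1:
      \<open>i\<close> carries the maximum, \<open>j\<close> the minimum, and the point lies on the
      affine wall.\<close>
    have "?Z j - ?Z i \<le> 1"
    proof -
      have "?Z j - ?Z i \<le> profile y 0 - profile y 4"
        using profile_bounds(1,2)[OF y] by (simp add: alcove_point_def diff_mono)
      also have "\<dots> \<le> 1" using profile_bounds(3)[OF y] y by (simp add: std_simplex_def)
      finally show ?thesis .
    qed
    moreover have "real_of_int (d i) \<ge> 1" "real_of_int (d j) \<le> of_int (- 1)"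
      using i j by (simp_all only: of_int_le_iff of_int_1_le_iff)
    then have "?Y i - ?Z i \<ge> 1" "?Y j - ?Z j \<le> -1" using d by simp_all
    ultimately have Yij: "?Y i - ?Y j \<ge> 1" by linarith
    have Y0: "?Y i \<le> profile x 0" and Y4: "profile x 4 \<le> ?Y j" and x4: "x $ 4 \<ge> 0"
      using profile_bounds(1,2)[OF x] x by (auto simp: alcove_point_def std_simplex_def)
    have Yi: "?Y i = profile x 0" and Yj: "?Y j = profile x 4" and x4: "x $ 4 = 0"
      using Yij Y0 Y4 x4 profile_bounds(3)[OF x] by linarith+
    have neq: "i \<noteq> j" using i j by auto
    \<comment> \<open>Exchanges only values with equal coordinates, so the point stays the same;
      \<open>i\<close> and \<open>j\<close> are brought to positions 0 and 4, the two that colour 4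
      exchanges.\<close>
    define \<rho> where "\<rho> = Transposition.transpose j (Transposition.transpose i (\<pi> 0) (\<pi> 4)) \<circ> Transposition.transpose i (\<pi> 0) \<circ> \<pi>"
    have \<rho>: "\<rho> \<in> perms" using \<pi> by (simp add: perms_def \<rho>_def bij_comp)
    have \<pi>04: "\<pi> 0 \<noteq> \<pi> 4" using \<pi> by (simp add: perms_def bij_is_inj inj_eq)
    have tr1: "Transposition.transpose i (\<pi> 0) (\<pi> 4) \<noteq> i"
      using \<pi>04 by (auto simp: Transposition.transpose_def)
    have \<rho>0: "\<rho> 0 = i" using tr1 neq by (simp add: \<rho>_def transpose_apply_other)
    have \<rho>4: "\<rho> 4 = j" by (simp add: \<rho>_def)
    have Y1: "?Y (Transposition.transpose i (\<pi> 0) a) = ?Y a" for a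
      using Yi alcove_point_perm[OF \<pi>, of x 0] by (auto simp: Transposition.transpose_def)
    have Y2: "?Y (Transposition.transpose j (Transposition.transpose i (\<pi> 0) (\<pi> 4)) a) = ?Y a" for a
      using Yj Y1[of "\<pi> 4"] alcove_point_perm[OF \<pi>, of x 4] by (auto simp: Transposition.transpose_def)
    have "?Y (\<rho> k) = profile x k" for k
      using Y1 Y2 alcove_point_perm[OF \<pi>] by (simp add: \<rho>_def)
    then have "?Y a = alcove_point \<rho> x a" for a
      using \<rho> by (metis alcove_point_def bij_is_surj mem_Collect_eq perms_def surj_f_inv_f)
    then have \<pi>\<rho>: "(\<pi>, \<rho>) \<in> ?R" and Y\<rho>: "\<And>a. alcove_point \<rho> x a = ?Y a"
      using alcove_point_eq_imp[OF \<pi> \<rho> x x] by auto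
    let ?\<rho> = "perm_adj 4 \<rho>"
    have \<rho>': "?\<rho> \<in> perms" using colored_graph_perms \<rho> by (simp add: colored_graph_def)
    have step: "(\<rho>, ?\<rho>) \<in> ?R" using \<rho> x4 by (intro comp_rel_step[OF colored_graph_perms]) auto
    \<comment> \<open>Crossing the affine wall subtracts the root with 1 at \<open>i\<close> and -1
      at \<open>j\<close>, which lowers the sum of absolute values by 2.\<close>
    define d' where "d' a = d a - (if a = i then 1 else 0) + (if a = j then 1 else 0)" for a
    have "\<rho> (inv \<rho> a) = a" for a using \<rho> by (simp add: perms_def bij_is_surj surj_f_inv_f)
    then have inv\<rho>: "inv \<rho> i = 0" "inv \<rho> j = 4" "\<And>a. inv \<rho> a = 0 \<Longrightarrow> a = i" "\<And>a. inv \<rho> a = 4 \<Longrightarrow> a = j"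
      using \<rho> \<rho>0 \<rho>4 by (auto simp: perms_def bij_is_inj inv_f_eq) metis+
    have swap4: "swap 4 = Transposition.transpose 4 0" by (simp add: five_eq_0)
    have "alcove_point ?\<rho> x a = ?Y a - (if a = i then 1 else 0) + (if a = j then 1 else 0)" for a
    proof -
      consider "a = i" | "a = j" | "inv \<rho> a \<noteq> 0" "inv \<rho> a \<noteq> 4" "a \<noteq> i" "a \<noteq> j" using inv\<rho> by blast
      then show ?thesis
      proof cases
        case 1
        then show ?thesis using neq Yi profile_bounds(3)[OF x] x4
          unfolding alcove_point_perm_adj[OF \<rho>] swap4 by (simp add: inv\<rho>)
      next
        case 2
        then show ?thesis using neq Yj profile_bounds(3)[OF x] x4
          unfolding alcove_point_perm_adj[OF \<rho>] swap4 by (simp add: inv\<rho>)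
      next
        case 3
        then show ?thesis using Y\<rho>[of a]
          unfolding alcove_point_perm_adj[OF \<rho>] swap4 by (simp add: transpose_apply_other alcove_point_def)
      qed
    qed
    then have d'_eq: "alcove_point ?\<rho> x a - ?Z a = of_int (d' a)" for a
      using d by (simp add: d'_def)
    have "\<bar>d' a\<bar> = \<bar>d a\<bar> - (if a = i then 1 else 0) - (if a = j then 1 else 0)" for a
      using i j neq by (auto simp: d'_def)
    then have "(\<Sum>a\<in>UNIV. \<bar>d' a\<bar>) = (\<Sum>a\<in>UNIV. \<bar>d a\<bar>) - 2" by (simp add: sum_subtractf)
    moreover have "(\<Sum>a\<in>UNIV. \<bar>d' a\<bar>) \<ge> 0" by (intro sum_nonneg) simp
    ultimately have "nat (\<Sum>a\<in>UNIV. \<bar>d' a\<bar>) < nat (\<Sum>a\<in>UNIV. \<bar>d a\<bar>)" by simp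
    from less.hyps[OF this \<rho>' \<sigma> x y d'_eq]
    have IH: "x = y" "(?\<rho>, \<sigma>) \<in> ?R" by auto
    have "(\<pi>, \<sigma>) \<in> ?R"
      using transD[OF equiv_imp_trans[OF comp_rel_equiv[OF colored_graph_perms]]] \<pi>\<rho> step IH(2) by blast
    then show ?thesis using IH(1) by blast
  qed
qed

section \<open>The crystallization\<close>

lemma std_simplex_convex_hull: "std_simplex = convex hull (range (\<lambda>i. axis i 1 :: real^'c::finite))"
proof (intro equalityI subsetI)
  fix x :: "real^'c" assume x: "x \<in> std_simplex"
  have "x = (\<Sum>i\<in>UNIV. x $ i *\<^sub>R axis i 1)"
    using basis_expansion[of x] by (simp add: scalar_mult_eq_scaleR)
  also have "\<dots> \<in> convex hull (range (\<lambda>i. axis i 1))"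
    using x by (intro convex_sum) (auto simp: std_simplex_def hull_inc)
  finally show "x \<in> convex hull (range (\<lambda>i. axis i 1))" .
next
  fix x :: "real^'c" assume "x \<in> convex hull (range (\<lambda>i. axis i 1))"
  then show "x \<in> std_simplex"
    using hull_minimal[of "range (\<lambda>i. axis i 1)" std_simplex convex] convex_std_simplex axis_std_simplex
    by blast
qed

text \<open>Charts are linear on whole simplices, so the trivial subdivision serves;
  \<open>alcove_point_cong_imp\<close> converts congruence modulo the lattice into a chain of wall
  crossings.\<close>

lemma K_PL_perms: "K_PL_homeomorphic_T4 perms perm_adj"
  unfolding K_PL_homeomorphic_T4_def
proof (intro exI[of _ "\<lambda>\<pi> x. torus_cover (chart \<pi> x)"] conjI ballI allI impI subsetI)
  show "pl_simplex_to_torus4 (\<lambda>x. torus_cover (chart \<pi> x))" for \<pi>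
    unfolding pl_simplex_to_torus4_def
  proof (rule exI[of _ "chart \<pi>"], intro conjI ballI exI[of _ "{std_simplex}"])
    fix t :: "(real^5) set" assume "t \<in> {std_simplex}"
    then have t: "t = std_simplex" by simp
    have "finite (range (\<lambda>i :: 5. axis i 1 :: real^5))" by simp
    then show "\<exists>F. finite F \<and> t = convex hull F" using std_simplex_convex_hull t by blast
    show "\<exists>L b. linear L \<and> (\<forall>x\<in>t. chart \<pi> x = L x + b)"
      by (intro exI[of _ "chart \<pi>"] exI[of _ 0]) (simp add: linear_chart)
  qed auto
  show "torus_cover (chart \<pi> x) \<in> torus4" for \<pi> x using range_torus_cover by blast
  show "torus_cover (chart \<pi> x) = torus_cover (chart \<sigma> y)" if "((\<pi>, x), \<sigma>, y) \<in> K_ident perms perm_adj" for \<pi> x \<sigma> y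
    using that chart_glue by (auto simp: K_ident_def)
  show "z \<in> (\<Union>\<pi>\<in>perms. (\<lambda>x. torus_cover (chart \<pi> x)) ` std_simplex)" if z: "z \<in> torus4" for z
  proof -
    obtain p where "z = torus_cover p" using z range_torus_cover by blast
    then show ?thesis using chart_surj[of p] by (auto simp: image_iff intro: sym)
  qed
  fix \<pi> \<sigma> x y
  assume V: "\<pi> \<in> perms" "\<sigma> \<in> perms" "x \<in> std_simplex" "y \<in> std_simplex"
    and eq: "torus_cover (chart \<pi> x) = torus_cover (chart \<sigma> y)"
  then have "\<forall>a. \<exists>n :: int. alcove_point \<pi> x a - alcove_point \<sigma> y a = of_int n"
    using torus_cover_chart_iff[OF V(1,2)] by (auto elim!: Ints_cases)
  then obtain d :: "5 \<Rightarrow> int" where "\<And>a. alcove_point \<pi> x a - alcove_point \<sigma> y a = of_int (d a)" by metis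
  from alcove_point_cong_imp[OF V this]
  have "x = y" and "(\<pi>, \<sigma>) \<in> {(\<pi>, perm_adj j \<pi>) | \<pi> j. \<pi> \<in> perms \<and> j \<in> {j. x $ j = 0}}\<^sup>*"
    by (auto simp: comp_rel_def)
  from this(2) have "((\<pi>, x), (\<sigma>, x)) \<in> (K_ident perms perm_adj)\<^sup>*"
  proof (induction rule: rtrancl_induct)
    case (step \<sigma> \<sigma>')
    then have "((\<sigma>, x), (\<sigma>', x)) \<in> K_ident perms perm_adj" using V(3) by (auto simp: K_ident_def)
    then show ?case using step.IH by (rule rtrancl_into_rtrancl[rotated])
  qed simp
  then show "((\<pi>, x), \<sigma>, y) \<in> (K_ident perms perm_adj)\<^sup>*" using \<open>x = y\<close> by simp
qed

section \<open>Relabelling the vertices by natural numbers\<close>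

context
  fixes V :: "'v set" and W :: "'w set" and \<phi> :: "'v \<Rightarrow> 'w" and adj :: "'c::finite \<Rightarrow> 'v \<Rightarrow> 'v"
  assumes \<phi>: "bij_betw \<phi> V W" and graph: "colored_graph V adj"
begin

definition transported_adj :: "'c \<Rightarrow> 'w \<Rightarrow> 'w" where
  "transported_adj c w = \<phi> (adj c (inv_into V \<phi> w))"

lemma inv_\<phi>: "v \<in> V \<Longrightarrow> inv_into V \<phi> (\<phi> v) = v" "w \<in> W \<Longrightarrow> \<phi> (inv_into V \<phi> w) = w"
    "w \<in> W \<Longrightarrow> inv_into V \<phi> w \<in> V" "v \<in> V \<Longrightarrow> \<phi> v \<in> W"
  using \<phi> bij_betw_inv_into_left[OF \<phi>] bij_betw_inv_into_right[OF \<phi>] bij_betwE[OF \<phi>]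
    bij_betwE[OF bij_betw_inv_into[OF \<phi>]] by auto

lemma adj_in: "v \<in> V \<Longrightarrow> adj c v \<in> V" "v \<in> V \<Longrightarrow> adj c v \<noteq> v" "v \<in> V \<Longrightarrow> adj c (adj c v) = v"
  using graph by (auto simp: colored_graph_def)

lemma transported_adj_\<phi>: "v \<in> V \<Longrightarrow> transported_adj c (\<phi> v) = \<phi> (adj c v)"
  by (simp add: transported_adj_def inv_\<phi>)

lemma colored_graph_transported: "colored_graph W transported_adj"
  unfolding colored_graph_def
proof (intro conjI allI impI)
  show "finite W" using \<phi> graph by (metis bij_betw_finite colored_graph_def)
  fix c w assume w: "w \<in> W"
  show "transported_adj c w \<in> W" using w by (simp add: transported_adj_def inv_\<phi> adj_in)
  show "transported_adj c w \<noteq> w" using w by (metis adj_in(1,2) inv_\<phi> transported_adj_def)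
  show "transported_adj c (transported_adj c w) = w"
    using w by (simp add: transported_adj_def inv_\<phi> adj_in)
qed

text \<open>Residue numbers are compared by counting closed sets, on which the bijection acts by
  images.\<close>

lemma g_comp_transported: "g_comp W transported_adj C = g_comp V adj C"
proof -
  have "bij_betw ((`) \<phi>) (color_closed V adj C) (color_closed W transported_adj C)"
  proof (rule bij_betw_imageI)
    show "inj_on ((`) \<phi>) (color_closed V adj C)"
      using \<phi> by (intro inj_on_subset[OF inj_on_image_Pow color_closed_subset]) (simp add: bij_betw_def)
    show "(`) \<phi> ` color_closed V adj C = color_closed W transported_adj C"
    proof (intro equalityI subsetI)
      fix X assume "X \<in> (`) \<phi> ` color_closed V adj C"
      then obtain S where S: "S \<in> color_closed V adj C" "X = \<phi> ` S" by auto
      then show "X \<in> color_closed W transported_adj C"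
        using transported_adj_\<phi> inv_\<phi>(4) unfolding color_closed_def by force
    next
      fix X assume X: "X \<in> color_closed W transported_adj C"
      let ?S = "inv_into V \<phi> ` X"
      have XW: "X \<subseteq> W" using X by (simp add: color_closed_def)
      have "adj c v \<in> ?S" if v: "v \<in> ?S" and c: "c \<in> C" for c v
      proof -
        obtain w where w: "w \<in> X" "v = inv_into V \<phi> w" using v by auto
        have "transported_adj c w \<in> X" using X w c by (simp add: color_closed_def)
        moreover have "inv_into V \<phi> (transported_adj c w) = adj c v"
          using w XW by (auto simp: transported_adj_def inv_\<phi> adj_in subset_iff)
        ultimately show ?thesis by (metis imageI)
      qed
      then have "?S \<in> color_closed V adj C" using XW inv_\<phi>(3) by (auto simp: color_closed_def)
      moreover have "X = \<phi> ` ?S" using XW inv_\<phi>(2) by (force simp: image_image)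
      ultimately show "X \<in> (`) \<phi> ` color_closed V adj C" by blast
    qed
  qed
  then have "card (color_closed V adj C) = card (color_closed W transported_adj C)" by (rule bij_betw_same_card)
  then show ?thesis by (simp add: card_color_closed[OF graph] card_color_closed[OF colored_graph_transported])
qed

lemma K_PL_transported:
  assumes "K_PL_homeomorphic_T4 V adj"
  shows "K_PL_homeomorphic_T4 W transported_adj"
proof -
  let ?i = "inv_into V \<phi>"
  obtain f where f: "\<And>v. v \<in> V \<Longrightarrow> pl_simplex_to_torus4 (f v)" "\<And>v x. v \<in> V \<Longrightarrow> x \<in> std_simplex \<Longrightarrow> f v x \<in> torus4"
    "\<And>v x w y. ((v, x), (w, y)) \<in> K_ident V adj \<Longrightarrow> f v x = f w y"
    "torus4 \<subseteq> (\<Union>v\<in>V. f v ` std_simplex)"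
    "\<And>v w x y. v \<in> V \<Longrightarrow> w \<in> V \<Longrightarrow> x \<in> std_simplex \<Longrightarrow> y \<in> std_simplex \<Longrightarrow>
       f v x = f w y \<Longrightarrow> ((v, x), (w, y)) \<in> (K_ident V adj)\<^sup>*"
    using assms unfolding K_PL_homeomorphic_T4_def by (elim exE conjE) (rule that, auto)
  have K1: "((?i v, x), (?i w, y)) \<in> K_ident V adj" if "((v, x), (w, y)) \<in> K_ident W transported_adj" for v w x y
    using that by (auto simp: K_ident_def transported_adj_def inv_\<phi> adj_in)
  have K2: "(map_prod \<phi> id p, map_prod \<phi> id q) \<in> K_ident W transported_adj" if "(p, q) \<in> K_ident V adj" for p q
    using that by (auto simp: K_ident_def transported_adj_\<phi> inv_\<phi>)
  have K3: "(map_prod \<phi> id p, map_prod \<phi> id q) \<in> (K_ident W transported_adj)\<^sup>*"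
    if "(p, q) \<in> (K_ident V adj)\<^sup>*" for p q
    using that by (induction rule: rtrancl_induct) (blast intro: rtrancl_into_rtrancl K2)+
  show ?thesis
    unfolding K_PL_homeomorphic_T4_def
  proof (intro exI[of _ "\<lambda>w. f (?i w)"] conjI ballI allI impI subsetI)
    show "pl_simplex_to_torus4 (f (?i w))" if "w \<in> W" for w using f(1) inv_\<phi>(3) that by blast
    show "f (?i w) x \<in> torus4" if "w \<in> W" "x \<in> std_simplex" for w x using f(2) inv_\<phi>(3) that by blast
    show "f (?i v) x = f (?i w) y" if "((v, x), w, y) \<in> K_ident W transported_adj" for v x w y
      using f(3) K1 that by blast
    show "z \<in> (\<Union>w\<in>W. f (?i w) ` std_simplex)" if "z \<in> torus4" for z
    proof -
      obtain v where v: "v \<in> V" "z \<in> f v ` std_simplex" using f(4) \<open>z \<in> torus4\<close> by blast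
      then show ?thesis using inv_\<phi>(1,4) by (intro UN_I[of "\<phi> v"]) simp_all
    qed
    show "((v, x), w, y) \<in> (K_ident W transported_adj)\<^sup>*"
      if "v \<in> W" "w \<in> W" "x \<in> std_simplex" "y \<in> std_simplex" "f (?i v) x = f (?i w) y" for v w x y
    proof -
      have "((?i v, x), (?i w, y)) \<in> (K_ident V adj)\<^sup>*" using that inv_\<phi>(3) by (intro f(5)) auto
      then have "(map_prod \<phi> id (?i v, x), map_prod \<phi> id (?i w, y)) \<in> (K_ident W transported_adj)\<^sup>*"
        by (rule K3)
      then show ?thesis using that by (simp add: inv_\<phi>)
    qed
  qed
qed

end

text \<open>The order 0, 2, 4, 1, 3 of the colours, in which cyclic neighbours are commuting
  transpositions. The inverse of 2 modulo 5 is 3.\<close>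

lemma bij_double_5: "bij_betw (\<lambda>i. of_nat (2 * i) :: 5) {..<5} UNIV"
proof -
  have "bij (\<lambda>k :: 5. 2 * k)"
    by (rule bij_betw_byWitness[where f' = "\<lambda>k. 3 * k"]) (simp_all add: mult.assoc[symmetric] five_eq_0)
  from bij_betw_trans[OF bij_5_exists this] show ?thesis by (simp add: o_def)
qed

lemma ex_crystallization:
  "\<exists>(V :: nat set) (adj :: 5 \<Rightarrow> nat \<Rightarrow> nat). crystallization_T4 V adj \<and> card V = 120 \<and> reg_genus_graph V adj = 16"
proof -
  have "card perms = card {..<120 :: nat}" by (simp add: card_perms)
  then obtain \<phi> where \<phi>: "bij_betw \<phi> perms {..<120 :: nat}"
    using finite_same_card_bij[of perms "{..<120 :: nat}"] by auto
  define adj where "adj = transported_adj perms \<phi> perm_adj"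
  note graph = colored_graph_transported[OF \<phi> colored_graph_perms, folded adj_def]
  note g = g_comp_transported[OF \<phi> colored_graph_perms, folded adj_def]
  note PL = K_PL_transported[OF \<phi> colored_graph_perms K_PL_perms, folded adj_def]
  have gem: "gem_T4 {..<120} adj" using graph PL by (simp add: gem_T4_def)
  let ?e = "\<lambda>i. of_nat (2 * i) :: 5"
  \<comment> \<open>All five consecutive pairs contribute 30, so \<open>chi_eps\<close> is 5 * 30 -
    3 * 60 = -30 and the genus is 1 + 15.\<close>
  have "g_comp {..<120} adj {?e i, ?e ((i + 1) mod 5)} = 30" if "i < 5" for i
  proof -
    have "?e ((i + 1) mod 5) = ?e i + 2"
      using that by (cases "i = 4") (simp_all add: algebra_simps)
    then show ?thesis using g_comp_perms_commuting[of "?e i"] by (simp add: g)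
  qed
  then have "rho_eps {..<120} adj ?e = 16" by (simp add: rho_eps_def chi_eps_def)
  then have "16 \<in> rho_eps {..<120} adj ` {e. bij_betw e {..<CARD(5)} UNIV}"
    using bij_double_5 by (intro image_eqI[of _ _ ?e]) auto
  then have "reg_genus_graph {..<120} adj \<le> 16"
    unfolding reg_genus_graph_def by (intro Min_le finite_rho_eps)
  moreover have "reg_genus_graph {..<120} adj \<ge> 16" by (rule reg_genus_graph_ge[OF gem])
  moreover have "crystallization_T4 {..<120} adj"
    using gem by (simp add: crystallization_T4_def g g_comp_perms_connected)
  ultimately show ?thesis by (intro exI[of _ "{..<120}"] exI[of _ adj]) simp
qed

theorem theorem3p2:
  shows "regular_genus_T4 = 16 \<and>
    (\<exists>(V :: nat set) (adj :: 5 \<Rightarrow> nat \<Rightarrow> nat).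
        crystallization_T4 V adj \<and> card V = 120 \<and> reg_genus_graph V adj = 16)"
proof
  let ?G = "{reg_genus_graph V adj | (V :: nat set) (adj :: 5 \<Rightarrow> nat \<Rightarrow> nat). gem_T4 V adj}"
  obtain V :: "nat set" and adj :: "5 \<Rightarrow> nat \<Rightarrow> nat"
    where "crystallization_T4 V adj" "reg_genus_graph V adj = 16"
    using ex_crystallization by blast
  then have "16 \<in> ?G" unfolding crystallization_T4_def by (metis (mono_tags, lifting) mem_Collect_eq)
  then show "regular_genus_T4 = 16"
    unfolding regular_genus_T4_def by (rule cInf_eq_minimum) (auto intro: reg_genus_graph_ge)
qed (rule ex_crystallization)

end
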